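(* Let $\mathbb{F}$ be a field, let $G$ be a planar cubic bridgeless graph with a garden $\Gamma$ and let $T$ be a basis of $G$. Then the $T$-versal dg-algebra $(\mathcal{A}_T,\partial_T)$ is dg-algebra isomorphic to the invariant dg-algebra of binary sequences $(\mathcal{A}_G,\partial_\Gamma)$. In particular, the dg-isomorphism type of $(\mathcal{A}_T,\partial_T)$ is independent of the basis $T$.
   Context: Dg-algebras over $\mathbb{F}$ are $\mathbb{Z}$-graded with differential of degree $-1$ satisfying $\partial(xy)=\partial(x)y+(-1)^{|x|}x\partial(y)$; dg-algebra isomorphisms are bijective unital degree-preserving $\mathbb{F}$-algebra maps commuting with differentials. Graph. $G$ is a finite connected bridgeless cubic (3-regular) planar graph with a fixed smooth embedding $G\subset(-1,1)\times(-1,1)$. $V,E,F$ are its sets of vertices, edges and bounded faces; $|V|=2g+2$, $|E|=3g+3$, $|F|=g+2$. Write $E=\{e_1,\dots,e_{3g+3}\}$, $F=\{f_1,\dots,f_{g+2}\}$. "$v\in f$" means $v$ lies on the boundary of $f$. Garden. A garden $\Gamma$ consists of: (1) an orientation of each edge; (2) for each $f\in F$ a center $c_f$ in the interior of $f$; (3) threads: for each $f\in F$ and $v\in f$ an embedded closed arc $\tau_f(v)$ from $c_f$ to $v$ with interior in the interior of $f$, and for each vertex $v$ on the exterior of $G$ an arc $\tau_0(v)$ in $[-1,1]^2$ from $v$ to $\{-1\}\times[-1,1]$, disjoint from $G$ away from $v$; threads are mutually disjoint except possibly at common endpoints; (4) for each $f\in F$ an embedded path $\gamma_f$ (tine) in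 $[-1,1]^2$ with endpoints in $[-1,1]\times\{-1\}$ and $[-1,1]\times\{1\}$, passing through $c_f$; tines are mutually disjoint, disjoint from $V$, and transverse to all edges and threads. Tines are oriented from bottom to top, threads towards their endpoint in $V$. Binary sequences. $E(\gamma_f)$ is the set of intersections of $\gamma_f$ with edges, $\alpha(\gamma_f)$ with interiors of threads. A binary sequence along $\gamma_f$ is a lower semicontinuous map $B:\gamma_f\to\{0,1\}$, locally constant away from $E(\gamma_f)\cup\alpha(\gamma_f)\cup\{c_f\}$, which (traversing upwards) must switch at each point of $E(\gamma_f)$, must switch from $0$ to $1$ at $c_f$, and at each point of $\alpha(\gamma_f)$ stays constant or switches from $0$ to $1$. $\mathcal{B}_{a,b}(f)$ is the set of those with initial value $a$ and final value $b$; $\alpha(B)$ is the set of points of $\alpha(\gamma_f)$ where $B$ switches. Weights. $\Lambda_G=\mathbb{F}[e_1^{\pm1},\dots,e_{3g+3}^{\pm1}]$. For $q\in E(\gamma_f)$ on an edge $e$: if $e$ crosses the upward tine from left to right, $H(B,q)=e$ for a switch $0\to1$ and $-e^{-1}$ for $1\to0$; if from right to left, $H(B,q)=-e$ for $0\to1$ and $e^{-1}$ for $1\to0$. For a thread $\tau$ ending at $v$, $H(\tau)=(-1)^{r_v}e_ne_me_k^{-1}$, where $r_v$ is the number of edges at $v$ oriented outward, $e_n,e_m$ are the edges at $v$ adjacent to $\tau$ and $e_k$ the edge opposite to $\tau$. For $p\in\alpha(\gamma_f)$ on the thread $\tau_p$, $\sigma(p)=+1$ if $\tau_p$ crosses the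 upward tine from left to right, $-1$ otherwise. $H(B)=\prod_{q\in E(\gamma_f)}H(B,q)\prod_{p\in\alpha(B)}\sigma(p)H(\tau_p)$. Algebra. $\widetilde{\mathcal{A}}_G$ is the free associative unital $\Lambda_G$-algebra ($\Lambda_G$ central) on $x,y,z$ (degree 2) and $f_1,\dots,f_{g+2}$ (degree 1), with $|e_i|=0$. The differential $\widetilde\partial_\Gamma$ is $0$ on $\Lambda_G$, $\widetilde\partial_\Gamma f_j=\sum_{v\in f_j}H(\tau_{f_j}(v))$, and $\widetilde\partial_\Gamma w=\sum_j\big(\sum_{B\in\mathcal{B}_{a,b}(f_j)}H(B)\big)f_j$ with $(a,b)=(1,1),(1,0),(0,0)$ for $w=x,y,z$, extended by the graded Leibniz rule. Invariant dg-algebra. Adjoin to $\widetilde{\mathcal{A}}_G$ a central invertible $t$ of degree $0$ with zero differential. For $f\in F$, $\varphi_f$ is the automorphism of $\widetilde{\mathcal{A}}_G[t^{\pm1}]$ fixing $t,x,y,z$, with $\varphi_f(e_i)=te_i$ if $e_i$ is on the boundary of $f$ and $\varphi_f(e_i)=e_i$ otherwise, $\varphi_f(f)=t^2f$, $\varphi_f(f_j)=f_j$ for $f_j\ne f$. $\varphi_0$ is given by $\varphi_0(t)=t$, $\varphi_0(e_i)=te_i$, $\varphi_0(f_j)=tf_j$, $\varphi_0(x)=x$, $\varphi_0(y)=t^{-1}y$, $\varphi_0(z)=z$. These generate an action of $\mathbb{Z}^{g+3}$; $\mathcal{A}_G$ is the subalgebra of elements of $\widetilde{\mathcal{A}}_G$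 fixed by it, with $\partial_\Gamma=\widetilde\partial_\Gamma|_{\mathcal{A}_G}$. $T$-versal dg-algebra. A basis of $G$ is a vertex $v_0\in V$ together with a tree $T\subseteq G$ which spans the vertex set $V\setminus\{v_0\}$ (so $T$ has $2g$ edges). Let $\Lambda_T$ be the algebra of Laurent polynomials over $\mathbb{F}$ in the edges of $T$, $Q:\Lambda_G\to\Lambda_T$ the map sending every edge not in $T$ to $1$ and fixing the edges in $T$, $\mathcal{A}_T$ the free associative $\Lambda_T$-algebra on $x,y,z,f_1,\dots,f_{g+2}$ with the same grading, and $Q:\widetilde{\mathcal{A}}_G\to\mathcal{A}_T$ the induced map. $\partial_T$ is the unique map with $Q\circ\widetilde\partial_\Gamma=\partial_T\circ Q$. *)

theory Defs
  imports "HOL-Analysis.Analysis" "HOL-Library.Poly_Mapping"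
begin

section \<open>Laurent polynomials and free algebras\<close>

text \<open>Laurent polynomials over \<open>'k\<close> in the variables \<open>'x\<close> are the group algebra of the free
  abelian group \<open>'x \<Rightarrow>\<^sub>0 int\<close> of exponent vectors.\<close>

type_synonym ('x, 'k) laurent = "('x \<Rightarrow>\<^sub>0 int) \<Rightarrow>\<^sub>0 'k"

definition lvar :: "'x \<Rightarrow> int \<Rightarrow> ('x, 'k::comm_ring_1) laurent" where
  "lvar x n = Poly_Mapping.single (Poly_Mapping.single x n) 1"

text \<open>The ring homomorphism that fixes \<open>'k\<close> and sends each variable \<open>x\<close> to the Laurent monomial
  with exponent vector \<open>s x\<close>.\<close>

definition laurent_subst ::
  "('x \<Rightarrow> 'y \<Rightarrow>\<^sub>0 int) \<Rightarrow> ('x, 'k::comm_ring_1) laurent \<Rightarrow> ('y, 'k) laurent" where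
  "laurent_subst s p =
     (\<Sum>m\<in>Poly_Mapping.keys p. Poly_Mapping.single (frag_extend s m) (Poly_Mapping.lookup p m))"

text \<open>Words under concatenation, written additively because the product of \<open>Poly_Mapping\<close> is the
  convolution over an additive monoid of keys.\<close>

datatype 'g word = Word (letters: "'g list")

instantiation word :: (type) monoid_add
begin
definition "0 = Word []"
definition "u + v = Word (letters u @ letters v)"
instance by standard (simp_all add: zero_word_def plus_word_def)
end

datatype 'f gen = X | Y | Z | Face 'f

fun gen_deg :: "'f gen \<Rightarrow> nat" where
  "gen_deg (Face j) = 1"
| "gen_deg _ = 2"

definition word_deg :: "'f gen word \<Rightarrow> nat" where
  "word_deg w = sum_list (map gen_deg (letters w))"

text \<open>The free associative unital algebra on \<open>'f gen\<close> over the ring of Laurent polynomials in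
  \<open>'x\<close>, whose elements are central.\<close>

type_synonym ('x, 'f, 'k) alg = "'f gen word \<Rightarrow>\<^sub>0 ('x, 'k) laurent"

definition coef :: "('x, 'k::comm_ring_1) laurent \<Rightarrow> ('x, 'f, 'k) alg" where
  "coef l = Poly_Mapping.single 0 l"

definition letter :: "'f gen \<Rightarrow> ('x, 'f, 'k::comm_ring_1) alg" where
  "letter g = Poly_Mapping.single (Word [g]) 1"

definition scal :: "'k::comm_ring_1 \<Rightarrow> ('x, 'f, 'k) alg \<Rightarrow> ('x, 'f, 'k) alg" where
  "scal c a = coef (Poly_Mapping.single 0 c) * a"

definition homogeneous :: "int \<Rightarrow> ('x, 'f, 'k::comm_ring_1) alg set" where
  "homogeneous n = {a. \<forall>w\<in>Poly_Mapping.keys a. int (word_deg w) = n}"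

text \<open>The algebra homomorphism given by \<open>laurent_subst s\<close> on coefficients and by \<open>g \<mapsto> c g \<cdot> g\<close>
  on generators.\<close>

definition alg_subst ::
  "('x \<Rightarrow> 'y \<Rightarrow>\<^sub>0 int) \<Rightarrow> ('f gen \<Rightarrow> ('y, 'k) laurent)
    \<Rightarrow> ('x, 'f, 'k::comm_ring_1) alg \<Rightarrow> ('y, 'f, 'k) alg" where
  "alg_subst s c a = (\<Sum>w\<in>Poly_Mapping.keys a.
     Poly_Mapping.single w
       (laurent_subst s (Poly_Mapping.lookup a w) * prod_list (map c (letters w))))"

fun leibniz :: "('f gen \<Rightarrow> ('x, 'f, 'k::comm_ring_1) alg) \<Rightarrow> 'f gen list \<Rightarrow> ('x, 'f, 'k) alg" where
  "leibniz d [] = 0"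
| "leibniz d (g # w) =
     d g * Poly_Mapping.single (Word w) 1 + (-1) ^ gen_deg g * letter g * leibniz d w"

text \<open>The derivation with value \<open>d g\<close> on generators and zero on the coefficient ring.\<close>

definition derivation ::
  "('f gen \<Rightarrow> ('x, 'f, 'k::comm_ring_1) alg) \<Rightarrow> ('x, 'f, 'k) alg \<Rightarrow> ('x, 'f, 'k) alg" where
  "derivation d a =
     (\<Sum>w\<in>Poly_Mapping.keys a. coef (Poly_Mapping.lookup a w) * leibniz d (letters w))"


section \<open>Dg-algebras\<close>

text \<open>The data of a dg-algebra whose underlying ring is a subring, \<open>dga_carrier\<close>, of a type.\<close>

record ('k, 'a) dga =
  dga_carrier :: "'a set"
  dga_scal :: "'k \<Rightarrow> 'a \<Rightarrow> 'a"
  dga_homog :: "int \<Rightarrow> 'a set"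
  dga_diff :: "'a \<Rightarrow> 'a"

definition dg_isomorphism ::
  "('k, 'a::ring_1) dga \<Rightarrow> ('k, 'b::ring_1) dga \<Rightarrow> ('a \<Rightarrow> 'b) \<Rightarrow> bool" where
  "dg_isomorphism A B \<phi> \<longleftrightarrow>
     bij_betw \<phi> (dga_carrier A) (dga_carrier B) \<and>
     \<phi> 1 = 1 \<and>
     (\<forall>a\<in>dga_carrier A. \<forall>b\<in>dga_carrier A. \<phi> (a + b) = \<phi> a + \<phi> b \<and> \<phi> (a * b) = \<phi> a * \<phi> b) \<and>
     (\<forall>c. \<forall>a\<in>dga_carrier A. \<phi> (dga_scal A c a) = dga_scal B c (\<phi> a)) \<and>
     (\<forall>n. \<forall>a\<in>dga_homog A n. \<phi> a \<in> dga_homog B n) \<and>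
     (\<forall>a\<in>dga_carrier A. dga_diff A a \<in> dga_carrier A \<and> \<phi> (dga_diff A a) = dga_diff B (\<phi> a))"

definition dg_isomorphic :: "('k, 'a::ring_1) dga \<Rightarrow> ('k, 'b::ring_1) dga \<Rightarrow> bool" where
  "dg_isomorphic A B \<longleftrightarrow> (\<exists>\<phi>. dg_isomorphism A B \<phi>)"


section \<open>Multigraphs\<close>

text \<open>A multigraph is given by the set \<open>ends e\<close> of end points of each edge \<open>e\<close>.\<close>

fun walk :: "('e \<Rightarrow> 'v set) \<Rightarrow> 'v \<Rightarrow> 'e list \<Rightarrow> 'v \<Rightarrow> bool" where
  "walk ends u [] v \<longleftrightarrow> u = v"
| "walk ends u (e # es) v \<longleftrightarrow> (\<exists>w. ends e = {u, w} \<and> walk ends w es v)"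

definition graph_connected :: "('e \<Rightarrow> 'v set) \<Rightarrow> 'v set \<Rightarrow> 'e set \<Rightarrow> bool" where
  "graph_connected ends W A \<longleftrightarrow> (\<forall>u\<in>W. \<forall>v\<in>W. \<exists>es. set es \<subseteq> A \<and> walk ends u es v)"

text \<open>Acyclicity is phrased with closed trails: a nonempty closed trail contains a cycle.\<close>

definition graph_tree :: "('e \<Rightarrow> 'v set) \<Rightarrow> 'v set \<Rightarrow> 'e set \<Rightarrow> bool" where
  "graph_tree ends W A \<longleftrightarrow>
     W \<noteq> {} \<and> (\<forall>e\<in>A. ends e \<subseteq> W) \<and> graph_connected ends W A \<and>
     \<not> (\<exists>u es. es \<noteq> [] \<and> distinct es \<and> set es \<subseteq> A \<and> walk ends u es u)"


section \<open>Smooth arcs in the plane\<close>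

text \<open>The plane is \<^typ>\<open>complex\<close>. A smooth arc is an injective path on \<open>[0,1]\<close>, smooth up to the
  end points and with nowhere vanishing velocity.\<close>

definition smooth_arc :: "(real \<Rightarrow> complex) \<Rightarrow> bool" where
  "smooth_arc p \<longleftrightarrow> arc p \<and>
     (\<exists>D. D 0 = p \<and>
        (\<forall>n. \<forall>t\<in>{0..1}. (D n has_vector_derivative D (Suc n) t) (at t within {0..1})) \<and>
        (\<forall>t\<in>{0..1}. D (Suc 0) t \<noteq> 0))"

abbreviation velocity :: "(real \<Rightarrow> complex) \<Rightarrow> real \<Rightarrow> complex" where
  "velocity p t \<equiv> vector_derivative p (at t within {0..1})"

definition velocity_at :: "(real \<Rightarrow> complex) \<Rightarrow> complex \<Rightarrow> complex" where
  "velocity_at p z = velocity p (THE t. t \<in> {0..1} \<and> p t = z)"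

definition arc_interior :: "(real \<Rightarrow> complex) \<Rightarrow> complex set" where
  "arc_interior p = path_image p - {pathstart p, pathfinish p}"

text \<open>\<open>Im (cnj u * w)\<close> is the determinant of the pair \<open>(u, w)\<close>.\<close>

definition transverse :: "(real \<Rightarrow> complex) \<Rightarrow> (real \<Rightarrow> complex) \<Rightarrow> bool" where
  "transverse p q \<longleftrightarrow>
     (\<forall>s\<in>{0..1}. \<forall>t\<in>{0..1}. p s = q t \<longrightarrow> Im (cnj (velocity p s) * velocity q t) \<noteq> 0)"

text \<open>At the common point \<open>z\<close>, \<open>p\<close> crosses \<open>q\<close> from the left to the right of \<open>q\<close>: for \<open>q\<close> moving
  upwards (\<open>\<i>\<close>), \<open>p\<close> moves in the direction \<open>1\<close>.\<close>

definition crosses_left_to_right :: "(real \<Rightarrow> complex) \<Rightarrow> (real \<Rightarrow> complex) \<Rightarrow> complex \<Rightarrow> bool" where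
  "crosses_left_to_right p q z \<longleftrightarrow> Im (cnj (velocity_at p z) * velocity_at q z) > 0"

definition closed_square :: "complex set" where
  "closed_square = {z. \<bar>Re z\<bar> \<le> 1 \<and> \<bar>Im z\<bar> \<le> 1}"


section \<open>Embedded cubic graphs\<close>

text \<open>The edges are indexed by the finite type \<open>'e\<close> and the bounded faces by the finite type \<open>'f\<close>.
  The parametrization of an edge carries no orientation; that is part of a garden. A face is
  represented by its interior, a component of the complement of the graph.\<close>

record ('e, 'f) plane_graph =
  verts :: "complex set"
  edge :: "'e \<Rightarrow> real \<Rightarrow> complex"
  face :: "'f \<Rightarrow> complex set"

definition edge_ends :: "('e, 'f) plane_graph \<Rightarrow> 'e \<Rightarrow> complex set" where
  "edge_ends G e = {pathstart (edge G e), pathfinish (edge G e)}"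

definition edges_at :: "('e, 'f) plane_graph \<Rightarrow> complex \<Rightarrow> 'e set" where
  "edges_at G v = {e. v \<in> edge_ends G e}"

definition points :: "('e, 'f) plane_graph \<Rightarrow> complex set" where
  "points G = verts G \<union> (\<Union>e. path_image (edge G e))"

definition exterior_face :: "('e, 'f) plane_graph \<Rightarrow> complex set" where
  "exterior_face G = \<Union> {C \<in> components (- points G). \<not> bounded C}"

definition edge_on_face :: "('e, 'f) plane_graph \<Rightarrow> 'e \<Rightarrow> 'f \<Rightarrow> bool" where
  "edge_on_face G e j \<longleftrightarrow> path_image (edge G e) \<subseteq> frontier (face G j)"

text \<open>A loop in a cubic graph forces a bridge at its vertex, so nothing is lost by embedding every
  edge as an arc. Multiple edges are allowed.\<close>

definition cubic_plane_graph :: "('e::finite, 'f::finite) plane_graph \<Rightarrow> bool" where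
  "cubic_plane_graph G \<longleftrightarrow>
     finite (verts G) \<and>
     (\<forall>e. smooth_arc (edge G e) \<and> path_image (edge G e) \<inter> verts G = edge_ends G e \<and>
          edge_ends G e \<subseteq> verts G) \<and>
     (\<forall>e e'. e \<noteq> e' \<longrightarrow> path_image (edge G e) \<inter> path_image (edge G e') \<subseteq> verts G) \<and>
     points G \<subseteq> {z. \<bar>Re z\<bar> < 1 \<and> \<bar>Im z\<bar> < 1} \<and>
     (\<forall>v\<in>verts G. card (edges_at G v) = 3) \<and>
     graph_connected (edge_ends G) (verts G) UNIV \<and>
     (\<forall>e. graph_connected (edge_ends G) (verts G) (UNIV - {e})) \<and>
     bij_betw (face G) UNIV {C \<in> components (- points G). bounded C}"

definition graph_basis :: "('e, 'f) plane_graph \<Rightarrow> complex \<Rightarrow> 'e set \<Rightarrow> bool" where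
  "graph_basis G v0 T \<longleftrightarrow> v0 \<in> verts G \<and> graph_tree (edge_ends G) (verts G - {v0}) T"


section \<open>Gardens\<close>

text \<open>\<open>forward e\<close> says that the edge \<open>e\<close> is oriented as parametrized. \<open>thread (Some j) v\<close> is the
  thread from the center of the face \<open>j\<close> to \<open>v\<close>, \<open>thread None v\<close> is the exterior thread at \<open>v\<close>;
  both are parametrized towards \<open>v\<close>. Tines are parametrized upwards.\<close>

record ('e, 'f) garden =
  forward :: "'e \<Rightarrow> bool"
  center :: "'f \<Rightarrow> complex"
  thread :: "'f option \<Rightarrow> complex \<Rightarrow> real \<Rightarrow> complex"
  tine :: "'f \<Rightarrow> real \<Rightarrow> complex"

definition thread_index :: "('e, 'f) plane_graph \<Rightarrow> ('f option \<times> complex) set" where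
  "thread_index G =
     {(Some j, v) |j v. v \<in> verts G \<inter> frontier (face G j)} \<union>
     {(None, v) |v. v \<in> verts G \<inter> frontier (exterior_face G)}"

definition is_garden :: "('e::finite, 'f::finite) plane_graph \<Rightarrow> ('e, 'f) garden \<Rightarrow> bool" where
  "is_garden G \<Gamma> \<longleftrightarrow>
     (\<forall>j. center \<Gamma> j \<in> face G j) \<and>
     (\<forall>(i, v)\<in>thread_index G.
        smooth_arc (thread \<Gamma> i v) \<and> pathfinish (thread \<Gamma> i v) = v \<and>
        (case i of
           Some j \<Rightarrow> pathstart (thread \<Gamma> i v) = center \<Gamma> j \<and>
                     arc_interior (thread \<Gamma> i v) \<subseteq> face G j
         | None \<Rightarrow> Re (pathstart (thread \<Gamma> i v)) = -1 \<and>
                   path_image (thread \<Gamma> i v) \<subseteq> closed_square \<and>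
                   path_image (thread \<Gamma> i v) \<inter> points G = {v})) \<and>
     (\<forall>(i, v)\<in>thread_index G. \<forall>(i', v')\<in>thread_index G. (i, v) \<noteq> (i', v') \<longrightarrow>
        path_image (thread \<Gamma> i v) \<inter> path_image (thread \<Gamma> i' v')
          \<subseteq> {pathstart (thread \<Gamma> i v), v} \<inter> {pathstart (thread \<Gamma> i' v'), v'}) \<and>
     (\<forall>j. smooth_arc (tine \<Gamma> j) \<and> path_image (tine \<Gamma> j) \<subseteq> closed_square \<and>
          Im (pathstart (tine \<Gamma> j)) = -1 \<and> Im (pathfinish (tine \<Gamma> j)) = 1 \<and>
          center \<Gamma> j \<in> path_image (tine \<Gamma> j) \<and>
          path_image (tine \<Gamma> j) \<inter> verts G = {} \<and>
          (\<forall>e. transverse (edge G e) (tine \<Gamma> j)) \<and>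
          (\<forall>(i, v)\<in>thread_index G. transverse (thread \<Gamma> i v) (tine \<Gamma> j))) \<and>
     (\<forall>j j'. j \<noteq> j' \<longrightarrow> path_image (tine \<Gamma> j) \<inter> path_image (tine \<Gamma> j') = {})"

definition oriented_edge :: "('e, 'f) plane_graph \<Rightarrow> ('e, 'f) garden \<Rightarrow> 'e \<Rightarrow> real \<Rightarrow> complex" where
  "oriented_edge G \<Gamma> e = (if forward \<Gamma> e then edge G e else reversepath (edge G e))"


section \<open>Binary sequences\<close>

text \<open>A tine is an embedded arc and is identified with its parameter interval \<open>[0,1]\<close>.\<close>

definition edge_params :: "('e, 'f) plane_graph \<Rightarrow> ('e, 'f) garden \<Rightarrow> 'f \<Rightarrow> real set" where
  "edge_params G \<Gamma> j = {t \<in> {0..1}. \<exists>e. tine \<Gamma> j t \<in> path_image (edge G e)}"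

definition thread_params :: "('e, 'f) plane_graph \<Rightarrow> ('e, 'f) garden \<Rightarrow> 'f \<Rightarrow> real set" where
  "thread_params G \<Gamma> j =
     {t \<in> {0..1}. \<exists>(i, v)\<in>thread_index G. tine \<Gamma> j t \<in> arc_interior (thread \<Gamma> i v)}"

definition locally_constant_at :: "(real \<Rightarrow> nat) \<Rightarrow> real \<Rightarrow> bool" where
  "locally_constant_at B t \<longleftrightarrow> (\<forall>\<^sub>F s in at t within {0..1}. B s = B t)"

definition switches_at :: "(real \<Rightarrow> nat) \<Rightarrow> real \<Rightarrow> nat \<Rightarrow> nat \<Rightarrow> bool" where
  "switches_at B t a b \<longleftrightarrow>
     (\<forall>\<^sub>F s in at t within {0..<t}. B s = a) \<and> (\<forall>\<^sub>F s in at t within {t<..1}. B s = b)"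

definition binary_sequences ::
  "('e, 'f) plane_graph \<Rightarrow> ('e, 'f) garden \<Rightarrow> 'f \<Rightarrow> nat \<Rightarrow> nat \<Rightarrow> (real \<Rightarrow> nat) set" where
  "binary_sequences G \<Gamma> j a b = {B \<in> {0..1} \<rightarrow>\<^sub>E {0, 1}.
     (\<forall>c. openin (top_of_set {0..1}) {t \<in> {0..1}. c < B t}) \<and>
     (\<forall>t\<in>{0..1} - (edge_params G \<Gamma> j \<union> thread_params G \<Gamma> j).
        tine \<Gamma> j t \<noteq> center \<Gamma> j \<longrightarrow> locally_constant_at B t) \<and>
     (\<forall>t\<in>edge_params G \<Gamma> j. switches_at B t 0 1 \<or> switches_at B t 1 0) \<and>
     (\<forall>t\<in>{0..1}. tine \<Gamma> j t = center \<Gamma> j \<longrightarrow> switches_at B t 0 1) \<and>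
     (\<forall>t\<in>thread_params G \<Gamma> j. locally_constant_at B t \<or> switches_at B t 0 1) \<and>
     B 0 = a \<and> B 1 = b}"

definition switch_params ::
  "('e, 'f) plane_graph \<Rightarrow> ('e, 'f) garden \<Rightarrow> 'f \<Rightarrow> (real \<Rightarrow> nat) \<Rightarrow> real set" where
  "switch_params G \<Gamma> j B = {t \<in> thread_params G \<Gamma> j. \<not> locally_constant_at B t}"


section \<open>Weights\<close>

definition edge_weight ::
  "('e, 'f) plane_graph \<Rightarrow> ('e, 'f) garden \<Rightarrow> 'f \<Rightarrow> (real \<Rightarrow> nat) \<Rightarrow> real
    \<Rightarrow> ('e, 'k::comm_ring_1) laurent" where
  "edge_weight G \<Gamma> j B t =
     (let e = (THE e. tine \<Gamma> j t \<in> path_image (edge G e)) in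
      if crosses_left_to_right (oriented_edge G \<Gamma> e) (tine \<Gamma> j) (tine \<Gamma> j t)
      then (if switches_at B t 0 1 then lvar e 1 else - lvar e (-1))
      else (if switches_at B t 0 1 then - lvar e 1 else lvar e (-1)))"

text \<open>Adjacency of an edge to a thread \<open>p\<close> at the end point \<open>v\<close> of \<open>p\<close> is local at \<open>v\<close>: the
  graph cuts a small disc around \<open>v\<close> into sectors, and the edge has to bound the sector through
  which \<open>p\<close> enters \<open>v\<close>.\<close>

definition adjacent_to_thread :: "('e, 'f) plane_graph \<Rightarrow> (real \<Rightarrow> complex) \<Rightarrow> 'e \<Rightarrow> bool" where
  "adjacent_to_thread G p e \<longleftrightarrow>
     (let v = pathfinish p in
      e \<in> edges_at G v \<and>
      (\<forall>\<^sub>F r in at_right 0. \<forall>\<^sub>F s in at_left 1.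
         path_image (edge G e) \<inter> (ball v r - {v}) \<inter>
         closure (connected_component_set (ball v r - points G) (p s)) \<noteq> {}))"

definition thread_weight ::
  "('e::finite, 'f) plane_graph \<Rightarrow> ('e, 'f) garden \<Rightarrow> (real \<Rightarrow> complex)
    \<Rightarrow> ('e, 'k::comm_ring_1) laurent" where
  "thread_weight G \<Gamma> p =
     (let v = pathfinish p in
      (-1) ^ card {e. pathstart (oriented_edge G \<Gamma> e) = v} *
      (\<Prod>e\<in>edges_at G v. lvar e (if adjacent_to_thread G p e then 1 else -1)))"

definition thread_at ::
  "('e, 'f) plane_graph \<Rightarrow> ('e, 'f) garden \<Rightarrow> complex \<Rightarrow> real \<Rightarrow> complex" where
  "thread_at G \<Gamma> z = (case (THE (i, v). (i, v) \<in> thread_index G \<and> z \<in> arc_interior (thread \<Gamma> i v))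
                       of (i, v) \<Rightarrow> thread \<Gamma> i v)"

definition seq_weight ::
  "('e::finite, 'f) plane_graph \<Rightarrow> ('e, 'f) garden \<Rightarrow> 'f \<Rightarrow> (real \<Rightarrow> nat)
    \<Rightarrow> ('e, 'k::comm_ring_1) laurent" where
  "seq_weight G \<Gamma> j B =
     (\<Prod>t\<in>edge_params G \<Gamma> j. edge_weight G \<Gamma> j B t) *
     (\<Prod>t\<in>switch_params G \<Gamma> j B.
        let p = thread_at G \<Gamma> (tine \<Gamma> j t) in
        (if crosses_left_to_right p (tine \<Gamma> j) (tine \<Gamma> j t) then 1 else -1) * thread_weight G \<Gamma> p)"


section \<open>The invariant and the versal dg-algebra\<close>

definition seq_sum ::
  "('e::finite, 'f::finite) plane_graph \<Rightarrow> ('e, 'f) garden \<Rightarrow> nat \<Rightarrow> nat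
    \<Rightarrow> ('e, 'f, 'k::comm_ring_1) alg" where
  "seq_sum G \<Gamma> a b =
     (\<Sum>j\<in>UNIV. coef (\<Sum>B\<in>binary_sequences G \<Gamma> j a b. seq_weight G \<Gamma> j B) * letter (Face j))"

fun gen_diff ::
  "('e::finite, 'f::finite) plane_graph \<Rightarrow> ('e, 'f) garden \<Rightarrow> 'f gen
    \<Rightarrow> ('e, 'f, 'k::comm_ring_1) alg" where
  "gen_diff G \<Gamma> X = seq_sum G \<Gamma> 1 1"
| "gen_diff G \<Gamma> Y = seq_sum G \<Gamma> 1 0"
| "gen_diff G \<Gamma> Z = seq_sum G \<Gamma> 0 0"
| "gen_diff G \<Gamma> (Face j) =
     coef (\<Sum>v\<in>verts G \<inter> frontier (face G j). thread_weight G \<Gamma> (thread \<Gamma> (Some j) v))"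

definition garden_diff ::
  "('e::finite, 'f::finite) plane_graph \<Rightarrow> ('e, 'f) garden
    \<Rightarrow> ('e, 'f, 'k::comm_ring_1) alg \<Rightarrow> ('e, 'f, 'k) alg" where
  "garden_diff G \<Gamma> = derivation (gen_diff G \<Gamma>)"

text \<open>The variables of the algebra with \<open>t\<close> adjoined are \<open>'e option\<close>, where \<open>None\<close> is \<open>t\<close>.\<close>

definition adjoin_t :: "('e, 'f, 'k::comm_ring_1) alg \<Rightarrow> ('e option, 'f, 'k) alg" where
  "adjoin_t = alg_subst (\<lambda>e. frag_of (Some e)) (\<lambda>_. 1)"

definition phi_face ::
  "('e, 'f) plane_graph \<Rightarrow> 'f \<Rightarrow> ('e option, 'f, 'k::comm_ring_1) alg \<Rightarrow> ('e option, 'f, 'k) alg"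
  where
  "phi_face G j = alg_subst
     (\<lambda>x. case x of
        None \<Rightarrow> frag_of None
      | Some e \<Rightarrow> if edge_on_face G e j then frag_of None + frag_of (Some e) else frag_of (Some e))
     (\<lambda>g. if g = Face j then lvar None 2 else 1)"

definition phi_0 :: "('e option, 'f, 'k::comm_ring_1) alg \<Rightarrow> ('e option, 'f, 'k) alg" where
  "phi_0 = alg_subst
     (\<lambda>x. case x of None \<Rightarrow> frag_of None | Some e \<Rightarrow> frag_of None + frag_of (Some e))
     (\<lambda>g. case g of X \<Rightarrow> 1 | Y \<Rightarrow> lvar None (-1) | Z \<Rightarrow> 1 | Face _ \<Rightarrow> lvar None 1)"

definition invariants :: "('e, 'f) plane_graph \<Rightarrow> ('e, 'f, 'k::comm_ring_1) alg set" where
  "invariants G = {a. (\<forall>j. phi_face G j (adjoin_t a) = adjoin_t a) \<and> phi_0 (adjoin_t a) = adjoin_t a}"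

definition invariant_dga ::
  "('e::finite, 'f::finite) plane_graph \<Rightarrow> ('e, 'f) garden \<Rightarrow> ('k::field, ('e, 'f, 'k) alg) dga"
  where
  "invariant_dga G \<Gamma> =
     \<lparr>dga_carrier = invariants G,
      dga_scal = scal,
      dga_homog = (\<lambda>n. invariants G \<inter> homogeneous n),
      dga_diff = garden_diff G \<Gamma>\<rparr>"

text \<open>The algebra over Laurent polynomials in the edges of \<open>T\<close>, realized inside the algebra over
  Laurent polynomials in all edges.\<close>

definition versal_carrier :: "'e set \<Rightarrow> ('e, 'f, 'k::comm_ring_1) alg set" where
  "versal_carrier T =
     {a. \<forall>w. \<forall>m\<in>Poly_Mapping.keys (Poly_Mapping.lookup a w). Poly_Mapping.keys m \<subseteq> T}"

definition versal_quotient :: "'e set \<Rightarrow> ('e, 'f, 'k::comm_ring_1) alg \<Rightarrow> ('e, 'f, 'k) alg" where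
  "versal_quotient T = alg_subst (\<lambda>e. if e \<in> T then frag_of e else 0) (\<lambda>_. 1)"

definition versal_diff ::
  "('e::finite, 'f::finite) plane_graph \<Rightarrow> ('e, 'f) garden \<Rightarrow> 'e set
    \<Rightarrow> ('e, 'f, 'k::comm_ring_1) alg \<Rightarrow> ('e, 'f, 'k) alg" where
  "versal_diff G \<Gamma> T =
     (THE d. d \<in> versal_carrier T \<rightarrow>\<^sub>E versal_carrier T \<and>
             versal_quotient T \<circ> garden_diff G \<Gamma> = d \<circ> versal_quotient T)"

definition versal_dga ::
  "('e::finite, 'f::finite) plane_graph \<Rightarrow> ('e, 'f) garden \<Rightarrow> 'e set
    \<Rightarrow> ('k::field, ('e, 'f, 'k) alg) dga" where
  "versal_dga G \<Gamma> T =
     \<lparr>dga_carrier = versal_carrier T,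
      dga_scal = scal,
      dga_homog = (\<lambda>n. versal_carrier T \<inter> homogeneous n),
      dga_diff = versal_diff G \<Gamma> T\<rparr>"

end

theory Submission
  imports Defs
begin

text \<open>Each generator of the torus action multiplies a monomial by a power of \<open>t\<close>, so the invariant
  algebra is spanned by the monomials all of whose weights vanish, and the isomorphism is the
  restriction of the quotient map \<open>Q\<close> to it. It is bijective because every exponent vector on \<open>T\<close>
  extends uniquely to one on all edges with prescribed weights. For the existence, \<open>T\<close> does not
  separate the plane, so the dual graph of the complement of \<open>T\<close> is connected, and the three edges at
  \<open>v0\<close> form an odd cycle in it; hence its unsigned incidence matrix maps onto the vectors with even
  coordinate sum. Uniqueness follows by counting: each edge added to a spanning tree splits a region.

  The differential preserves the weights: along a tine, the function that is \<open>2 * B - 1\<close> inside a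
  given bounded face and \<open>0\<close> outside vanishes at both ends, and its jumps are the contributions of the
  edges, threads and the center to the weight of \<open>H(B)\<close> times the face generator. For a thread
  ending at a vertex, the weights of the three edges cancel except for the face containing the thread.\<close>


section \<open>Substitutions and gradings\<close>

text \<open>Exponents are integers, so the extension off \<open>T\<close> must exist over the
  integers and not merely over a field. Each bounded face prescribes one incidence sum and
  \<open>phi_0\<close> the sum of all exponents; as every edge has two sides, the incidences over
  all regions add up to twice that sum. Hence prescribing weights is the same as prescribing a value
  on every region, the exterior included, with even total. Incidences carry no signs, so passing a
  unit across an edge changes its sign. In a bipartite dual graph the alternating sum would be an
  obstruction; an odd cycle removes it, since it yields twice a unit vector. Uniqueness may be
  tested over the reals, where dimensions suffice.

  Most of the work is plane topology. Which regions lie beside an edge, which ones meet at a vertex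
  and which one a tine enters are read off from explicit sectors in small discs, and the Jordan
  curve theorem ties these to global regions, along a cycle through the edge that bridgelessness
  provides.\<close>

abbreviation lookup :: "('a \<Rightarrow>\<^sub>0 'b::zero) \<Rightarrow> 'a \<Rightarrow> 'b" where
  "lookup \<equiv> Poly_Mapping.lookup"

abbreviation keys :: "('a \<Rightarrow>\<^sub>0 'b::zero) \<Rightarrow> 'a set" where
  "keys \<equiv> Poly_Mapping.keys"

abbreviation single :: "'a \<Rightarrow> 'b::zero \<Rightarrow> 'a \<Rightarrow>\<^sub>0 'b" where
  "single \<equiv> Poly_Mapping.single"

section \<open>Finite sums over supports\<close>

lemma poly_mapping_expansion:
  fixes p :: "'a \<Rightarrow>\<^sub>0 'b::comm_monoid_add"
  shows "p = (\<Sum>k\<in>keys p. single k (lookup p k))"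
  by (rule poly_mapping_eqI)
     (simp add: lookup_sum lookup_single when_def in_keys_iff)

text \<open>Additive maps are determined by their values on single terms, so this replaces an
  induction on the support whenever both sides of a law are additive.\<close>

lemma poly_mapping_induct_additive [case_names zero single add]:
  fixes p :: "'a \<Rightarrow>\<^sub>0 'b::comm_monoid_add"
  assumes "P 0" "\<And>k c. P (single k c)" "\<And>p q. P p \<Longrightarrow> P q \<Longrightarrow> P (p + q)"
  shows "P p"
proof -
  have "P (\<Sum>k\<in>K. single k (lookup p k))" if "finite K" for K
    using that by induction (auto intro: assms)
  then show ?thesis
    by (subst poly_mapping_expansion) simp
qed

lemma sum_keys_superset:
  assumes "finite S" "keys p \<subseteq> S" "\<And>k. f k 0 = 0"
  shows "(\<Sum>k\<in>keys p. f k (lookup p k)) = (\<Sum>k\<in>S. f k (lookup p k))"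
  using assms by (intro sum.mono_neutral_left) (auto simp: in_keys_iff)

text \<open>The support of a sum can be smaller than the union of the supports because of
  cancellation; since \<open>f k 0 = 0\<close>, all three sums can be taken over that union.\<close>

lemma sum_keys_add:
  assumes z: "\<And>k. f k 0 = 0" and a: "\<And>k x y. f k (x + y) = f k x + f k y"
  shows "(\<Sum>k\<in>keys (p + q). f k (lookup (p + q) k))
    = (\<Sum>k\<in>keys p. f k (lookup p k)) + (\<Sum>k\<in>keys q. f k (lookup q k))"
proof -
  define S where "S = keys p \<union> keys q"
  have S: "finite S" "keys p \<subseteq> S" "keys q \<subseteq> S" "keys (p + q) \<subseteq> S"
    using keys_add[of p q] by (auto simp: S_def)
  show ?thesis
    using sum_keys_superset[where f = f, OF S(1) S(2) z] sum_keys_superset[where f = f, OF S(1) S(3) z]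
      sum_keys_superset[where f = f, OF S(1) S(4) z]
    by (simp add: lookup_add a sum.distrib)
qed

section \<open>Substitutions as ring homomorphisms\<close>

lemma laurent_subst_single [simp]: "laurent_subst s (single m c) = single (frag_extend s m) c"
  by (simp add: laurent_subst_def)

lemma laurent_subst_zero [simp]: "laurent_subst s 0 = 0"
  by (simp add: laurent_subst_def)

lemma laurent_subst_add: "laurent_subst s (p + q) = laurent_subst s p + laurent_subst s q"
  unfolding laurent_subst_def by (rule sum_keys_add) (auto simp: single_add)

lemma laurent_subst_mult: "laurent_subst s (p * q) = laurent_subst s p * laurent_subst s q"
proof (induction p rule: poly_mapping_induct_additive)
  case (single k c)
  show ?case
    by (induction q rule: poly_mapping_induct_additive)
       (simp_all add: mult_single frag_extend_add laurent_subst_add distrib_left)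
qed (simp_all add: laurent_subst_add distrib_right)

lemma laurent_subst_one [simp]: "laurent_subst s 1 = 1"
  using laurent_subst_single[of s 0 1] by simp

lemma alg_subst_single [simp]:
  "alg_subst s c (single w l) = single w (laurent_subst s l * prod_list (map c (letters w)))"
  by (simp add: alg_subst_def)

lemma alg_subst_zero [simp]: "alg_subst s c 0 = 0"
  by (simp add: alg_subst_def)

lemma alg_subst_add: "alg_subst s c (a + b) = alg_subst s c a + alg_subst s c b"
  unfolding alg_subst_def
  by (rule sum_keys_add) (auto simp: laurent_subst_add distrib_right single_add)

lemma alg_subst_sum: "alg_subst s c (sum f A) = (\<Sum>x\<in>A. alg_subst s c (f x))"
  using sum_comp_morphism[of "alg_subst s c" f A] by (simp add: alg_subst_add o_def)

text \<open>\<open>alg_subst\<close> fixes words and only acts on coefficients, so questions about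
  invariance and about lost coefficients can be decided one word at a time.\<close>

lemma lookup_alg_subst:
  "lookup (alg_subst s c a) w = laurent_subst s (lookup a w) * prod_list (map c (letters w))"
  by (simp add: alg_subst_def lookup_sum lookup_single when_def in_keys_iff)

lemma prod_list_map_one [simp]: "prod_list (map (\<lambda>_. 1) xs) = (1 :: 'a::monoid_mult)"
  by (induction xs) auto

text \<open>Generators are left unscaled, the shape shared by \<open>versal_quotient\<close> and
  \<open>adjoin_t\<close>; the scaling automorphisms are handled by weights and enter only through
  the elements they fix.\<close>

lemma alg_subst_mult:
  "alg_subst s (\<lambda>_. 1) (a * b) = alg_subst s (\<lambda>_. 1) a * alg_subst s (\<lambda>_. 1) b"
proof (induction a rule: poly_mapping_induct_additive)
  case (single k c)
  show ?case
    by (induction b rule: poly_mapping_induct_additive)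
       (simp_all add: mult_single laurent_subst_mult alg_subst_add distrib_left)
qed (simp_all add: alg_subst_add distrib_right)

lemma alg_subst_one [simp]: "alg_subst s (\<lambda>_. 1) 1 = 1"
  using alg_subst_single[of s "\<lambda>_. 1" 0 1] by simp

lemma alg_subst_uminus: "alg_subst s c (- a) = - alg_subst s c a"
  using alg_subst_add[of s c a "- a"] by (simp add: minus_unique)

lemma alg_subst_coef [simp]: "alg_subst s (\<lambda>_. 1) (coef l) = coef (laurent_subst s l)"
  by (simp add: coef_def)

lemma coef_add: "coef (k + l) = coef k + coef l"
  by (simp add: coef_def single_add)

lemma coef_mult: "coef (k * l) = coef k * coef l"
  by (simp add: coef_def mult_single)

section \<open>Derivations under substitutions\<close>

lemma derivation_zero [simp]: "derivation d 0 = 0"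
  by (simp add: derivation_def)

lemma derivation_single: "derivation d (single w l) = coef l * leibniz d (letters w)"
  by (simp add: derivation_def coef_def)

lemma derivation_add: "derivation d (a + b) = derivation d a + derivation d b"
  unfolding derivation_def
  by (rule sum_keys_add[where f = "\<lambda>w l. coef l * leibniz d (letters w)"])
     (simp_all add: coef_add distrib_right, simp add: coef_def)

lemma alg_subst_minus_one_power: "alg_subst s (\<lambda>_. 1) ((- 1) ^ n) = (- 1) ^ n"
  by (induction n) (simp_all add: alg_subst_mult alg_subst_uminus)

lemma alg_subst_leibniz:
  "alg_subst s (\<lambda>_. 1) (leibniz d w) = leibniz (\<lambda>g. alg_subst s (\<lambda>_. 1) (d g)) w"
  by (induction w)
     (simp_all add: alg_subst_add alg_subst_mult alg_subst_minus_one_power letter_def)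

text \<open>Both sides are additive, and on a term a multiplicative map fixing the letters turns the
  Leibniz expansion for \<open>d\<close> into the one for the transformed values. This is what lets
  a differential pass to the quotient.\<close>

lemma alg_subst_derivation:
  "alg_subst s (\<lambda>_. 1) (derivation d a)
    = derivation (\<lambda>g. alg_subst s (\<lambda>_. 1) (d g)) (alg_subst s (\<lambda>_. 1) a)"
  by (induction a rule: poly_mapping_induct_additive)
     (simp_all add: derivation_single derivation_add alg_subst_add alg_subst_mult alg_subst_leibniz)

subsection \<open>Weights of monomials\<close>

text \<open>The exponent of \<open>t\<close> that the monomial acquires when each variable
  \<open>x\<close> is scaled by the power \<open>\<omega> x\<close> of \<open>t\<close>.\<close>

definition exp_weight :: "('x::finite \<Rightarrow> int) \<Rightarrow> ('x \<Rightarrow>\<^sub>0 int) \<Rightarrow> int" where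
  "exp_weight \<omega> m = (\<Sum>x\<in>UNIV. lookup m x * \<omega> x)"

definition word_weight :: "('g \<Rightarrow> int) \<Rightarrow> 'g word \<Rightarrow> int" where
  "word_weight \<nu> w = sum_list (map \<nu> (letters w))"

text \<open>The part of the algebra on which a one-parameter subgroup of the torus acts by
  \<open>t\<close> to the power \<open>k\<close>, expressed without \<open>t\<close>.\<close>

definition weighted ::
  "('x::finite \<Rightarrow> int) \<Rightarrow> ('f gen \<Rightarrow> int) \<Rightarrow> int \<Rightarrow> ('x, 'f, 'k::comm_ring_1) alg set" where
  "weighted \<omega> \<nu> k = {a. \<forall>w. \<forall>m\<in>keys (lookup a w). exp_weight \<omega> m + word_weight \<nu> w = k}"

lemma exp_weight_0 [simp]: "exp_weight \<omega> 0 = 0"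
  by (simp add: exp_weight_def)

lemma exp_weight_add: "exp_weight \<omega> (m + n) = exp_weight \<omega> m + exp_weight \<omega> n"
  by (simp add: exp_weight_def lookup_add distrib_right sum.distrib)

lemma exp_weight_single [simp]: "exp_weight \<omega> (single x n) = n * \<omega> x"
  by (simp add: exp_weight_def lookup_single when_def if_distrib[of "\<lambda>t. t * _"] cong: if_cong)

lemma word_weight_0 [simp]: "word_weight \<nu> 0 = 0"
  by (simp add: word_weight_def zero_word_def)

lemma word_weight_add: "word_weight \<nu> (v + w) = word_weight \<nu> v + word_weight \<nu> w"
  by (simp add: word_weight_def plus_word_def)

lemma weighted_zero [simp]: "0 \<in> weighted \<omega> \<nu> k"
  by (simp add: weighted_def)

lemma weighted_add: "a \<in> weighted \<omega> \<nu> k \<Longrightarrow> b \<in> weighted \<omega> \<nu> k \<Longrightarrow> a + b \<in> weighted \<omega> \<nu> k"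
  using keys_add[of "lookup a w" "lookup b w" for w] by (fastforce simp: weighted_def lookup_add)

lemma weighted_uminus: "a \<in> weighted \<omega> \<nu> k \<Longrightarrow> - a \<in> weighted \<omega> \<nu> k"
  by (simp add: weighted_def keys_def)

lemma weighted_sum: "(\<And>x. x \<in> A \<Longrightarrow> f x \<in> weighted \<omega> \<nu> k) \<Longrightarrow> sum f A \<in> weighted \<omega> \<nu> k"
  by (induction A rule: infinite_finite_induct) (auto intro: weighted_add)

lemma weighted_monomial:
  "exp_weight \<omega> m + word_weight \<nu> w = k \<Longrightarrow> single w (single m c) \<in> weighted \<omega> \<nu> k"
  by (auto simp: weighted_def lookup_single when_def split: if_splits)

lemma monomial_expansion:
  fixes a :: "('x, 'f, 'k::comm_ring_1) alg"
  shows "a = (\<Sum>w\<in>keys a. \<Sum>m\<in>keys (lookup a w). single w (single m (lookup (lookup a w) m)))"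
proof -
  have single_sum: "single w (sum f K) = (\<Sum>m\<in>K. single w (f m))"
    for w :: "'f gen word" and f :: "('x \<Rightarrow>\<^sub>0 int) \<Rightarrow> ('x, 'k) laurent" and K
    by (induction K rule: infinite_finite_induct) (simp_all add: single_add)
  show ?thesis
    by (simp only: single_sum[symmetric] poly_mapping_expansion[symmetric])
qed

text \<open>A weight space is spanned by the monomials it contains, because membership only
  restricts which exponents occur.\<close>

lemma weighted_induct [consumes 1, case_names zero monomial add]:
  assumes "a \<in> weighted \<omega> \<nu> k" "P 0"
    "\<And>w m c. exp_weight \<omega> m + word_weight \<nu> w = k \<Longrightarrow> P (single w (single m c))"
    "\<And>a b. P a \<Longrightarrow> P b \<Longrightarrow> P (a + b)"
  shows "P a"
proof -
  have P_sum: "P (sum f A)" if "\<And>x. x \<in> A \<Longrightarrow> P (f x)" for f A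
    using that by (induction A rule: infinite_finite_induct) (auto intro: assms)
  show ?thesis
    by (subst monomial_expansion) (use assms in \<open>auto intro!: P_sum simp: weighted_def\<close>)
qed

lemma weighted_mult:
  assumes "a \<in> weighted \<omega> \<nu> k" "b \<in> weighted \<omega> \<nu> l"
  shows "a * b \<in> weighted \<omega> \<nu> (k + l)"
  using assms(1)
proof (induction rule: weighted_induct)
  case (monomial w m c)
  show ?case
    using assms(2)
  proof (induction rule: weighted_induct)
    case (monomial v n d)
    then show ?case
      using \<open>exp_weight \<omega> m + word_weight \<nu> w = k\<close>
      by (auto simp: mult_single exp_weight_add word_weight_add intro!: weighted_monomial)
  qed (auto simp: distrib_left intro: weighted_add)
qed (auto simp: distrib_right intro: weighted_add)

lemma weighted_one: "1 \<in> weighted \<omega> \<nu> 0"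
  using weighted_monomial[of \<omega> 0 \<nu> 0 0 1] by simp

lemma weighted_minus_one_power: "(- 1) ^ n \<in> weighted \<omega> \<nu> 0"
proof (induction n)
  case (Suc n)
  show ?case
    using weighted_mult[OF weighted_uminus[OF weighted_one] Suc] by simp
qed (simp add: weighted_one)

lemma weighted_word: "single (Word w) 1 \<in> weighted \<omega> \<nu> (sum_list (map \<nu> w))"
  using weighted_monomial[of \<omega> 0 \<nu> "Word w" _ 1] by (simp add: word_weight_def)

text \<open>Each summand of the Leibniz expansion replaces one letter \<open>g\<close> by
  \<open>d g\<close>, which has the same weight, and signs have weight zero.\<close>

lemma weighted_leibniz:
  assumes "\<And>g. d g \<in> weighted \<omega> \<nu> (\<nu> g)"
  shows "leibniz d w \<in> weighted \<omega> \<nu> (sum_list (map \<nu> w))"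
proof (induction w)
  case (Cons g w)
  have "letter g \<in> weighted \<omega> \<nu> (\<nu> g)"
    using weighted_word[of "[g]"] by (simp add: letter_def)
  then have "(- 1) ^ gen_deg g * letter g * leibniz d w \<in> weighted \<omega> \<nu> (0 + \<nu> g + sum_list (map \<nu> w))"
    by (intro weighted_mult weighted_minus_one_power Cons)
  moreover have "d g * single (Word w) 1 \<in> weighted \<omega> \<nu> (\<nu> g + sum_list (map \<nu> w))"
    by (intro weighted_mult weighted_word assms)
  ultimately show ?case
    by (auto intro: weighted_add)
qed simp

lemma weighted_derivation:
  assumes "\<And>g. d g \<in> weighted \<omega> \<nu> (\<nu> g)" "a \<in> weighted \<omega> \<nu> k"
  shows "derivation d a \<in> weighted \<omega> \<nu> k"
  using assms(2)
proof (induction rule: weighted_induct)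
  case (monomial w m c)
  have "coef (single m c) \<in> weighted \<omega> \<nu> (exp_weight \<omega> m)"
    by (auto simp: coef_def intro!: weighted_monomial)
  from weighted_mult[OF this weighted_leibniz[OF assms(1), of "letters w"]] show ?case
    using monomial by (simp add: derivation_single word_weight_def)
qed (auto simp: derivation_add intro: weighted_add)

lemma weighted_coef_letter:
  assumes "coef l \<in> weighted \<omega> \<nu> k"
  shows "coef l * letter g \<in> weighted \<omega> \<nu> (k + \<nu> g)"
  using weighted_mult[OF assms weighted_word[of "[g]"]] by (simp add: letter_def)

lemma coef_one [simp]: "coef 1 = 1"
  by (simp add: coef_def)

lemma weighted_coef_prod:
  assumes "\<And>x. x \<in> A \<Longrightarrow> coef (f x) \<in> weighted \<omega> \<nu> (k x)"
  shows "coef (prod f A) \<in> weighted \<omega> \<nu> (sum k A)"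
  using assms
  by (induction A rule: infinite_finite_induct)
     (auto simp: coef_mult weighted_one intro: weighted_mult)

lemma weighted_coef_lvar: "coef (lvar x n) \<in> weighted \<omega> \<nu> (n * \<omega> x)"
  by (auto simp: lvar_def coef_def intro!: weighted_monomial)

lemma weighted_coef_minus: "coef l \<in> weighted \<omega> \<nu> k \<Longrightarrow> coef (- l) \<in> weighted \<omega> \<nu> k"
  using weighted_uminus[of "coef l"] by (simp add: coef_def single_uminus)

subsection \<open>Invariants as weight zero elements\<close>

text \<open>The common form of \<open>phi_face\<close> and \<open>phi_0\<close>: each variable and
  each generator is multiplied by its own power of \<open>t\<close>.\<close>

definition weight_action ::
  "('x \<Rightarrow> int) \<Rightarrow> ('f gen \<Rightarrow> int) \<Rightarrow> ('x option, 'f, 'k::comm_ring_1) alg \<Rightarrow> ('x option, 'f, 'k) alg"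
  where
  "weight_action \<omega> \<nu> = alg_subst
     (\<lambda>y. case y of None \<Rightarrow> frag_of None
        | Some x \<Rightarrow> frag_cmul (\<omega> x) (frag_of None) + frag_of (Some x))
     (\<lambda>g. lvar None (\<nu> g))"

lemma frag_extend_finite:
  fixes m :: "'x::finite \<Rightarrow>\<^sub>0 int"
  shows "frag_extend s m = (\<Sum>x\<in>UNIV. frag_cmul (lookup m x) (s x))"
  unfolding frag_extend_def by (intro sum.mono_neutral_left) (auto simp: in_keys_iff)

lemma lookup_adjoin_exponent:
  fixes m :: "'x::finite \<Rightarrow>\<^sub>0 int"
  shows "lookup (frag_extend (\<lambda>x. frag_of (Some x)) m) y = (case y of None \<Rightarrow> 0 | Some x \<Rightarrow> lookup m x)"
  by (auto simp: frag_extend_finite lookup_sum lookup_single when_def if_distrib[of "\<lambda>t. _ * t"]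
      split: option.splits cong: if_cong)

text \<open>The two substitutions compose to one that is linear in the exponent, and the powers of
  \<open>t\<close> picked up by the variables add up to the weight.\<close>

lemma weight_action_exponent:
  fixes m :: "'x::finite \<Rightarrow>\<^sub>0 int"
  shows "frag_extend (\<lambda>y. case y of None \<Rightarrow> frag_of None
        | Some x \<Rightarrow> frag_cmul (\<omega> x) (frag_of None) + frag_of (Some x))
      (frag_extend (\<lambda>x. frag_of (Some x)) m)
    = frag_extend (\<lambda>x. frag_of (Some x)) m + single None (exp_weight \<omega> m)" (is "?l = ?r")
proof -
  have "?l = (\<Sum>x\<in>UNIV. frag_cmul (lookup m x) (frag_cmul (\<omega> x) (frag_of None) + frag_of (Some x)))"
    by (simp add: frag_extend_finite[of _ m] frag_extend_sum frag_extend_cmul o_def del: frag_cmul_cmul)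
  also have "\<dots> = ?r"
    by (rule poly_mapping_eqI)
       (auto simp: frag_extend_finite[of _ m] lookup_sum lookup_add lookup_single when_def exp_weight_def
         distrib_left intro: sum.cong)
  finally show ?thesis .
qed

lemma prod_list_lvar: "prod_list (map (\<lambda>g. lvar x (\<nu> g)) gs) = lvar x (sum_list (map \<nu> gs))"
proof (induction gs)
  case (Cons g gs)
  then show ?case
    by (simp add: lvar_def mult_single single_add)
qed (simp add: lvar_def)

text \<open>A term without \<open>t\<close> is multiplied by \<open>t\<close> to its weight.
  Different monomials keep different images, whatever their powers of \<open>t\<close>, so nothing
  cancels and each term must be fixed separately.\<close>

lemma weight_action_invariant_iff:
  fixes a :: "('x::finite, 'f, 'k::comm_ring_1) alg"
  shows "weight_action \<omega> \<nu> (adjoin_t a) = adjoin_t a \<longleftrightarrow> a \<in> weighted \<omega> \<nu> 0"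
proof -
  let ?i = "frag_extend (\<lambda>x. frag_of (Some x)) :: ('x \<Rightarrow>\<^sub>0 int) \<Rightarrow> _"
  define \<tau> :: "_ \<Rightarrow> _ \<Rightarrow> 'x option \<Rightarrow>\<^sub>0 int" where "\<tau> w m = single None (exp_weight \<omega> m + word_weight \<nu> w)" for w :: "'f gen word" and m
  \<comment> \<open>The coordinates \<open>Some x\<close> recover the original exponent, and the
    coordinate \<open>None\<close> recovers the power of \<open>t\<close>.\<close>
  have inj: "m = n \<and> \<tau> w k = 0" if "?i m = ?i n + \<tau> w k" for m n k w
  proof -
    have "lookup (?i m) y = lookup (?i n + \<tau> w k) y" for y
      by (simp add: that)
    note eq = this
    have "lookup m x = lookup n x" for x
      using eq[of "Some x"] by (simp add: lookup_adjoin_exponent lookup_add \<tau>_def lookup_single)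
    moreover have "exp_weight \<omega> k + word_weight \<nu> w = 0"
      using eq[of None] by (simp add: lookup_adjoin_exponent lookup_add \<tau>_def lookup_single)
    ultimately show ?thesis
      by (simp add: \<tau>_def poly_mapping_eqI)
  qed
  have inj0: "?i m = ?i n \<longleftrightarrow> m = n" for m n
  proof
    assume eq: "?i m = ?i n"
    have "lookup m x = lookup n x" for x
      using lookup_adjoin_exponent[of m "Some x"] lookup_adjoin_exponent[of n "Some x"] eq by simp
    then show "m = n"
      by (rule poly_mapping_eqI)
  qed simp
  have adj: "lookup (adjoin_t a) w = (\<Sum>m\<in>keys (lookup a w). single (?i m) (lookup (lookup a w) m))" for w
    by (simp add: adjoin_t_def lookup_alg_subst laurent_subst_def)
  have act: "lookup (weight_action \<omega> \<nu> (adjoin_t a)) w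
      = (\<Sum>m\<in>keys (lookup a w). single (?i m + \<tau> w m) (lookup (lookup a w) m))" for w
  proof -
    have 1: "laurent_subst s (\<Sum>m\<in>K. single (?i m) (c m)) = (\<Sum>m\<in>K. single (frag_extend s (?i m)) (c m))"
      for s :: "_ \<Rightarrow> 'x option \<Rightarrow>\<^sub>0 int" and K and c :: "_ \<Rightarrow> 'k"
      using sum_comp_morphism[of "laurent_subst s" "\<lambda>m. single (?i m) (c m)" K]
      by (simp add: laurent_subst_add o_def)
    show ?thesis
      by (simp only: weight_action_def lookup_alg_subst adj 1 weight_action_exponent prod_list_lvar)
         (simp add: lvar_def sum_distrib_right mult_single \<tau>_def word_weight_def single_add add.assoc)
  qed
  show ?thesis
  proof
    assume eq: "weight_action \<omega> \<nu> (adjoin_t a) = adjoin_t a"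
    \<comment> \<open>The coefficient at \<open>?i n\<close> is nonzero before the action, hence
      also after it, so some moved term lands there; by \<open>inj\<close> this term is
      \<open>n\<close> itself, moved by the trivial power of \<open>t\<close>.\<close>
    have "\<tau> w n = 0" if n: "n \<in> keys (lookup a w)" for w n
    proof -
      have "lookup (\<Sum>m\<in>keys (lookup a w). single (?i m + \<tau> w m) (lookup (lookup a w) m)) (?i n)
        = lookup (\<Sum>m\<in>keys (lookup a w). single (?i m) (lookup (lookup a w) m)) (?i n)"
        using eq act adj by metis
      also have "\<dots> = lookup (lookup a w) n"
        using n by (simp add: lookup_sum lookup_single when_def inj0)
      also have "\<dots> \<noteq> 0"
        using n by (simp add: in_keys_iff)
      finally obtain m where "?i m + \<tau> w m = ?i n"
        by (auto simp: lookup_sum lookup_single when_def elim!: sum.not_neutral_contains_not_neutral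
            split: if_splits)
      from inj[OF this[symmetric]] show ?thesis by simp
    qed
    then have "lookup (\<tau> w n) None = 0" if "n \<in> keys (lookup a w)" for w n
      using that by simp
    then show "a \<in> weighted \<omega> \<nu> 0"
      by (auto simp: weighted_def \<tau>_def)
  next
    assume a: "a \<in> weighted \<omega> \<nu> 0"
    show "weight_action \<omega> \<nu> (adjoin_t a) = adjoin_t a"
    proof (rule poly_mapping_eqI)
      fix w
      show "lookup (weight_action \<omega> \<nu> (adjoin_t a)) w = lookup (adjoin_t a) w"
        unfolding act adj by (rule sum.cong) (use a in \<open>auto simp: weighted_def \<tau>_def\<close>)
    qed
  qed
qed

section \<open>The torus action attached to the graph\<close>

definition face_weight :: "('e, 'f) plane_graph \<Rightarrow> 'f \<Rightarrow> 'e \<Rightarrow> int" where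
  "face_weight G j e = of_bool (edge_on_face G e j)"

definition gen_face_weight :: "'f \<Rightarrow> 'f gen \<Rightarrow> int" where
  "gen_face_weight j g = (if g = Face j then 2 else 0)"

fun gen_weight_0 :: "'f gen \<Rightarrow> int" where
  "gen_weight_0 Y = -1"
| "gen_weight_0 (Face j) = 1"
| "gen_weight_0 _ = 0"

lemma lvar_0 [simp]: "lvar x 0 = 1"
  by (simp add: lvar_def)

lemma phi_face_eq: "phi_face G j = weight_action (face_weight G j) (gen_face_weight j)"
  unfolding phi_face_def weight_action_def
  by (intro arg_cong2[where f = alg_subst] ext)
     (auto simp: face_weight_def gen_face_weight_def split: option.splits)

lemma phi_0_eq: "phi_0 = weight_action (\<lambda>_. 1) gen_weight_0"
  unfolding phi_0_def weight_action_def
  by (intro arg_cong2[where f = alg_subst] ext)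
     (auto split: option.splits gen.splits)

lemma invariants_eq:
  fixes G :: "('e::finite, 'f) plane_graph"
  shows "(invariants G :: ('e, 'f, 'k::comm_ring_1) alg set)
    = (\<Inter>j. weighted (face_weight G j) (gen_face_weight j) 0) \<inter> weighted (\<lambda>_. 1) gen_weight_0 0"
  by (auto simp: invariants_def phi_face_eq phi_0_eq weight_action_invariant_iff)


subsection \<open>The quotient map\<close>

lemma lookup_restrict_exponent:
  fixes m :: "'x::finite \<Rightarrow>\<^sub>0 int"
  shows "lookup (frag_extend (\<lambda>e. if e \<in> T then frag_of e else 0) m) x = (if x \<in> T then lookup m x else 0)"
proof -
  have "lookup (frag_extend (\<lambda>e. if e \<in> T then frag_of e else 0) m) x
    = (\<Sum>y\<in>UNIV. if y = x then (if x \<in> T then lookup m x else 0) else 0)"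
    unfolding frag_extend_finite lookup_sum
    by (rule sum.cong) (auto simp: lookup_single when_def)
  then show ?thesis by simp
qed

lemma versal_quotient_fixes:
  fixes a :: "('e::finite, 'f, 'k::comm_ring_1) alg"
  assumes "a \<in> versal_carrier T"
  shows "versal_quotient T a = a"
proof (rule poly_mapping_eqI)
  fix w
  let ?s = "\<lambda>e. if e \<in> T then frag_of e else 0"
  have "frag_extend ?s m = m" if "m \<in> keys (lookup a w)" for m
  proof (rule poly_mapping_eqI)
    have "keys m \<subseteq> T"
      using that assms by (auto simp: versal_carrier_def)
    then show "lookup (frag_extend ?s m) x = lookup m x" for x
      by (auto simp: lookup_restrict_exponent in_keys_iff)
  qed
  then have "laurent_subst ?s (lookup a w) = lookup a w"
    by (simp add: laurent_subst_def poly_mapping_expansion[symmetric])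
  then show "lookup (versal_quotient T a) w = lookup a w"
    by (simp add: versal_quotient_def lookup_alg_subst)
qed

lemma versal_carrier_zero [simp]: "0 \<in> versal_carrier T"
  by (simp add: versal_carrier_def)

lemma versal_carrier_add: "a \<in> versal_carrier T \<Longrightarrow> b \<in> versal_carrier T \<Longrightarrow> a + b \<in> versal_carrier T"
  using keys_add[of "lookup a w" "lookup b w" for w] by (fastforce simp: versal_carrier_def lookup_add)

lemma versal_carrier_monomial:
  "keys m \<subseteq> T \<Longrightarrow> single w (single m c) \<in> versal_carrier T"
  by (auto simp: versal_carrier_def lookup_single when_def split: if_splits)

lemma versal_quotient_in_carrier:
  fixes a :: "('e::finite, 'f, 'k::comm_ring_1) alg"
  shows "versal_quotient T a \<in> versal_carrier T"
proof -
  have "keys (frag_extend (\<lambda>e. if e \<in> T then frag_of e else 0) m) \<subseteq> T" for m :: "'e \<Rightarrow>\<^sub>0 int"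
    by (auto simp: in_keys_iff lookup_restrict_exponent split: if_splits)
  then have mono: "versal_quotient T (single w (single m c)) \<in> versal_carrier T"
    for w :: "'f gen word" and m and c :: 'k
    by (auto simp: versal_quotient_def intro!: versal_carrier_monomial)
  have "versal_quotient T (single w l) \<in> versal_carrier T"
    for w :: "'f gen word" and l :: "('e, 'k) laurent"
    by (induction l rule: poly_mapping_induct_additive)
       (simp_all add: mono single_add, simp_all add: versal_quotient_def alg_subst_add versal_carrier_add)
  then show ?thesis
    by (induction a rule: poly_mapping_induct_additive)
       (simp_all add: versal_quotient_def alg_subst_add versal_carrier_add)
qed

text \<open>Q is multiplicative and idempotent, and it intertwines \<open>derivation d\<close> with
  the derivation whose values are Q applied to those of \<open>d\<close>. Hence Q after a derivation
  depends only on the image under Q.\<close>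

lemma versal_quotient_derivation:
  fixes a :: "('e::finite, 'f, 'k::comm_ring_1) alg"
  shows "versal_quotient T (derivation d (versal_quotient T a)) = versal_quotient T (derivation d a)"
proof -
  have "versal_quotient T (versal_quotient T a) = versal_quotient T a"
    by (rule versal_quotient_fixes[OF versal_quotient_in_carrier])
  then show ?thesis
    by (simp add: versal_quotient_def alg_subst_derivation)
qed

text \<open>Resolves the definite description: a candidate exists because Q after the differential
  factors through Q, and it is unique because Q fixes the carrier pointwise and extensional
  functions have no freedom outside it.\<close>

lemma versal_diff_eq:
  fixes G :: "('e::finite, 'f::finite) plane_graph"
  shows "(versal_diff G \<Gamma> T :: ('e, 'f, 'k::comm_ring_1) alg \<Rightarrow> _)
    = restrict (versal_quotient T \<circ> garden_diff G \<Gamma>) (versal_carrier T)"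
  unfolding versal_diff_def
proof (rule the_equality)
  show "restrict (versal_quotient T \<circ> garden_diff G \<Gamma>) (versal_carrier T)
      \<in> versal_carrier T \<rightarrow>\<^sub>E (versal_carrier T :: ('e, 'f, 'k) alg set) \<and>
    versal_quotient T \<circ> garden_diff G \<Gamma>
      = restrict (versal_quotient T \<circ> garden_diff G \<Gamma>) (versal_carrier T) \<circ> versal_quotient T"
    by (auto simp: fun_eq_iff versal_quotient_in_carrier garden_diff_def versal_quotient_derivation)
  fix d :: "('e, 'f, 'k) alg \<Rightarrow> ('e, 'f, 'k) alg"
  assume d: "d \<in> versal_carrier T \<rightarrow>\<^sub>E versal_carrier T \<and>
    versal_quotient T \<circ> garden_diff G \<Gamma> = d \<circ> versal_quotient T"
  show "d = restrict (versal_quotient T \<circ> garden_diff G \<Gamma>) (versal_carrier T)"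
  proof (rule extensionalityI)
    show "d \<in> extensional (versal_carrier T)" using d by (auto simp: PiE_def)
    fix a :: "('e, 'f, 'k) alg" assume a: "a \<in> versal_carrier T"
    have "(d \<circ> versal_quotient T) a = (versal_quotient T \<circ> garden_diff G \<Gamma>) a"
      using d by simp
    then show "d a = restrict (versal_quotient T \<circ> garden_diff G \<Gamma>) (versal_carrier T) a"
      using a by (simp add: versal_quotient_fixes)
  qed simp
qed

lemma versal_diff_quotient:
  fixes a :: "('e::finite, 'f::finite, 'k::comm_ring_1) alg"
  shows "versal_diff G \<Gamma> T (versal_quotient T a) = versal_quotient T (garden_diff G \<Gamma> a)"
  by (simp add: versal_diff_eq versal_quotient_in_carrier garden_diff_def versal_quotient_derivation)

subsection \<open>Unimodularity and the isomorphism\<close>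

text \<open>By linearity, exponent vectors with prescribed values on \<open>T\<close> reduce to those vanishing on \<open>T\<close>.\<close>

definition unimodular_complement :: "('e::finite, 'f) plane_graph \<Rightarrow> 'e set \<Rightarrow> bool" where
  "unimodular_complement G T \<longleftrightarrow>
     (\<forall>c c0. \<exists>m. keys m \<inter> T = {} \<and> (\<forall>j. exp_weight (face_weight G j) m = c j)
        \<and> exp_weight (\<lambda>_. 1) m = c0) \<and>
     (\<forall>m. keys m \<inter> T = {} \<longrightarrow> (\<forall>j. exp_weight (face_weight G j) m = 0)
        \<longrightarrow> exp_weight (\<lambda>_. 1) m = 0 \<longrightarrow> m = 0)"

section \<open>Closure properties of the invariants and of Q\<close>

lemma exp_weight_uminus: "exp_weight \<omega> (- m) = - exp_weight \<omega> m"
  by (simp add: exp_weight_def sum_negf)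

lemma exp_weight_diff: "exp_weight \<omega> (m - n) = exp_weight \<omega> m - exp_weight \<omega> n"
  using exp_weight_add[of \<omega> m "- n"] by (simp add: exp_weight_uminus)

lemma versal_quotient_add: "versal_quotient T (a + b) = versal_quotient T a + versal_quotient T b"
  by (simp add: versal_quotient_def alg_subst_add)

lemma versal_quotient_mult: "versal_quotient T (a * b) = versal_quotient T a * versal_quotient T b"
  by (simp add: versal_quotient_def alg_subst_mult)

lemma invariants_add: "a \<in> invariants G \<Longrightarrow> b \<in> invariants G \<Longrightarrow> a + b \<in> invariants G"
  for G :: "('e::finite, 'f) plane_graph"
  by (auto simp: invariants_eq intro: weighted_add)

lemma invariants_mult: "a \<in> invariants G \<Longrightarrow> b \<in> invariants G \<Longrightarrow> a * b \<in> invariants G"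
  for G :: "('e::finite, 'f) plane_graph"
  using weighted_mult[where k = 0 and l = 0] by (auto simp: invariants_eq)

lemma invariants_one: "1 \<in> invariants G" for G :: "('e::finite, 'f) plane_graph"
  by (auto simp: invariants_eq intro: weighted_one)

lemma invariants_uminus: "a \<in> invariants G \<Longrightarrow> - a \<in> invariants G"
  for G :: "('e::finite, 'f) plane_graph"
  by (auto simp: invariants_eq intro: weighted_uminus)

lemma invariants_scal: "a \<in> invariants G \<Longrightarrow> scal c a \<in> invariants G"
  for G :: "('e::finite, 'f) plane_graph"
  unfolding scal_def by (intro invariants_mult) (auto simp: invariants_eq coef_def intro!: weighted_monomial)

lemma versal_quotient_scal: "versal_quotient T (scal c a) = scal c (versal_quotient T a)"
  by (simp add: scal_def versal_quotient_mult) (simp add: versal_quotient_def)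

lemma versal_quotient_one [simp]: "versal_quotient T 1 = 1"
  by (simp add: versal_quotient_def)

text \<open>For a fixed word, invariance gives all exponents in its coefficient the same weights, so
  the difference of two of them has weight zero. If they agree on \<open>T\<close>, it is supported
  off \<open>T\<close> and vanishes by unimodularity.\<close>

lemma invariants_exponents_inj:
  fixes a :: "('e::finite, 'f, 'k::comm_ring_1) alg"
  assumes T: "unimodular_complement G T" and a: "a \<in> invariants G"
    and m: "m \<in> keys (lookup a w)" and n: "n \<in> keys (lookup a w)"
    and eq: "frag_extend (\<lambda>e. if e \<in> T then frag_of e else 0) m
      = frag_extend (\<lambda>e. if e \<in> T then frag_of e else 0) n"
  shows "m = n"
proof -
  have "lookup (m - n) e = 0" if "e \<in> T" for e
    using arg_cong[OF eq, of "\<lambda>k. lookup k e"] that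
    by (simp add: lookup_restrict_exponent lookup_minus)
  then have "keys (m - n) \<inter> T = {}"
    by (auto simp: in_keys_iff)
  moreover have "exp_weight \<omega> (m - n) = 0" if "a \<in> weighted \<omega> \<nu> 0" for \<omega> \<nu>
  proof -
    have "exp_weight \<omega> m + word_weight \<nu> w = 0" "exp_weight \<omega> n + word_weight \<nu> w = 0"
      using that m n by (auto simp: weighted_def)
    then show ?thesis by (simp add: exp_weight_diff)
  qed
  moreover have "a \<in> weighted (face_weight G j) (gen_face_weight j) 0" "a \<in> weighted (\<lambda>_. 1) gen_weight_0 0" for j
    using a by (auto simp: invariants_eq)
  ultimately have "exp_weight (face_weight G j) (m - n) = 0" "exp_weight (\<lambda>_. 1) (m - n) = 0" for j
    by blast+
  then have "m - n = 0"
    using conjunct2[OF T[unfolded unimodular_complement_def]] \<open>keys (m - n) \<inter> T = {}\<close> by blast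
  then show ?thesis by simp
qed

text \<open>Terms of one coefficient cannot merge under Q, so every coefficient of an invariant
  element can still be read off. Injectivity on invariants and preservation of the set of words both
  follow from this.\<close>

lemma lookup_versal_quotient_invariant:
  fixes a :: "('e::finite, 'f, 'k::comm_ring_1) alg"
  assumes T: "unimodular_complement G T" and a: "a \<in> invariants G" and m: "m \<in> keys (lookup a w)"
  shows "lookup (lookup (versal_quotient T a) w) (frag_extend (\<lambda>e. if e \<in> T then frag_of e else 0) m)
    = lookup (lookup a w) m"
proof -
  let ?r = "frag_extend (\<lambda>e. if e \<in> T then frag_of e else 0)"
  have "lookup (lookup (versal_quotient T a) w) (?r m)
    = (\<Sum>n\<in>keys (lookup a w). lookup (lookup a w) n when ?r n = ?r m)"
    by (simp add: versal_quotient_def lookup_alg_subst laurent_subst_def lookup_sum lookup_single)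
  also have "\<dots> = (\<Sum>n\<in>keys (lookup a w). if n = m then lookup (lookup a w) m else 0)"
  proof (rule sum.cong)
    fix n assume "n \<in> keys (lookup a w)"
    then have "?r n = ?r m \<longleftrightarrow> n = m"
      using invariants_exponents_inj[OF T a _ m, of n] by blast
    then show "(lookup (lookup a w) n when ?r n = ?r m) = (if n = m then lookup (lookup a w) m else 0)"
      by (simp only: when_def) simp
  qed simp
  finally show ?thesis
    using m by simp
qed

lemma versal_quotient_inj_on_invariants:
  fixes G :: "('e::finite, 'f) plane_graph"
  assumes T: "unimodular_complement G T"
  shows "inj_on (versal_quotient T :: ('e, 'f, 'k::comm_ring_1) alg \<Rightarrow> _) (invariants G)"
proof (rule inj_onI)
  fix a b :: "('e, 'f, 'k) alg"
  assume ab: "a \<in> invariants G" "b \<in> invariants G" and eq: "versal_quotient T a = versal_quotient T b"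
  have inv: "a + - b \<in> invariants G"
    using ab by (intro invariants_add invariants_uminus)
  have "versal_quotient T (a + - b) = versal_quotient T a + versal_quotient T (- b)"
    by (rule versal_quotient_add)
  also have "versal_quotient T (- b) = - versal_quotient T b"
    unfolding versal_quotient_def by (rule alg_subst_uminus)
  finally have 0: "versal_quotient T (a + - b) = 0"
    unfolding eq by simp
  have "lookup (lookup (a + - b) w) m = 0" for w m
  proof (cases "m \<in> keys (lookup (a + - b) w)")
    case True
    show ?thesis
      using lookup_versal_quotient_invariant[OF T inv True] by (simp only: 0 lookup_zero)
  next
    case False
    then show ?thesis
      unfolding in_keys_iff by blast
  qed
  then have "lookup (a + - b) w = 0" for w
    by (intro poly_mapping_eqI) (simp only: lookup_zero)
  then have "a + - b = 0"
    by (intro poly_mapping_eqI) (simp only: lookup_zero)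
  then show "a = b" by simp
qed

lemma versal_quotient_surj:
  fixes G :: "('e::finite, 'f) plane_graph" and b :: "('e, 'f, 'k::comm_ring_1) alg"
  assumes T: "unimodular_complement G T" and b: "b \<in> versal_carrier T"
  obtains a where "a \<in> invariants G" "versal_quotient T a = b"
proof -
  let ?r = "frag_extend (\<lambda>e. if e \<in> T then frag_of e else 0)"
  \<comment> \<open>A monomial on \<open>T\<close> is lifted together with its word: variables off
    \<open>T\<close> are added to cancel the weights of both. As Q sends these variables to 1, the
    lift still maps to the monomial.\<close>
  have "\<exists>n. ?r n = m \<and> (\<forall>j. exp_weight (face_weight G j) n + word_weight (gen_face_weight j) w = 0)
      \<and> exp_weight (\<lambda>_. 1) n + word_weight gen_weight_0 w = 0" if m: "keys m \<subseteq> T" for m and w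
  proof -
    obtain n where n: "keys n \<inter> T = {}"
      "\<And>j. exp_weight (face_weight G j) n
        = - exp_weight (face_weight G j) m - word_weight (gen_face_weight j) w"
      "exp_weight (\<lambda>_. 1) n = - exp_weight (\<lambda>_. 1) m - word_weight gen_weight_0 w"
      using conjunct1[OF T[unfolded unimodular_complement_def], rule_format,
          of "\<lambda>j. - exp_weight (face_weight G j) m - word_weight (gen_face_weight j) w"] by blast
    have "lookup (?r (m + n)) x = lookup m x" for x
      using n(1) m by (auto simp: lookup_restrict_exponent lookup_add in_keys_iff)
    then have "?r (m + n) = m"
      by (rule poly_mapping_eqI)
    then show ?thesis
      using n by (intro exI[of _ "m + n"]) (auto simp: exp_weight_add)
  qed
  then have "\<forall>m w. \<exists>n. keys m \<subseteq> T \<longrightarrow> ?r n = m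
      \<and> (\<forall>j. exp_weight (face_weight G j) n + word_weight (gen_face_weight j) w = 0)
      \<and> exp_weight (\<lambda>_. 1) n + word_weight gen_weight_0 w = 0"
    by blast
  then obtain x where "\<forall>m w. keys m \<subseteq> T \<longrightarrow> ?r (x m w) = m
      \<and> (\<forall>j. exp_weight (face_weight G j) (x m w) + word_weight (gen_face_weight j) w = 0)
      \<and> exp_weight (\<lambda>_. 1) (x m w) + word_weight gen_weight_0 w = 0"
    unfolding choice_iff by blast
  then have x: "?r (x m w) = m" "exp_weight (face_weight G j) (x m w) + word_weight (gen_face_weight j) w = 0"
    "exp_weight (\<lambda>_. 1) (x m w) + word_weight gen_weight_0 w = 0" if "keys m \<subseteq> T" for m w j
    using that by blast+
  define a where "a = (\<Sum>w\<in>keys b. \<Sum>m\<in>keys (lookup b w). single w (single (x m w) (lookup (lookup b w) m)))"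
  have sub: "keys m \<subseteq> T" if "m \<in> keys (lookup b w)" for m w
    using b that by (auto simp: versal_carrier_def)
  have "a \<in> invariants G"
    unfolding a_def invariants_eq
    by (intro IntI INT_I weighted_sum weighted_monomial x sub)
  moreover have "versal_quotient T a = b"
    unfolding a_def versal_quotient_def alg_subst_sum
    by (rule trans[OF _ monomial_expansion[of b, symmetric]])
       (intro sum.cong refl, simp add: x(1) sub)
  ultimately show ?thesis ..
qed

lemma bij_betw_versal_quotient:
  fixes G :: "('e::finite, 'f) plane_graph"
  assumes "unimodular_complement G T"
  shows "bij_betw (versal_quotient T :: ('e, 'f, 'k::comm_ring_1) alg \<Rightarrow> _) (invariants G) (versal_carrier T)"
  unfolding bij_betw_def
proof
  show "inj_on (versal_quotient T :: ('e, 'f, 'k) alg \<Rightarrow> _) (invariants G)"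
    by (rule versal_quotient_inj_on_invariants[OF assms])
  show "versal_quotient T ` (invariants G :: ('e, 'f, 'k) alg set) = versal_carrier T"
    by (blast intro: versal_quotient_in_carrier elim: versal_quotient_surj[OF assms])
qed

text \<open>Q changes no word and kills no coefficient of an invariant element. One direction serves
  Q, the other its inverse.\<close>

lemma homogeneous_versal_quotient_iff:
  fixes a :: "('e::finite, 'f, 'k::comm_ring_1) alg"
  assumes "unimodular_complement G T" "a \<in> invariants G"
  shows "versal_quotient T a \<in> homogeneous n \<longleftrightarrow> a \<in> homogeneous n"
proof -
  have "lookup (versal_quotient T a) w = 0 \<longleftrightarrow> lookup a w = 0" for w
  proof
    assume 0: "lookup (versal_quotient T a) w = 0"
    have "lookup (lookup a w) m = 0" for m
    proof (cases "m \<in> keys (lookup a w)")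
      case True
      show ?thesis
        using lookup_versal_quotient_invariant[OF assms True] by (simp only: 0 lookup_zero)
    next
      case False
      then show ?thesis
        unfolding in_keys_iff by blast
    qed
    then show "lookup a w = 0"
      by (intro poly_mapping_eqI) (simp only: lookup_zero)
  qed (simp add: versal_quotient_def lookup_alg_subst)
  then have "keys (versal_quotient T a) = keys a"
    by (intro set_eqI) (simp only: in_keys_iff)
  then show ?thesis
    by (simp add: homogeneous_def)
qed

lemma dg_isomorphic_invariant_versal:
  fixes G :: "('e::finite, 'f::finite) plane_graph"
  assumes T: "unimodular_complement G T"
    and closed: "\<And>a. a \<in> invariants G \<Longrightarrow> (garden_diff G \<Gamma> a :: ('e, 'f, 'k::field) alg) \<in> invariants G"
  shows "dg_isomorphic (invariant_dga G \<Gamma> :: ('k, ('e, 'f, 'k) alg) dga) (versal_dga G \<Gamma> T)"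
proof -
  have "dg_isomorphism (invariant_dga G \<Gamma> :: ('k, ('e, 'f, 'k) alg) dga) (versal_dga G \<Gamma> T) (versal_quotient T)"
    using bij_betw_versal_quotient[OF T] closed homogeneous_versal_quotient_iff[OF T]
    by (auto simp: dg_isomorphism_def invariant_dga_def versal_dga_def versal_quotient_add
        versal_quotient_mult versal_quotient_scal versal_diff_quotient versal_quotient_in_carrier)
  then show ?thesis
    by (auto simp: dg_isomorphic_def)
qed

text \<open>Symmetry is not built into \<open>dg_isomorphic\<close>, so the inverse of Q is treated
  directly. The algebra laws for it come from applying Q to the expected value and using that the
  inverse undoes Q on invariants.\<close>

lemma dg_isomorphic_versal_invariant:
  fixes G :: "('e::finite, 'f::finite) plane_graph"
  assumes T: "unimodular_complement G T"
    and closed: "\<And>a. a \<in> invariants G \<Longrightarrow> (garden_diff G \<Gamma> a :: ('e, 'f, 'k::field) alg) \<in> invariants G"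
  shows "dg_isomorphic (versal_dga G \<Gamma> T :: ('k, ('e, 'f, 'k) alg) dga) (invariant_dga G \<Gamma>)"
proof -
  let ?Q = "versal_quotient T :: ('e, 'f, 'k) alg \<Rightarrow> ('e, 'f, 'k) alg"
  define \<psi> where "\<psi> = inv_into (invariants G) ?Q"
  note bij = bij_betw_versal_quotient[OF T, where 'k = 'k]
  have \<psi>: "bij_betw \<psi> (versal_carrier T) (invariants G)"
    using bij_betw_inv_into[OF bij] by (simp add: \<psi>_def)
  have \<psi>_inv: "\<psi> a \<in> invariants G" if "a \<in> versal_carrier T" for a
    using \<psi> that by (auto simp: bij_betw_def)
  have Q\<psi>: "?Q (\<psi> a) = a" if "a \<in> versal_carrier T" for a
    using bij_betw_inv_into_right[OF bij that] by (simp add: \<psi>_def)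
  have \<psi>Q: "\<psi> (?Q a) = a" if "a \<in> invariants G" for a
    using bij_betw_inv_into_left[OF bij that] by (simp add: \<psi>_def)
  have "\<psi> (a + b) = \<psi> a + \<psi> b" "\<psi> (a * b) = \<psi> a * \<psi> b"
    if "a \<in> versal_carrier T" "b \<in> versal_carrier T" for a b
    using that \<psi>Q[of "\<psi> a + \<psi> b"] \<psi>Q[of "\<psi> a * \<psi> b"]
    by (simp_all add: versal_quotient_add versal_quotient_mult Q\<psi> \<psi>_inv invariants_add invariants_mult)
  moreover have "\<psi> (scal c a) = scal c (\<psi> a)" if "a \<in> versal_carrier T" for a c
    using that \<psi>Q[of "scal c (\<psi> a)"] by (simp add: versal_quotient_scal Q\<psi> \<psi>_inv invariants_scal)
  moreover have "\<psi> 1 = 1"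
    using \<psi>Q[OF invariants_one] by simp
  moreover have "\<psi> a \<in> invariants G \<inter> homogeneous n" if "a \<in> versal_carrier T \<inter> homogeneous n" for a n
    using that homogeneous_versal_quotient_iff[OF T, of "\<psi> a" n] by (simp add: Q\<psi> \<psi>_inv)
  moreover have "versal_diff G \<Gamma> T a \<in> versal_carrier T \<and> \<psi> (versal_diff G \<Gamma> T a) = garden_diff G \<Gamma> (\<psi> a)"
    if "a \<in> versal_carrier T" for a
    using that versal_diff_quotient[of G \<Gamma> T "\<psi> a"]
    by (simp add: Q\<psi> \<psi>Q \<psi>_inv closed versal_quotient_in_carrier)
  ultimately have "dg_isomorphism (versal_dga G \<Gamma> T :: ('k, ('e, 'f, 'k) alg) dga) (invariant_dga G \<Gamma>) \<psi>"
    using \<psi> unfolding dg_isomorphism_def invariant_dga_def versal_dga_def dga.simps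
    by (intro conjI) blast+
  then show ?thesis
    by (auto simp: dg_isomorphic_def)
qed

lemma dg_isomorphic_trans:
  assumes "dg_isomorphic A B" "dg_isomorphic B C"
  shows "dg_isomorphic A C"
proof -
  obtain \<phi> \<psi> where \<phi>: "dg_isomorphism A B \<phi>" and \<psi>: "dg_isomorphism B C \<psi>"
    using assms by (auto simp: dg_isomorphic_def)
  have "\<phi> a \<in> dga_carrier B" if "a \<in> dga_carrier A" for a
    using \<phi> that by (auto simp: dg_isomorphism_def bij_betw_def)
  then have "dg_isomorphism A C (\<psi> \<circ> \<phi>)"
    using \<phi> \<psi> bij_betw_trans[of \<phi> "dga_carrier A" "dga_carrier B" \<psi> "dga_carrier C"]
    by (simp add: dg_isomorphism_def)
  then show ?thesis
    by (auto simp: dg_isomorphic_def)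
qed

lemma garden_diff_invariant:
  fixes G :: "('e::finite, 'f::finite) plane_graph" and a :: "('e, 'f, 'k::comm_ring_1) alg"
  assumes face: "\<And>j g. (gen_diff G \<Gamma> g :: ('e, 'f, 'k) alg)
      \<in> weighted (face_weight G j) (gen_face_weight j) (gen_face_weight j g)"
    and total: "\<And>g. (gen_diff G \<Gamma> g :: ('e, 'f, 'k) alg)
      \<in> weighted (\<lambda>_. 1) gen_weight_0 (gen_weight_0 g)"
    and a: "a \<in> invariants G"
  shows "garden_diff G \<Gamma> a \<in> invariants G"
  using a unfolding invariants_eq garden_diff_def
  by (auto intro: weighted_derivation face total)


section \<open>Local structure of smooth arcs\<close>

text \<open>The germ of an arc at \<open>z\<close>, parametrized by the distance from
  \<open>z\<close> once \<open>u\<close> takes unit values. The direction may vary with the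
  distance, so a ray can be curved.\<close>

definition ray :: "complex \<Rightarrow> (real \<Rightarrow> complex) \<Rightarrow> real \<Rightarrow> complex set" where
  "ray z u r = (\<lambda>\<rho>. z + \<rho> *\<^sub>R u \<rho>) ` {0<..<r}"

text \<open>Writing both vectors as \<open>d\<close> plus an error of norm below N/3, where N is the
  norm of \<open>d\<close>, the product is at least (1 - 1/3 - 1/3 - 1/9) N^2, which is
  positive.\<close>

lemma inner_pos_if_near:
  fixes d x y :: "'a::real_inner"
  assumes "norm (x - d) < norm d / 3" "norm (y - d) < norm d / 3"
  shows "0 < x \<bullet> y"
proof -
  define a b N where "a = x - d" "b = y - d" "N = norm d"
  have ab: "norm a < N / 3" "norm b < N / 3"
    using assms by (simp_all add: a_b_N_def)
  have N: "N > 0"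
    using ab(1) norm_ge_zero[of a] by linarith
  have "x \<bullet> y = N * N + d \<bullet> b + a \<bullet> d + a \<bullet> b"
    by (simp add: a_b_N_def inner_diff inner_commute power2_norm_eq_inner flip: power2_eq_square)
  moreover have "\<bar>d \<bullet> b\<bar> \<le> N * (N / 3)" "\<bar>a \<bullet> d\<bar> \<le> (N / 3) * N" "\<bar>a \<bullet> b\<bar> \<le> (N / 3) * (N / 3)"
    using ab N by (intro order_trans[OF Cauchy_Schwarz_ineq2] mult_mono; simp add: a_b_N_def(3)[symmetric])+
  moreover have "N * N > 0"
    using N by simp
  ultimately show ?thesis by (simp add: abs_le_iff)
qed

lemma has_vector_derivative_quotient:
  assumes "(f has_vector_derivative D) (at x within S)"
  shows "((\<lambda>t. (f t - f x) /\<^sub>R (t - x)) \<longlongrightarrow> D) (at x within S)"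
proof -
  have "((\<lambda>y. norm ((f y - f x) - (y - x) *\<^sub>R D) / norm (y - x)) \<longlongrightarrow> 0) (at x within S)"
    using assms by (simp add: has_vector_derivative_def has_derivative_iff_norm)
  then have "((\<lambda>y. norm ((f y - f x) /\<^sub>R (y - x) - D)) \<longlongrightarrow> 0) (at x within S)"
  proof (rule Lim_transform_eventually)
    show "\<forall>\<^sub>F y in at x within S. norm ((f y - f x) - (y - x) *\<^sub>R D) / norm (y - x)
        = norm ((f y - f x) /\<^sub>R (y - x) - D)"
      unfolding eventually_at_filter
    proof (intro always_eventually allI impI)
      fix y assume "y \<noteq> x"
      then have "(f y - f x) /\<^sub>R (y - x) - D = ((f y - f x) - (y - x) *\<^sub>R D) /\<^sub>R (y - x)"
        by (simp add: scaleR_diff_right)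
      then show "norm ((f y - f x) - (y - x) *\<^sub>R D) / norm (y - x) = norm ((f y - f x) /\<^sub>R (y - x) - D)"
        by (simp add: divide_inverse mult.commute)
    qed
  qed
  then show ?thesis
    by (simp add: tendsto_norm_zero_iff Lim_null[symmetric])
qed

lemma mem_rayI: "0 < \<rho> \<Longrightarrow> \<rho> < r \<Longrightarrow> x = z + \<rho> *\<^sub>R u \<rho> \<Longrightarrow> x \<in> ray z u r"
  by (auto simp: ray_def)

text \<open>Near the starting point both the chord slope and the velocity are close to
  \<open>D 0\<close>, so their inner product is positive and the distance to the starting point
  increases strictly. The inverse of this distance gives the new parameter. The rest of the arc is
  compact and misses the starting point, so it stays out of a small ball.\<close>

lemma radial_parametrization:
  fixes f D :: "real \<Rightarrow> complex"
  assumes L: "0 < L"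
    and der: "\<And>t. t \<in> {0..L} \<Longrightarrow> (f has_vector_derivative D t) (at t within {0..L})"
    and cont: "continuous_on {0..L} D" and nz: "D 0 \<noteq> 0" and inj: "inj_on f {0..L}"
  obtains r u where "0 < r" "continuous_on {0<..<r} u" "\<And>\<rho>. \<rho> \<in> {0<..<r} \<Longrightarrow> norm (u \<rho>) = 1"
    "(u \<longlongrightarrow> sgn (D 0)) (at_right 0)"
    "\<And>r'. r' \<le> r \<Longrightarrow> f ` {0<..L} \<inter> ball (f 0) r' = ray (f 0) u r'"
proof -
  define z N where "z = f 0" "N = norm (D 0)"
  define h where "h t = (f t - z) /\<^sub>R t" for t
  define G where "G t = norm (f t - z)" for t
  have cf: "continuous_on {0..L} f"
    by (metis der continuous_on_eq_continuous_within has_vector_derivative_continuous)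
  have at_r: "at 0 within {0..L} = at_right (0::real)"
    using at_within_Icc_at_right[OF L] .
  have N: "N / 3 > 0"
    using nz by (simp add: z_N_def)
  have h_lim: "(h \<longlongrightarrow> D 0) (at_right 0)"
  proof -
    have "(f has_vector_derivative D 0) (at 0 within {0..L})"
      using der L by simp
    from has_vector_derivative_quotient[OF this] show ?thesis
      by (simp add: h_def[abs_def] z_N_def at_r)
  qed
  have D_lim: "(D \<longlongrightarrow> D 0) (at_right 0)"
    using cont L unfolding continuous_on_def at_r[symmetric] by auto
  have "\<forall>\<^sub>F t in at_right 0. norm (h t - D 0) < N / 3 \<and> norm (D t - D 0) < N / 3 \<and> t < L"
    using tendstoD[OF h_lim N] tendstoD[OF D_lim N] eventually_at_right_less[of 0] order_tendstoD(2)[OF tendsto_ident_at L]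
    by eventually_elim (simp add: dist_norm)
  then obtain b where b: "b > 0" "\<And>t. 0 < t \<Longrightarrow> t < b \<Longrightarrow> norm (h t - D 0) < N / 3 \<and> norm (D t - D 0) < N / 3 \<and> t < L"
    unfolding eventually_at_right_field by auto
  \<comment> \<open>Half of \<open>b\<close>, so that the estimates hold up to and including
    \<delta>.\<close>
  define \<delta> where "\<delta> = b / 2"
  have \<delta>: "0 < \<delta>" "\<delta> < L" "\<And>t. 0 < t \<Longrightarrow> t \<le> \<delta> \<Longrightarrow> 0 < h t \<bullet> D t"
    using b b(2)[of "b / 2"] unfolding \<delta>_def z_N_def by (auto intro!: inner_pos_if_near[where d = "D 0"])
  have cG: "continuous_on {0..\<delta>} G"
    unfolding G_def using \<delta> by (intro continuous_intros continuous_on_subset[OF cf]) auto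
  have G_mono: "G s < G t" if st: "0 \<le> s" "s < t" "t \<le> \<delta>" for s t
  proof -
    \<comment> \<open>The squared distance has derivative
      \<open>2 * ((f x - z) \<bullet> D x)\<close>, whose sign is that of
      \<open>h x \<bullet> D x\<close>.\<close>
    have "(f s - z) \<bullet> (f s - z) < (f t - z) \<bullet> (f t - z)"
    proof (rule DERIV_pos_imp_increasing_open[OF st(2), of "\<lambda>x. (f x - z) \<bullet> (f x - z)"])
      fix x assume x: "s < x" "x < t"
      then have xL: "0 < x" "x < L" "x \<le> \<delta>"
        using st \<delta> by auto
      have "(f has_vector_derivative D x) (at x)"
        using der[of x] xL by (simp add: at_within_Icc_at)
      then have "((\<lambda>x. (f x - z) \<bullet> (f x - z)) has_vector_derivative (f x - z) \<bullet> D x + D x \<bullet> (f x - z)) (at x)"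
        by (intro bounded_bilinear.has_vector_derivative[OF bounded_bilinear_inner])
           (auto intro!: derivative_eq_intros)
      moreover have "(f x - z) \<bullet> D x > 0"
        using \<delta>(3)[of x] xL by (simp add: h_def zero_less_mult_iff)
      ultimately show "\<exists>y. ((\<lambda>x. (f x - z) \<bullet> (f x - z)) has_real_derivative y) (at x) \<and> 0 < y"
        by (auto simp: has_real_derivative_iff_has_vector_derivative inner_commute intro!: exI)
    next
      show "continuous_on {s..t} (\<lambda>x. (f x - z) \<bullet> (f x - z))"
        using st \<delta> by (intro continuous_intros continuous_on_subset[OF cf]) auto
    qed
    then show ?thesis
      by (simp add: G_def norm_eq_sqrt_inner)
  qed
  have injG: "inj_on G {0..\<delta>}"
    by (rule linorder_inj_onI) (use G_mono in \<open>fastforce+\<close>)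
  have G0: "G 0 = 0"
    by (simp add: G_def z_N_def)
  have imG: "G ` {0..\<delta>} = {0..G \<delta>}"
  proof
    show "G ` {0..\<delta>} \<subseteq> {0..G \<delta>}"
      using G_mono[of _ \<delta>] by (force simp: G_def less_le)
    show "{0..G \<delta>} \<subseteq> G ` {0..\<delta>}"
      using IVT'[of G 0 _ \<delta>] cG \<delta> G0 by (force simp: image_iff)
  qed
  define k where "k = inv_into {0..\<delta>} G"
  have kG: "k (G t) = t" if "t \<in> {0..\<delta>}" for t
    unfolding k_def using inv_into_f_f[OF injG that] .
  have Gk: "G (k \<rho>) = \<rho>" "k \<rho> \<in> {0..\<delta>}" if "\<rho> \<in> {0..G \<delta>}" for \<rho>
    using that f_inv_into_f[of \<rho> G "{0..\<delta>}"] inv_into_into[of \<rho> G "{0..\<delta>}"]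
    unfolding k_def imG by auto
  have ck: "continuous_on {0..G \<delta>} k"
    using continuous_on_inv[of "{0..\<delta>}" G k] cG kG by (simp add: imG)
  have k_pos: "k \<rho> > 0" if "0 < \<rho>" "\<rho> \<le> G \<delta>" for \<rho>
    using Gk[of \<rho>] that G0 by (cases "k \<rho> = 0") auto
  have G\<delta>: "G \<delta> > 0"
    using G_mono[of 0 \<delta>] G0 \<delta> by simp
  have "z \<notin> f ` {\<delta>..L}"
  proof
    assume "z \<in> f ` {\<delta>..L}"
    then obtain t where "t \<in> {\<delta>..L}" "f 0 = f t"
      by (auto simp: z_N_def)
    then show False
      using inj_onD[OF inj, of 0 t] \<delta> L by simp
  qed
  moreover have "closed (f ` {\<delta>..L})"
    using \<delta> by (intro compact_imp_closed compact_continuous_image continuous_on_subset[OF cf]) auto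
  ultimately obtain d where d: "d > 0" "\<And>x. x \<in> f ` {\<delta>..L} \<Longrightarrow> d \<le> dist z x"
    using separate_point_closed[of "f ` {\<delta>..L}" z] by metis
  define r where "r = min d (G \<delta>)"
  define u where "u \<rho> = (f (k \<rho>) - z) /\<^sub>R \<rho>" for \<rho>
  show ?thesis
  proof
    show "0 < r"
      using d G\<delta> by (simp add: r_def)
    have kim: "k ` {0<..<r} \<subseteq> {0..L}"
    proof safe
      fix \<rho> assume "\<rho> \<in> {0<..<r}"
      then show "k \<rho> \<in> {0..L}"
        using Gk(2)[of \<rho>] \<delta> by (simp add: r_def)
    qed
    have ck': "continuous_on {0<..<r} k"
      by (rule continuous_on_subset[OF ck]) (auto simp: r_def)
    show "continuous_on {0<..<r} u"
      unfolding u_def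
      by (intro continuous_intros continuous_on_compose2[OF cf ck' kim]) auto
    show "norm (u \<rho>) = 1" if "\<rho> \<in> {0<..<r}" for \<rho>
      using Gk(1)[of \<rho>] that by (auto simp: u_def G_def r_def)
    \<comment> \<open>The direction at distance \<rho> is the normalized chord slope
      \<open>h\<close> at the parameter \<open>k \<rho>\<close>, and chord slopes converge to the
      velocity.\<close>
    show "(u \<longlongrightarrow> sgn (D 0)) (at_right 0)"
    proof -
      have "(k \<longlongrightarrow> k 0) (at_right 0)"
        using ck G\<delta> by (simp add: continuous_on_Icc_at_rightD)
      moreover have "k 0 = 0"
        using kG[of 0] \<delta> G0 by simp
      moreover have ev: "\<forall>\<^sub>F \<rho> in at_right 0. 0 < \<rho> \<and> \<rho> < G \<delta>"
        using G\<delta> by (auto simp: eventually_at_right_field)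
      ultimately have "filterlim k (at_right 0) (at_right 0)"
        using k_pos by (fastforce simp: filterlim_at elim!: eventually_mono)
      from filterlim_compose[OF tendsto_sgn[OF h_lim nz] this]
      have "((\<lambda>\<rho>. sgn (h (k \<rho>))) \<longlongrightarrow> sgn (D 0)) (at_right 0)" .
      then show ?thesis
      proof (rule Lim_transform_eventually)
        show "\<forall>\<^sub>F \<rho> in at_right 0. sgn (h (k \<rho>)) = u \<rho>"
          using ev
        proof eventually_elim
          case (elim \<rho>)
          then show ?case
            using Gk(1)[of \<rho>] k_pos[of \<rho>] by (simp add: h_def u_def G_def sgn_scaleR sgn_div_norm)
        qed
      qed
    qed
    show "f ` {0<..L} \<inter> ball (f 0) r' = ray (f 0) u r'" if "r' \<le> r" for r'
    proof safe
      fix t assume t: "t \<in> {0<..L}" "f t \<in> ball (f 0) r'"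
      then have "dist z (f t) < d"
        using that by (simp add: r_def z_N_def)
      then have "t < \<delta>"
        using d(2)[of "f t"] t by force
      then have "k (G t) = t" "G t < r'" "0 < G t"
        using t kG[of t] G_mono[of 0 t] by (auto simp: G_def z_N_def dist_norm norm_minus_commute)
      then show "f t \<in> ray (f 0) u r'"
        by (intro mem_rayI[of "G t"]) (auto simp: u_def z_N_def)
    next
      fix x assume "x \<in> ray (f 0) u r'"
      then obtain \<rho> where \<rho>: "0 < \<rho>" "\<rho> < r'" "x = f 0 + \<rho> *\<^sub>R u \<rho>"
        by (auto simp: ray_def)
      then have x: "x = f (k \<rho>)"
        by (simp add: u_def z_N_def)
      have "\<rho> \<in> {0..G \<delta>}"
        using \<rho> that by (auto simp: r_def)
      note Gk[OF this]
      then show "x \<in> f ` {0<..L}" "x \<in> ball (f 0) r'"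
        using x k_pos[of \<rho>] \<rho> \<delta> \<open>\<rho> \<in> {0..G \<delta>}\<close>
        by (auto simp: G_def z_N_def dist_norm norm_minus_commute)
    qed
  qed
qed


subsection \<open>Sectors\<close>

text \<open>Angles are measured from the moving direction \<open>u \<rho>\<close> and the bounds
  depend on the radius, so regions between curved rays are covered as well.\<close>

definition sector ::
  "complex \<Rightarrow> (real \<Rightarrow> complex) \<Rightarrow> (real \<Rightarrow> real) \<Rightarrow> (real \<Rightarrow> real) \<Rightarrow> real \<Rightarrow> complex set" where
  "sector z u \<alpha> \<beta> r = {z + \<rho> *\<^sub>R (u \<rho> * cis \<theta>) | \<rho> \<theta>. 0 < \<rho> \<and> \<rho> < r \<and> \<alpha> \<rho> < \<theta> \<and> \<theta> < \<beta> \<rho>}"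

definition directions :: "real \<Rightarrow> (real \<Rightarrow> complex) \<Rightarrow> bool" where
  "directions r u \<longleftrightarrow> continuous_on {0<..<r} u \<and> (\<forall>\<rho>\<in>{0<..<r}. norm (u \<rho>) = 1)"

lemma directionsD:
  assumes "directions r u"
  shows "continuous_on {0<..<r} u" "0 < \<rho> \<Longrightarrow> \<rho> < r \<Longrightarrow> norm (u \<rho>) = 1"
  using assms by (auto simp: directions_def)

lemma directions_mono: "directions r u \<Longrightarrow> r' \<le> r \<Longrightarrow> directions r' u"
  unfolding directions_def by (auto elim!: continuous_on_subset)

lemma cis_inj_on_period:
  assumes "cis x = cis y" "x \<le> y" "y < x + 2 * pi"
  shows "x = y"
proof -
  have "cis (y - x) = 1"
    using assms(1) by (simp add: cis_divide[symmetric])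
  then have "Arg2pi 1 = y - x"
    using assms by (intro Arg2pi_unique[of 1]) (auto simp: cis_conv_exp)
  then show ?thesis
    using Arg2pi_of_real[of 1] by simp
qed

lemma sector_ball:
  assumes "directions r u" "r' \<le> r"
  shows "sector z u \<alpha> \<beta> r \<inter> ball z r' = sector z u \<alpha> \<beta> r'"
proof -
  have "dist z (z + \<rho> *\<^sub>R (u \<rho> * cis \<theta>)) = \<rho>" if "0 < \<rho>" "\<rho> < r" for \<rho> \<theta>
    using directionsD(2)[OF assms(1) that] that by (simp add: dist_norm norm_mult)
  then show ?thesis
    using assms(2) unfolding sector_def by fastforce
qed

lemma sector_norm:
  assumes "directions r u" "x \<in> sector z u \<alpha> \<beta> r"
  obtains \<theta> where "0 < norm (x - z)" "norm (x - z) < r"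
    "\<alpha> (norm (x - z)) < \<theta>" "\<theta> < \<beta> (norm (x - z))"
    "x - z = norm (x - z) *\<^sub>R (u (norm (x - z)) * cis \<theta>)"
proof -
  obtain \<rho> \<theta> where x: "x = z + \<rho> *\<^sub>R (u \<rho> * cis \<theta>)" "0 < \<rho>" "\<rho> < r" "\<alpha> \<rho> < \<theta>" "\<theta> < \<beta> \<rho>"
    using assms(2) by (auto simp: sector_def)
  have "norm (x - z) = \<rho>"
    using directionsD(2)[OF assms(1) x(2,3)] x(1,2) by (simp add: norm_mult)
  then show ?thesis
    using that[of \<theta>] x by simp
qed

lemma sectorI:
  assumes "0 < norm (x - z)" "norm (x - z) < r"
    "\<alpha> (norm (x - z)) < \<theta>" "\<theta> < \<beta> (norm (x - z))"
    "x - z = norm (x - z) *\<^sub>R (u (norm (x - z)) * cis \<theta>)"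
  shows "x \<in> sector z u \<alpha> \<beta> r"
proof -
  have "x = z + norm (x - z) *\<^sub>R (u (norm (x - z)) * cis \<theta>)"
    using assms(5) by (metis add.commute diff_add_cancel)
  then show ?thesis
    unfolding sector_def using assms(1-4) by blast
qed

text \<open>The image of a rectangle: interpolating between the bounding angles replaces the angle
  by a parameter in the unit interval.\<close>

lemma connected_sector:
  assumes u: "directions r u"
    and \<alpha>: "continuous_on {0<..<r} \<alpha>" and \<beta>: "continuous_on {0<..<r} \<beta>"
    and lt: "\<And>\<rho>. 0 < \<rho> \<Longrightarrow> \<rho> < r \<Longrightarrow> \<alpha> \<rho> < \<beta> \<rho>"
  shows "connected (sector z u \<alpha> \<beta> r)"
proof -
  define F where "F = (\<lambda>(\<rho>, s). z + \<rho> *\<^sub>R (u \<rho> * cis ((1 - s) * \<alpha> \<rho> + s * \<beta> \<rho>)))"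
  have "sector z u \<alpha> \<beta> r = F ` ({0<..<r} \<times> {0<..<1})"
  proof safe
    fix x assume "x \<in> sector z u \<alpha> \<beta> r"
    then obtain \<rho> \<theta> where x: "x = z + \<rho> *\<^sub>R (u \<rho> * cis \<theta>)" "0 < \<rho>" "\<rho> < r" "\<alpha> \<rho> < \<theta>" "\<theta> < \<beta> \<rho>"
      by (auto simp: sector_def)
    define s where "s = (\<theta> - \<alpha> \<rho>) / (\<beta> \<rho> - \<alpha> \<rho>)"
    have "s * (\<beta> \<rho> - \<alpha> \<rho>) = \<theta> - \<alpha> \<rho>"
      using lt[OF x(2,3)] by (simp add: s_def)
    then have "(1 - s) * \<alpha> \<rho> + s * \<beta> \<rho> = \<theta>"
      by (simp add: algebra_simps)
    moreover have "0 < s" "s < 1"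
      using x lt[OF x(2,3)] by (auto simp: s_def)
    ultimately show "x \<in> F ` ({0<..<r} \<times> {0<..<1})"
      using x by (intro image_eqI[of _ _ "(\<rho>, s)"]) (auto simp: F_def)
  next
    fix \<rho> s :: real assume s: "\<rho> \<in> {0<..<r}" "s \<in> {0<..<1}"
    have "\<alpha> \<rho> < (1 - s) * \<alpha> \<rho> + s * \<beta> \<rho>" "(1 - s) * \<alpha> \<rho> + s * \<beta> \<rho> < \<beta> \<rho>"
      using convex_bound_lt[of "\<alpha> \<rho>" "\<beta> \<rho>" "\<beta> \<rho>" "1 - s" s]
        mult_strict_left_mono[of "\<alpha> \<rho>" "\<beta> \<rho>" s] mult_strict_left_mono[of "\<alpha> \<rho>" "\<beta> \<rho>" "1 - s"] lt[of \<rho>] s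
      by (auto simp: algebra_simps)
    then show "F (\<rho>, s) \<in> sector z u \<alpha> \<beta> r"
      using s unfolding sector_def F_def by auto
  qed
  moreover have "continuous_on ({0<..<r} \<times> {0<..<1}) F"
    unfolding F_def case_prod_unfold
    by (intro continuous_intros continuous_on_compose2[OF directionsD(1)[OF u]]
        continuous_on_compose2[OF \<alpha>] continuous_on_compose2[OF \<beta>]) auto
  ultimately show ?thesis
    by (auto intro!: connected_continuous_image connected_Times)
qed

text \<open>With the bisecting direction \<open>c\<close> and half the opening angle
  \<open>h\<close>, which is at most pi, membership at distance \<rho> amounts to
  \<open>Re ((x - z) * cnj (c \<rho>)) > \<rho> * cos (h \<rho>)\<close>. This is a strict
  inequality between continuous functions and needs no continuous choice of the angle.\<close>

lemma open_sector:
  assumes u: "directions r u"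
    and \<alpha>: "continuous_on {0<..<r} \<alpha>" and \<beta>: "continuous_on {0<..<r} \<beta>"
    and lt: "\<And>\<rho>. 0 < \<rho> \<Longrightarrow> \<rho> < r \<Longrightarrow> \<alpha> \<rho> < \<beta> \<rho> \<and> \<beta> \<rho> \<le> \<alpha> \<rho> + 2 * pi"
  shows "open (sector z u \<alpha> \<beta> r)"
proof -
  define D where "D = ball z r - {z}"
  define c where "c \<rho> = u \<rho> * cis ((\<alpha> \<rho> + \<beta> \<rho>) / 2)" for \<rho>
  define h where "h \<rho> = (\<beta> \<rho> - \<alpha> \<rho>) / 2" for \<rho>
  define R where "R x = Re ((x - z) * cnj (c (norm (x - z)))) - norm (x - z) * cos (h (norm (x - z)))" for x
  have D: "open D" "\<And>x. x \<in> D \<Longrightarrow> 0 < norm (x - z) \<and> norm (x - z) < r"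
    unfolding D_def by (auto simp: dist_norm norm_minus_commute)
  have h: "0 < h \<rho>" "h \<rho> \<le> pi" if "0 < \<rho>" "\<rho> < r" for \<rho>
    using lt[OF that] by (auto simp: h_def)
  have "sector z u \<alpha> \<beta> r = D \<inter> R -` {0<..}"
  proof (rule set_eqI, rule iffI)
    fix x assume x: "x \<in> sector z u \<alpha> \<beta> r"
    define \<rho> where "\<rho> = norm (x - z)"
    obtain \<theta> where \<theta>: "0 < \<rho>" "\<rho> < r" "\<alpha> \<rho> < \<theta>" "\<theta> < \<beta> \<rho>" "x - z = \<rho> *\<^sub>R (u \<rho> * cis \<theta>)"
      using sector_norm[OF u x] unfolding \<rho>_def by metis
    have u1: "u \<rho> * cnj (u \<rho>) = 1"
      using directionsD(2)[OF u \<theta>(1,2)] by (simp add: complex_norm_square[symmetric])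
    have "(x - z) * cnj (c \<rho>) = \<rho> *\<^sub>R ((u \<rho> * cnj (u \<rho>)) * (cis \<theta> * cnj (cis ((\<alpha> \<rho> + \<beta> \<rho>) / 2))))"
      unfolding \<theta>(5) c_def by (simp add: scaleR_conv_of_real)
    also have "\<dots> = \<rho> *\<^sub>R cis (\<theta> - (\<alpha> \<rho> + \<beta> \<rho>) / 2)"
      by (simp add: u1 cis_cnj cis_mult del: cis_divide)
    finally have "R x = \<rho> * (cos (\<theta> - (\<alpha> \<rho> + \<beta> \<rho>) / 2) - cos (h \<rho>))"
      by (simp add: R_def \<rho>_def[symmetric] algebra_simps)
    moreover have "cos (h \<rho>) < cos \<bar>\<theta> - (\<alpha> \<rho> + \<beta> \<rho>) / 2\<bar>"
      using \<theta> h[OF \<theta>(1,2)] by (intro cos_monotone_0_pi) (auto simp: h_def abs_if field_simps)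
    ultimately have "R x > 0"
      unfolding cos_abs_real using mult_pos_pos[OF \<theta>(1)] by simp
    then show "x \<in> D \<inter> R -` {0<..}"
      using \<theta>(1,2) by (auto simp: D_def \<rho>_def dist_norm norm_minus_commute)
  next
    fix x assume x: "x \<in> D \<inter> R -` {0<..}"
    define \<rho> where "\<rho> = norm (x - z)"
    have \<rho>: "0 < \<rho>" "\<rho> < r"
      using D(2) x by (auto simp: \<rho>_def)
    have u1: "norm (c \<rho>) = 1"
      using directionsD(2)[OF u \<rho>] by (simp add: c_def norm_mult)
    define w where "w = (x - z) / (\<rho> * c \<rho>)"
    have nw: "norm w = 1"
      using u1 \<rho> by (simp add: w_def norm_divide norm_mult) (simp add: \<rho>_def)
    define \<phi> where "\<phi> = Arg w"
    have w: "w = cis \<phi>"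
      using nw Arg_eq[of w] by (cases "w = 0") (auto simp: \<phi>_def cis_conv_exp)
    have c0: "c \<rho> \<noteq> 0"
      using u1 by auto
    have xz: "x - z = \<rho> *\<^sub>R (c \<rho> * cis \<phi>)"
      using c0 \<rho> unfolding w[symmetric] w_def by (simp add: scaleR_conv_of_real)
    have "(x - z) * cnj (c \<rho>) = \<rho> *\<^sub>R (cis \<phi> * (c \<rho> * cnj (c \<rho>)))"
      unfolding xz by (simp add: scaleR_conv_of_real)
    also have "c \<rho> * cnj (c \<rho>) = 1"
      using u1 by (simp add: complex_norm_square[symmetric])
    finally have "R x = \<rho> * (cos \<phi> - cos (h \<rho>))"
      by (simp add: R_def \<rho>_def[symmetric] algebra_simps)
    then have "cos (h \<rho>) < cos \<bar>\<phi>\<bar>"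
      using x \<rho> by (simp add: abs_if zero_less_mult_iff)
    then have "\<bar>\<phi>\<bar> < h \<rho>"
      using cos_monotone_0_pi_le[of "h \<rho>" "\<bar>\<phi>\<bar>"] h[OF \<rho>] Arg_bounded[of w]
      by (fastforce simp: \<phi>_def not_less[symmetric])
    moreover have "x = z + \<rho> *\<^sub>R (u \<rho> * cis ((\<alpha> \<rho> + \<beta> \<rho>) / 2 + \<phi>))"
      using xz by (simp add: c_def cis_mult[symmetric] mult.assoc diff_eq_eq add.commute)
    ultimately show "x \<in> sector z u \<alpha> \<beta> r"
      using \<rho> unfolding sector_def h_def
      by (intro CollectI exI[of _ \<rho>] exI[of _ "(\<alpha> \<rho> + \<beta> \<rho>) / 2 + \<phi>"]) (auto simp: abs_less_iff field_simps)
  qed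
  moreover have "continuous_on D R"
    unfolding R_def c_def h_def
    by (intro continuous_intros continuous_on_compose2[OF directionsD(1)[OF u]]
        continuous_on_compose2[OF \<alpha>] continuous_on_compose2[OF \<beta>]) (use D(2) in auto)
  ultimately show ?thesis
    using D(1) by (simp add: continuous_open_preimage)
qed

lemma sector_disjoint:
  assumes u: "directions r u"
    and le: "\<And>\<rho>. 0 < \<rho> \<Longrightarrow> \<rho> < r \<Longrightarrow> \<beta> \<rho> \<le> \<alpha>' \<rho> \<and> \<beta>' \<rho> \<le> \<alpha> \<rho> + 2 * pi"
  shows "sector z u \<alpha> \<beta> r \<inter> sector z u \<alpha>' \<beta>' r = {}"
proof (rule ccontr)
  assume "\<not> ?thesis"
  then obtain x where x: "x \<in> sector z u \<alpha> \<beta> r" "x \<in> sector z u \<alpha>' \<beta>' r" by auto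
  define \<rho> where "\<rho> = norm (x - z)"
  obtain \<theta> where \<theta>: "0 < \<rho>" "\<rho> < r" "\<alpha> \<rho> < \<theta>" "\<theta> < \<beta> \<rho>" "x - z = \<rho> *\<^sub>R (u \<rho> * cis \<theta>)"
    using sector_norm[OF u x(1)] unfolding \<rho>_def by metis
  obtain \<theta>' where \<theta>': "\<alpha>' \<rho> < \<theta>'" "\<theta>' < \<beta>' \<rho>" "x - z = \<rho> *\<^sub>R (u \<rho> * cis \<theta>')"
    using sector_norm[OF u x(2)] unfolding \<rho>_def by metis
  have "u \<rho> \<noteq> 0"
    using directionsD(2)[OF u \<theta>(1,2)] by auto
  then have "cis \<theta> = cis \<theta>'"
    using \<theta>(1,5) \<theta>'(3) by simp
  then have "\<theta> = \<theta>'"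
    using le[OF \<theta>(1,2)] \<theta> \<theta>' by (intro cis_inj_on_period) auto
  then show False
    using le[OF \<theta>(1,2)] \<theta> \<theta>' by auto
qed

lemma ray_subset_sector:
  assumes "directions r u" "\<And>\<rho>. 0 < \<rho> \<Longrightarrow> \<rho> < r \<Longrightarrow> \<alpha> \<rho> < \<theta> \<rho> \<and> \<theta> \<rho> < \<beta> \<rho> \<and> v \<rho> = u \<rho> * cis (\<theta> \<rho>)"
  shows "ray z v r \<subseteq> sector z u \<alpha> \<beta> r"
  using assms unfolding ray_def sector_def by fastforce

lemma ray_subset_closure_sector:
  assumes "\<And>\<rho>. 0 < \<rho> \<Longrightarrow> \<rho> < r \<Longrightarrow> \<alpha> \<rho> < \<beta> \<rho> \<and> \<theta> \<rho> \<in> {\<alpha> \<rho>..\<beta> \<rho>} \<and> v \<rho> = u \<rho> * cis (\<theta> \<rho>)"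
  shows "ray z v r \<subseteq> closure (sector z u \<alpha> \<beta> r)"
proof
  fix x assume "x \<in> ray z v r"
  then obtain \<rho> where x: "0 < \<rho>" "\<rho> < r" "x = z + \<rho> *\<^sub>R v \<rho>"
    by (auto simp: ray_def)
  define F where "F \<theta> = z + \<rho> *\<^sub>R (u \<rho> * cis \<theta>)" for \<theta>
  have "F ` closure {\<alpha> \<rho><..<\<beta> \<rho>} \<subseteq> closure (sector z u \<alpha> \<beta> r)"
  proof (rule image_closure_subset)
    show "continuous_on (closure {\<alpha> \<rho><..<\<beta> \<rho>}) F"
      unfolding F_def by (intro continuous_intros)
    have "F ` {\<alpha> \<rho><..<\<beta> \<rho>} \<subseteq> sector z u \<alpha> \<beta> r"
    proof (rule image_subsetI)
      fix \<theta> assume "\<theta> \<in> {\<alpha> \<rho><..<\<beta> \<rho>}"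
      then show "F \<theta> \<in> sector z u \<alpha> \<beta> r"
        using x(1,2) unfolding F_def sector_def by (intro CollectI exI[of _ \<rho>] exI[of _ \<theta>]) auto
    qed
    then show "F ` {\<alpha> \<rho><..<\<beta> \<rho>} \<subseteq> closure (sector z u \<alpha> \<beta> r)"
      using closure_subset by blast
  qed simp
  moreover have "x = F (\<theta> \<rho>)" "\<theta> \<rho> \<in> closure {\<alpha> \<rho><..<\<beta> \<rho>}"
    using assms[OF x(1,2)] x by (auto simp: F_def closure_greaterThanLessThan)
  ultimately show "x \<in> closure (sector z u \<alpha> \<beta> r)"
    by blast
qed

text \<open>As the unit vectors \<open>u\<close> and \<open>v\<close> never agree, their quotient
  stays off the nonnegative reals, where \<open>Arg2pi\<close> would jump.\<close>

lemma direction_angle: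
  assumes "directions r u" "directions r v" "\<forall>\<rho>\<in>{0<..<r}. u \<rho> \<noteq> v \<rho>"
  defines "\<psi> \<equiv> \<lambda>\<rho>. Arg2pi (v \<rho> / u \<rho>)"
  shows "continuous_on {0<..<r} \<psi>"
    "0 < \<rho> \<Longrightarrow> \<rho> < r \<Longrightarrow> 0 < \<psi> \<rho> \<and> \<psi> \<rho> < 2 * pi \<and> v \<rho> = u \<rho> * cis (\<psi> \<rho>)"
proof -
  have v: "v \<rho> = u \<rho> * cis (\<psi> \<rho>)" if "0 < \<rho>" "\<rho> < r" for \<rho>
  proof -
    have "norm (v \<rho> / u \<rho>) = 1"
      using directionsD(2)[OF assms(1) that] directionsD(2)[OF assms(2) that] by (simp add: norm_divide)
    then have "v \<rho> / u \<rho> = cis (\<psi> \<rho>)"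
      using Arg2pi_eq[of "v \<rho> / u \<rho>"] by (simp add: \<psi>_def cis_conv_exp)
    moreover have "u \<rho> \<noteq> 0"
      using directionsD(2)[OF assms(1) that] by auto
    ultimately show ?thesis by (simp add: field_simps)
  qed
  have pos: "0 < \<psi> \<rho>" if "0 < \<rho>" "\<rho> < r" for \<rho>
  proof -
    have "\<psi> \<rho> \<noteq> 0"
      using v[OF that] assms(3)[rule_format, of \<rho>] that by auto
    then show ?thesis
      using Arg2pi_ge_0[of "v \<rho> / u \<rho>"] unfolding \<psi>_def by linarith
  qed
  have "\<psi> \<rho> < 2 * pi"
    unfolding \<psi>_def by (rule Arg2pi_lt_2pi)
  then show "0 < \<rho> \<Longrightarrow> \<rho> < r \<Longrightarrow> 0 < \<psi> \<rho> \<and> \<psi> \<rho> < 2 * pi \<and> v \<rho> = u \<rho> * cis (\<psi> \<rho>)"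
    using pos[of \<rho>] v[of \<rho>] by blast
  show "continuous_on {0<..<r} \<psi>"
    unfolding \<psi>_def
  proof (rule continuous_on_compose2[where g = Arg2pi and t = "- \<real>\<^sub>\<ge>\<^sub>0"])
    show "continuous_on (- \<real>\<^sub>\<ge>\<^sub>0) Arg2pi"
      by (intro continuous_at_imp_continuous_on ballI continuous_at_Arg2pi) auto
    show "continuous_on {0<..<r} (\<lambda>\<rho>. v \<rho> / u \<rho>)"
      using directionsD(2)[OF assms(1)]
      by (intro continuous_intros directionsD(1)[OF assms(1)] directionsD(1)[OF assms(2)]) force
    show "(\<lambda>\<rho>. v \<rho> / u \<rho>) ` {0<..<r} \<subseteq> - \<real>\<^sub>\<ge>\<^sub>0"
    proof (rule image_subsetI)
      fix \<rho> assume "\<rho> \<in> {0<..<r}"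
      then have "Arg2pi (v \<rho> / u \<rho>) \<noteq> 0"
        using pos[of \<rho>] by (simp add: \<psi>_def)
      then show "v \<rho> / u \<rho> \<in> - \<real>\<^sub>\<ge>\<^sub>0"
        by (auto simp: Arg2pi_eq_0 complex_nonneg_Reals_iff complex_is_Real_iff)
    qed
  qed
qed

section \<open>Decomposition of a punctured disc by rays\<close>

lemma sector_cover:
  assumes u: "directions r u" and x: "x \<in> ball z r - {z}"
  shows "x \<in> ray z u r \<or> x \<in> sector z u (\<lambda>_. 0) (\<lambda>_. 2 * pi) r"
proof -
  define \<rho> where "\<rho> = norm (x - z)"
  have \<rho>: "0 < \<rho>" "\<rho> < r"
    using x by (auto simp: \<rho>_def dist_norm norm_minus_commute)
  define w where "w = (x - z) / (\<rho> * u \<rho>)"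
  have u1: "norm (u \<rho>) = 1"
    using directionsD(2)[OF u \<rho>] .
  have nw: "norm w = 1"
    using u1 \<rho> by (simp add: w_def norm_divide norm_mult) (simp add: \<rho>_def)
  have w: "w = cis (Arg2pi w)"
    using nw Arg2pi_eq[of w] by (auto simp: cis_conv_exp)
  have xz: "x - z = \<rho> *\<^sub>R (u \<rho> * cis (Arg2pi w))"
  proof -
    have "u \<rho> \<noteq> 0"
      using u1 by auto
    then have "x - z = \<rho> *\<^sub>R (u \<rho> * w)"
      using \<rho> by (simp add: w_def scaleR_conv_of_real)
    then show ?thesis
      using w by simp
  qed
  show ?thesis
  proof (cases "Arg2pi w = 0")
    case True
    then show ?thesis
      using xz \<rho> by (intro disjI1 mem_rayI[of \<rho>]) (auto simp: algebra_simps)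
  next
    case False
    then show ?thesis
      using xz \<rho> Arg2pi_ge_0[of w] Arg2pi_lt_2pi[of w]
      by (intro disjI2 sectorI[where \<theta> = "Arg2pi w"]) (auto simp: \<rho>_def)
  qed
qed

lemma sector_split:
  assumes u: "directions r u" and v: "\<And>\<rho>. 0 < \<rho> \<Longrightarrow> \<rho> < r \<Longrightarrow> \<alpha> \<rho> < \<psi> \<rho> \<and> \<psi> \<rho> < \<beta> \<rho> \<and> v \<rho> = u \<rho> * cis (\<psi> \<rho>)"
  shows "sector z u \<alpha> \<beta> r = sector z u \<alpha> \<psi> r \<union> ray z v r \<union> sector z u \<psi> \<beta> r"
proof
  show "sector z u \<alpha> \<beta> r \<subseteq> sector z u \<alpha> \<psi> r \<union> ray z v r \<union> sector z u \<psi> \<beta> r"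
  proof
    fix x assume "x \<in> sector z u \<alpha> \<beta> r"
    then obtain \<rho> \<theta> where x: "x = z + \<rho> *\<^sub>R (u \<rho> * cis \<theta>)" "0 < \<rho>" "\<rho> < r" "\<alpha> \<rho> < \<theta>" "\<theta> < \<beta> \<rho>"
      by (auto simp: sector_def)
    consider "\<theta> < \<psi> \<rho>" | "\<theta> = \<psi> \<rho>" | "\<theta> > \<psi> \<rho>" by linarith
    then show "x \<in> sector z u \<alpha> \<psi> r \<union> ray z v r \<union> sector z u \<psi> \<beta> r"
    proof cases
      case 2
      then show ?thesis
        using x v[OF x(2,3)] by (auto intro!: mem_rayI[of \<rho>])
    qed (use x in \<open>auto simp: sector_def\<close>)
  qed
  show "sector z u \<alpha> \<psi> r \<union> ray z v r \<union> sector z u \<psi> \<beta> r \<subseteq> sector z u \<alpha> \<beta> r"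
    using v unfolding sector_def ray_def by fastforce
qed

lemma ray_avoids_sector_full:
  assumes u: "directions r u"
  shows "ray z u r \<inter> sector z u (\<lambda>_. 0) (\<lambda>_. 2 * pi) r = {}"
proof (rule ccontr)
  assume "\<not> ?thesis"
  then obtain x where x: "x \<in> ray z u r" "x \<in> sector z u (\<lambda>_. 0) (\<lambda>_. 2 * pi) r" by auto
  define \<rho> where "\<rho> = norm (x - z)"
  obtain \<theta> where \<theta>: "0 < \<rho>" "\<rho> < r" "0 < \<theta>" "\<theta> < 2 * pi" "x - z = \<rho> *\<^sub>R (u \<rho> * cis \<theta>)"
    using sector_norm[OF u x(2)] unfolding \<rho>_def by metis
  obtain \<sigma> where \<sigma>: "0 < \<sigma>" "\<sigma> < r" "x = z + \<sigma> *\<^sub>R u \<sigma>"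
    using x(1) by (auto simp: ray_def)
  have "\<rho> = \<sigma>"
    using directionsD(2)[OF u \<sigma>(1,2)] \<sigma> by (simp add: \<rho>_def)
  moreover have "u \<rho> \<noteq> 0"
    using directionsD(2)[OF u \<theta>(1,2)] by auto
  ultimately have "cis 0 = cis \<theta>"
    using \<theta> \<sigma> by simp
  then have "0 = \<theta>"
    by (rule cis_inj_on_period) (use \<theta> in auto)
  then show False
    using \<theta> by simp
qed


lemma two_ray_sectors:
  fixes z :: complex
  assumes u: "directions r u" and v: "directions r v" and ne: "\<forall>\<rho>\<in>{0<..<r}. u \<rho> \<noteq> v \<rho>"
  defines "\<psi> \<equiv> \<lambda>\<rho>. Arg2pi (v \<rho> / u \<rho>)"
  defines "S1 \<equiv> sector z u (\<lambda>_. 0) \<psi> r" and "S2 \<equiv> sector z u \<psi> (\<lambda>_. 2 * pi) r"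
  shows "open S1" "open S2" "connected S1" "connected S2" "S1 \<inter> S2 = {}"
    "ball z r - {z} - ray z u r - ray z v r = S1 \<union> S2"
    "ray z u r \<union> ray z v r \<subseteq> closure S1 \<inter> closure S2"
proof -
  have \<psi>1: "continuous_on {0<..<r} \<psi>"
    unfolding \<psi>_def by (rule direction_angle(1)[OF u v ne])
  have \<psi>2: "0 < \<psi> \<rho> \<and> \<psi> \<rho> < 2 * pi \<and> v \<rho> = u \<rho> * cis (\<psi> \<rho>)" if "0 < \<rho>" "\<rho> < r" for \<rho>
    unfolding \<psi>_def by (rule direction_angle(2)[OF u v ne that])
  note \<psi> = \<psi>1 \<psi>2
  note c = continuous_on_const[of "{0<..<r}"]
  show "open S1"
    unfolding S1_def
  proof (intro open_sector u \<psi>(1) c)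
    fix \<rho> assume "0 < \<rho>" "\<rho> < r"
    from \<psi>(2)[OF this] show "0 < \<psi> \<rho> \<and> \<psi> \<rho> \<le> 0 + 2 * pi"
      by simp
  qed
  show "open S2"
    unfolding S2_def
  proof (intro open_sector u \<psi>(1) c)
    fix \<rho> assume "0 < \<rho>" "\<rho> < r"
    from \<psi>(2)[OF this] show "\<psi> \<rho> < 2 * pi \<and> 2 * pi \<le> \<psi> \<rho> + 2 * pi"
      by simp
  qed
  show "connected S1"
    unfolding S1_def by (intro connected_sector u \<psi>(1) c) (use \<psi>(2) in force)
  show "connected S2"
    unfolding S2_def by (intro connected_sector u \<psi>(1) c) (use \<psi>(2) in force)
  show dis: "S1 \<inter> S2 = {}"
    unfolding S1_def S2_def by (rule sector_disjoint[OF u]) auto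
  have full: "sector z u (\<lambda>_. 0) (\<lambda>_. 2 * pi) r = S1 \<union> ray z v r \<union> S2"
    unfolding S1_def S2_def by (rule sector_split[OF u]) (use \<psi>(2) in blast)
  have uniq: "\<theta> = \<psi> \<rho>" if "0 < \<rho>" "\<rho> < r" "0 < \<theta>" "\<theta> < 2 * pi" "v \<rho> = u \<rho> * cis \<theta>" for \<rho> \<theta>
  proof -
    have "u \<rho> \<noteq> 0"
      using directionsD(2)[OF u that(1,2)] by auto
    then have "cis \<theta> = cis (\<psi> \<rho>)"
      using that(5) \<psi>(2)[OF that(1,2)] by simp
    then show ?thesis
      using cis_inj_on_period[of \<theta> "\<psi> \<rho>"] cis_inj_on_period[of "\<psi> \<rho>" \<theta>] that \<psi>(2)[OF that(1,2)]
      by (cases "\<theta> \<le> \<psi> \<rho>") auto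
  qed
  have "x \<notin> S1 \<and> x \<notin> S2" if x: "x \<in> ray z v r" for x
  proof -
    obtain \<sigma> where \<sigma>: "0 < \<sigma>" "\<sigma> < r" "x = z + \<sigma> *\<^sub>R v \<sigma>"
      using x by (auto simp: ray_def)
    have n: "norm (x - z) = \<sigma>"
      using directionsD(2)[OF v \<sigma>(1,2)] \<sigma> by simp
    show ?thesis
    proof (intro conjI notI)
      assume "x \<in> S1"
      then obtain \<theta> where "0 < \<theta>" "\<theta> < \<psi> \<sigma>" "x - z = \<sigma> *\<^sub>R (u \<sigma> * cis \<theta>)"
        using sector_norm[OF u] unfolding S1_def n[symmetric] by metis
      then show False
        using uniq[OF \<sigma>(1,2), of \<theta>] \<psi>(2)[OF \<sigma>(1,2)] \<sigma> by simp
    next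
      assume "x \<in> S2"
      then obtain \<theta> where "\<psi> \<sigma> < \<theta>" "\<theta> < 2 * pi" "x - z = \<sigma> *\<^sub>R (u \<sigma> * cis \<theta>)"
        using sector_norm[OF u] unfolding S2_def n[symmetric] by metis
      then show False
        using uniq[OF \<sigma>(1,2), of \<theta>] \<psi>(2)[OF \<sigma>(1,2)] \<sigma> by simp
    qed
  qed
  then have v': "ray z v r \<inter> S1 = {}" "ray z v r \<inter> S2 = {}"
    by blast+
  have "S1 \<union> S2 \<subseteq> ball z r - {z}"
  proof
    fix x assume "x \<in> S1 \<union> S2"
    then have "x \<in> sector z u (\<lambda>_. 0) (\<lambda>_. 2 * pi) r"
      using full by auto
    then show "x \<in> ball z r - {z}"
      by (rule sector_norm[OF u]) (auto simp: dist_norm norm_minus_commute)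
  qed
  then show "ball z r - {z} - ray z u r - ray z v r = S1 \<union> S2"
    using sector_cover[OF u, of _ z] full v' ray_avoids_sector_full[OF u, of z] by blast
  show "ray z u r \<union> ray z v r \<subseteq> closure S1 \<inter> closure S2"
  proof -
    have "ray z u r \<subseteq> closure S1"
      unfolding S1_def by (rule ray_subset_closure_sector[where \<theta> = "\<lambda>_. 0"]) (use \<psi>(2) in force)
    moreover have "ray z v r \<subseteq> closure S1"
      unfolding S1_def by (rule ray_subset_closure_sector[where \<theta> = \<psi>]) (use \<psi>(2) in force)
    moreover have "ray z v r \<subseteq> closure S2"
      unfolding S2_def by (rule ray_subset_closure_sector[where \<theta> = \<psi>]) (use \<psi>(2) in force)
    moreover have "ray z u r \<subseteq> closure S2"
      unfolding S2_def by (rule ray_subset_closure_sector[where \<theta> = "\<lambda>_. 2 * pi"]) (use \<psi>(2) in force)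
    ultimately show ?thesis by blast
  qed
qed

text \<open>Three rays cut a disc into three sectors; \<open>S i\<close> is the one opposite to the ray \<open>i\<close>.\<close>

definition opposite_sectors ::
  "complex \<Rightarrow> real \<Rightarrow> 'i set \<Rightarrow> ('i \<Rightarrow> real \<Rightarrow> complex) \<Rightarrow> ('i \<Rightarrow> complex set) \<Rightarrow> bool" where
  "opposite_sectors z r I u S \<longleftrightarrow>
     (\<forall>i\<in>I. open (S i)) \<and> (\<forall>i\<in>I. \<forall>j\<in>I. i \<noteq> j \<longrightarrow> S i \<inter> S j = {}) \<and>
     (\<forall>r'. 0 < r' \<longrightarrow> r' \<le> r \<longrightarrow>
        (\<forall>i\<in>I. connected (S i \<inter> ball z r')) \<and>
        ball z r' - {z} - (\<Union>i\<in>I. ray z (u i) r') = (\<Union>i\<in>I. S i) \<inter> ball z r' \<and>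
        (\<forall>i\<in>I. \<forall>j\<in>I. i \<noteq> j \<longrightarrow> ray z (u i) r' \<subseteq> closure (S j \<inter> ball z r')) \<and>
        (\<forall>i\<in>I. ray z (u i) r' \<inter> closure (S i) = {}))"

lemma opposite_sectors_ordered:
  fixes u :: "'i \<Rightarrow> real \<Rightarrow> complex"
  assumes u: "directions r (u a)" and "directions r (u b)" "directions r (u c)"
    and abc: "a \<noteq> b" "b \<noteq> c" "a \<noteq> c"
    and \<beta>: "continuous_on {0<..<r} \<beta>" "\<And>\<rho>. 0 < \<rho> \<Longrightarrow> \<rho> < r \<Longrightarrow> 0 < \<beta> \<rho> \<and> u b \<rho> = u a \<rho> * cis (\<beta> \<rho>)"
    and \<gamma>: "continuous_on {0<..<r} \<gamma>" "\<And>\<rho>. 0 < \<rho> \<Longrightarrow> \<rho> < r \<Longrightarrow> \<gamma> \<rho> < 2 * pi \<and> u c \<rho> = u a \<rho> * cis (\<gamma> \<rho>)"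
    and lt: "\<And>\<rho>. 0 < \<rho> \<Longrightarrow> \<rho> < r \<Longrightarrow> \<beta> \<rho> < \<gamma> \<rho>"
  shows "\<exists>S. opposite_sectors z r {a, b, c} u S"
proof -
  \<comment> \<open>In counterclockwise order the rays \<open>a\<close>, \<open>b\<close>,
    \<open>c\<close> have angles 0, \<beta>, \<gamma>; each index gets the sector between the other
    two rays.\<close>
  define S where "S i = (if i = a then sector z (u a) \<beta> \<gamma> r else if i = b then sector z (u a) \<gamma> (\<lambda>_. 2 * pi) r
    else sector z (u a) (\<lambda>_. 0) \<beta> r)" for i
  have S: "S a = sector z (u a) \<beta> \<gamma> r" "S b = sector z (u a) \<gamma> (\<lambda>_. 2 * pi) r" "S c = sector z (u a) (\<lambda>_. 0) \<beta> r"
    using abc by (auto simp: S_def)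
  note k = continuous_on_const[of "{0<..<r}"]
  have bd: "0 < \<beta> \<rho> \<and> \<beta> \<rho> < \<gamma> \<rho> \<and> \<gamma> \<rho> < 2 * pi" if "0 < \<rho>" "\<rho> < r" for \<rho>
    using \<beta>(2) \<gamma>(2) lt that by blast
  have op: "open (S i)" if "i \<in> {a, b, c}" for i
  proof -
    have "open (S a)" "open (S b)" "open (S c)"
      unfolding S by (intro open_sector u \<beta>(1) \<gamma>(1) k; use bd in force)+
    then show ?thesis using that by auto
  qed
  have "S a \<inter> S b = {}" "S c \<inter> S a = {}" "S c \<inter> S b = {}"
    unfolding S by (rule sector_disjoint[OF u]; use bd in force)+
  then have dis: "S i \<inter> S j = {}" if "i \<in> {a, b, c}" "j \<in> {a, b, c}" "i \<noteq> j" for i j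
    using that by blast
  have rb: "S i \<inter> ball z r' = (if i = a then sector z (u a) \<beta> \<gamma> r' else if i = b then sector z (u a) \<gamma> (\<lambda>_. 2 * pi) r'
    else sector z (u a) (\<lambda>_. 0) \<beta> r')" if "r' \<le> r" for i r'
    by (simp add: S_def sector_ball[OF u that])
  have conn: "connected (S i \<inter> ball z r')" if "r' \<le> r" "i \<in> {a, b, c}" for i r'
  proof -
    have "continuous_on {0<..<r'} \<beta>" "continuous_on {0<..<r'} \<gamma>" "directions r' (u a)"
      using \<beta>(1) \<gamma>(1) directions_mono[OF u] that(1) by (auto elim: continuous_on_subset)
    moreover have "0 < \<beta> \<rho> \<and> \<beta> \<rho> < \<gamma> \<rho> \<and> \<gamma> \<rho> < 2 * pi" if "0 < \<rho>" "\<rho> < r'" for \<rho>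
      using bd that \<open>r' \<le> r\<close> by simp
    ultimately show ?thesis
      unfolding rb[OF that(1)] by (auto intro!: connected_sector)
  qed
  have clo: "ray z (u i) r' \<subseteq> closure (S j \<inter> ball z r')"
    if r': "r' \<le> r" and ij: "i \<in> {a, b, c}" "j \<in> {a, b, c}" "i \<noteq> j" for i j r'
  proof -
    have bd': "0 < \<beta> \<rho> \<and> \<beta> \<rho> < \<gamma> \<rho> \<and> \<gamma> \<rho> < 2 * pi \<and> u b \<rho> = u a \<rho> * cis (\<beta> \<rho>) \<and> u c \<rho> = u a \<rho> * cis (\<gamma> \<rho>)"
      if "0 < \<rho>" "\<rho> < r'" for \<rho>
      using bd[of \<rho>] \<beta>(2)[of \<rho>] \<gamma>(2)[of \<rho>] that r' by simp
    have "ray z (u a) r' \<subseteq> closure (sector z (u a) (\<lambda>_. 0) \<beta> r')"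
      by (rule ray_subset_closure_sector[where \<theta> = "\<lambda>_. 0"]) (use bd' in force)
    moreover have "ray z (u a) r' \<subseteq> closure (sector z (u a) \<gamma> (\<lambda>_. 2 * pi) r')"
      by (rule ray_subset_closure_sector[where \<theta> = "\<lambda>_. 2 * pi"]) (use bd' in force)
    moreover have "ray z (u b) r' \<subseteq> closure (sector z (u a) (\<lambda>_. 0) \<beta> r')"
      by (rule ray_subset_closure_sector[where \<theta> = \<beta>]) (use bd' in force)
    moreover have "ray z (u b) r' \<subseteq> closure (sector z (u a) \<beta> \<gamma> r')"
      by (rule ray_subset_closure_sector[where \<theta> = \<beta>]) (use bd' in force)
    moreover have "ray z (u c) r' \<subseteq> closure (sector z (u a) \<beta> \<gamma> r')"
      by (rule ray_subset_closure_sector[where \<theta> = \<gamma>]) (use bd' in force)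
    moreover have "ray z (u c) r' \<subseteq> closure (sector z (u a) \<gamma> (\<lambda>_. 2 * pi) r')"
      by (rule ray_subset_closure_sector[where \<theta> = \<gamma>]) (use bd' in force)
    ultimately show ?thesis
      unfolding rb[OF r'] using ij abc by auto
  qed
  \<comment> \<open>\<open>W i\<close> joins the two sectors next to the ray \<open>i\<close> across
    that ray. It is open and disjoint from \<open>S i\<close>, which keeps the closure of
    \<open>S i\<close> off the ray. At \<open>a\<close> the angle \<gamma> is lowered by a full turn
    in order to cross the angle 0.\<close>
  define W where "W i = (if i = a then sector z (u a) (\<lambda>\<rho>. \<gamma> \<rho> - 2 * pi) \<beta> r
    else if i = b then sector z (u a) (\<lambda>_. 0) \<gamma> r else sector z (u a) \<beta> (\<lambda>_. 2 * pi) r)" for i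
  have W: "W a = sector z (u a) (\<lambda>\<rho>. \<gamma> \<rho> - 2 * pi) \<beta> r" "W b = sector z (u a) (\<lambda>_. 0) \<gamma> r"
    "W c = sector z (u a) \<beta> (\<lambda>_. 2 * pi) r"
    using abc by (auto simp: W_def)
  have "open (W a)" "open (W b)" "open (W c)"
    unfolding W by (intro open_sector u \<beta>(1) \<gamma>(1) k continuous_intros; use bd in force)+
  moreover have "W a \<inter> S a = {}" "W b \<inter> S b = {}"
    unfolding W S by (rule sector_disjoint[OF u]; use bd in force)+
  moreover have "S c \<inter> W c = {}"
    unfolding W S by (rule sector_disjoint[OF u]; use bd in force)+
  moreover have "ray z (u a) r \<subseteq> W a"
    unfolding W by (rule ray_subset_sector[OF u, where \<theta> = "\<lambda>_. 0"]) (use bd in force)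
  moreover have "ray z (u b) r \<subseteq> W b"
    unfolding W by (rule ray_subset_sector[OF u, where \<theta> = \<beta>]) (use bd \<beta>(2) in force)
  moreover have "ray z (u c) r \<subseteq> W c"
    unfolding W by (rule ray_subset_sector[OF u, where \<theta> = \<gamma>]) (use bd \<gamma>(2) in force)
  ultimately have "\<forall>i\<in>{a, b, c}. open (W i) \<and> W i \<inter> S i = {} \<and> ray z (u i) r \<subseteq> W i"
    by blast
  then have sep: "ray z (u i) r \<inter> closure (S i) = {}" if "i \<in> {a, b, c}" for i
    using that open_Int_closure_eq_empty[of "W i" "S i"] by blast
  have ray_r: "ray z (u i) r' = ray z (u i) r \<inter> ball z r'" if "i \<in> {a, b, c}" "r' \<le> r" for i r'
  proof -
    have d: "directions r (u i)"
      using that assms(1-3) by blast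
    have "dist z (z + \<rho> *\<^sub>R u i \<rho>) = \<rho>" if "0 < \<rho>" "\<rho> < r" for \<rho>
      using directionsD(2)[OF d that] that by (simp add: dist_norm)
    then show ?thesis
      using that(2) unfolding ray_def by fastforce
  qed
  have cov: "ball z r - {z} - (\<Union>i\<in>{a, b, c}. ray z (u i) r) = (\<Union>i\<in>{a, b, c}. S i)"
  proof -
    have 1: "sector z (u a) (\<lambda>_. 0) (\<lambda>_. 2 * pi) r = S c \<union> ray z (u b) r \<union> sector z (u a) \<beta> (\<lambda>_. 2 * pi) r"
      unfolding S by (rule sector_split[OF u]) (use bd \<beta>(2) in force)
    have 2: "sector z (u a) \<beta> (\<lambda>_. 2 * pi) r = S a \<union> ray z (u c) r \<union> S b"
      unfolding S by (rule sector_split[OF u]) (use bd \<gamma>(2) in force)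
    have "sector z (u a) (\<lambda>_. 0) (\<lambda>_. 2 * pi) r \<subseteq> ball z r - {z}"
    proof
      fix x assume "x \<in> sector z (u a) (\<lambda>_. 0) (\<lambda>_. 2 * pi) r"
      then show "x \<in> ball z r - {z}"
        by (rule sector_norm[OF u]) (auto simp: dist_norm norm_minus_commute)
    qed
    moreover have "ray z (u i) r \<inter> S j = {}" if "i \<in> {a, b, c}" "j \<in> {a, b, c}" for i j
    proof (rule ccontr)
      assume ne: "\<not> ?thesis"
      show False
      proof (cases "i = j")
        case True
        then show False using sep[OF that(1)] ne closure_subset by blast
      next
        case False
        \<comment> \<open>The third sector \<open>S l\<close> accumulates at the whole ray
          \<open>i\<close>, while the open set \<open>S j\<close> is disjoint from
          \<open>S l\<close> and so cannot meet its closure.\<close>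
        obtain x where x: "x \<in> ray z (u i) r" "x \<in> S j" using ne by auto
        obtain l where l: "l \<in> {a, b, c}" "l \<noteq> i" "l \<noteq> j"
          using that False abc by auto
        have "x \<in> ball z r"
          using ray_r[OF that(1) order.refl] x by auto
        then have "x \<in> closure (S l \<inter> ball z r)"
          using clo[OF order.refl that(1) l(1)] l x by blast
        then show False
          using open_Int_closure_eq_empty[OF op[OF that(2)], of "S l \<inter> ball z r"] dis[OF that(2) l(1)] l x by blast
      qed
    qed
    ultimately have sub: "sector z (u a) (\<lambda>_. 0) (\<lambda>_. 2 * pi) r \<subseteq> ball z r - {z}"
      and rd: "\<And>i j. i \<in> {a, b, c} \<Longrightarrow> j \<in> {a, b, c} \<Longrightarrow> ray z (u i) r \<inter> S j = {}"
      by blast+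
    have i1: "(\<Union>i\<in>{a, b, c}. S i) \<subseteq> ball z r - {z}"
      using sub unfolding 1 2 by simp
    have i2: "(\<Union>i\<in>{a, b, c}. S i) \<inter> (\<Union>i\<in>{a, b, c}. ray z (u i) r) = {}"
      using rd by fast
    have i3: "ball z r - {z} \<subseteq> (\<Union>i\<in>{a, b, c}. ray z (u i) r) \<union> (\<Union>i\<in>{a, b, c}. S i)"
    proof
      fix x assume "x \<in> ball z r - {z}"
      from sector_cover[OF u this]
      show "x \<in> (\<Union>i\<in>{a, b, c}. ray z (u i) r) \<union> (\<Union>i\<in>{a, b, c}. S i)"
        unfolding 1 2 by auto
    qed
    have "B - R = A" if "A \<subseteq> B" "A \<inter> R = {}" "B \<subseteq> R \<union> A" for A B R :: "complex set"
      using that by blast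
    from this[OF i1 i2 i3] show ?thesis .
  qed
  have cov': "ball z r' - {z} - (\<Union>i\<in>{a, b, c}. ray z (u i) r') = (\<Union>i\<in>{a, b, c}. S i) \<inter> ball z r'"
    if "r' \<le> r" for r'
  proof -
    have "ball z r' \<subseteq> ball z r" using that by auto
    moreover have "(\<Union>i\<in>{a, b, c}. ray z (u i) r') = (\<Union>i\<in>{a, b, c}. ray z (u i) r) \<inter> ball z r'"
      using ray_r[OF _ that] by blast
    ultimately show ?thesis
      unfolding cov[symmetric] by blast
  qed
  have "opposite_sectors z r {a, b, c} u S"
    unfolding opposite_sectors_def
  proof (intro conjI ballI allI impI)
    fix i r' assume ir: "i \<in> {a, b, c}" "r' \<le> r"
    show "connected (S i \<inter> ball z r')"
      by (rule conn[OF ir(2,1)])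
    show "ray z (u i) r' \<inter> closure (S i) = {}"
      using sep[OF ir(1)] ray_r[OF ir] by blast
    fix j assume j: "j \<in> {a, b, c}" "i \<noteq> j"
    show "ray z (u i) r' \<subseteq> closure (S j \<inter> ball z r')"
      by (rule clo[OF ir(2) ir(1) j])
  next
    fix i j assume "i \<in> {a, b, c}" "j \<in> {a, b, c}" "i \<noteq> j"
    then show "S i \<inter> S j = {}"
      by (rule dis)
  next
    fix r' assume "r' \<le> r"
    then show "ball z r' - {z} - (\<Union>i\<in>{a, b, c}. ray z (u i) r') = (\<Union>i\<in>{a, b, c}. S i) \<inter> ball z r'"
      by (rule cov')
  qed (rule op)
  then show ?thesis by blast
qed

text \<open>The angles of the second and third ray against the first are continuous and never equal,
  so by connectedness of the interval of radii their order is the same at all radii.\<close>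

lemma opposite_sectors_exist:
  fixes u :: "'i \<Rightarrow> real \<Rightarrow> complex"
  assumes u: "\<And>i. i \<in> {a, b, c} \<Longrightarrow> directions r (u i)" and abc: "a \<noteq> b" "b \<noteq> c" "a \<noteq> c"
    and ne: "\<And>i j \<rho>. i \<in> {a, b, c} \<Longrightarrow> j \<in> {a, b, c} \<Longrightarrow> i \<noteq> j \<Longrightarrow> 0 < \<rho> \<Longrightarrow> \<rho> < r \<Longrightarrow> u i \<rho> \<noteq> u j \<rho>"
  shows "\<exists>S. opposite_sectors z r {a, b, c} u S"
proof -
  define \<psi> where "\<psi> i \<rho> = Arg2pi (u i \<rho> / u a \<rho>)" for i \<rho>
  have \<psi>: "continuous_on {0<..<r} (\<psi> i)"
    "\<And>\<rho>. 0 < \<rho> \<Longrightarrow> \<rho> < r \<Longrightarrow> 0 < \<psi> i \<rho> \<and> \<psi> i \<rho> < 2 * pi \<and> u i \<rho> = u a \<rho> * cis (\<psi> i \<rho>)"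
    if "i \<in> {b, c}" for i
    using direction_angle[of r "u a" "u i"] u ne[of a i] that abc unfolding \<psi>_def by auto
  have ne': "\<psi> b \<rho> \<noteq> \<psi> c \<rho>" if "0 < \<rho>" "\<rho> < r" for \<rho>
    using \<psi>(2)[of b \<rho>] \<psi>(2)[of c \<rho>] ne[of b c \<rho>] abc that by auto
  have "(\<forall>\<rho>\<in>{0<..<r}. \<psi> b \<rho> < \<psi> c \<rho>) \<or> (\<forall>\<rho>\<in>{0<..<r}. \<psi> c \<rho> < \<psi> b \<rho>)"
  proof (rule ccontr)
    assume "\<not> ?thesis"
    then obtain x y where xy: "x \<in> {0<..<r}" "y \<in> {0<..<r}" "\<psi> b x - \<psi> c x \<le> 0" "0 \<le> \<psi> b y - \<psi> c y"
      by force
    have "connected ((\<lambda>\<rho>. \<psi> b \<rho> - \<psi> c \<rho>) ` {0<..<r})"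
      by (intro connected_continuous_image continuous_intros \<psi>(1)) auto
    then have "0 \<in> (\<lambda>\<rho>. \<psi> b \<rho> - \<psi> c \<rho>) ` {0<..<r}"
      using xy by (meson connected_iff_interval image_eqI)
    then show False
      using ne' by auto
  qed
  then show ?thesis
  proof
    assume "\<forall>\<rho>\<in>{0<..<r}. \<psi> b \<rho> < \<psi> c \<rho>"
    then show ?thesis
      using u abc \<psi> by (intro opposite_sectors_ordered[where \<beta> = "\<psi> b" and \<gamma> = "\<psi> c"]) auto
  next
    assume "\<forall>\<rho>\<in>{0<..<r}. \<psi> c \<rho> < \<psi> b \<rho>"
    then have "\<exists>S. opposite_sectors z r {a, c, b} u S"
      using u abc \<psi> by (intro opposite_sectors_ordered[where \<beta> = "\<psi> c" and \<gamma> = "\<psi> b"]) auto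
    then show ?thesis
      by (simp add: insert_commute)
  qed
qed


subsection \<open>The two sides of a smooth arc\<close>

lemma center_in_closure_ray:
  assumes "0 < r" "directions r u"
  shows "z \<in> closure (ray z u r)"
  unfolding closure_approachable
proof (intro allI impI)
  fix e :: real assume "0 < e"
  define \<rho> where "\<rho> = min (r / 2) (e / 2)"
  have \<rho>: "0 < \<rho>" "\<rho> < r" "\<rho> < e"
    using assms \<open>0 < e\<close> by (auto simp: \<rho>_def)
  have "dist (z + \<rho> *\<^sub>R u \<rho>) z < e"
    using directionsD(2)[OF assms(2) \<rho>(1,2)] \<rho> by (simp add: dist_norm)
  then show "\<exists>y\<in>ray z u r. dist y z < e"
    using \<rho> by (blast intro: mem_rayI)
qed

text \<open>Seen from \<open>u\<close>, the opposite ray has angle tending to pi, whereas the moving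
  point has angle tending to that of \<open>f / d\<close>. The sign of \<open>Im (cnj d * f)\<close>
  decides on which side of pi this limit lies, and a value \<open>c\<close> strictly in between
  eventually separates the two angles.\<close>

lemma eventually_in_two_ray_sectors:
  assumes u: "directions r u" and v: "directions r v" and r: "0 < r"
    and ud: "(u \<longlongrightarrow> d) (at_right 0)" and vd: "(v \<longlongrightarrow> - d) (at_right 0)" and d: "norm d = 1"
    and h: "(h \<longlongrightarrow> z) F" "\<forall>\<^sub>F a in F. h a \<noteq> z" "((\<lambda>a. sgn (h a - z)) \<longlongrightarrow> f) F"
  shows "Im (cnj d * f) > 0 \<Longrightarrow> \<forall>\<^sub>F a in F. h a \<in> sector z u (\<lambda>_. 0) (\<lambda>\<rho>. Arg2pi (v \<rho> / u \<rho>)) r"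
    and "Im (cnj d * f) < 0 \<Longrightarrow> \<forall>\<^sub>F a in F. h a \<in> sector z u (\<lambda>\<rho>. Arg2pi (v \<rho> / u \<rho>)) (\<lambda>_. 2 * pi) r"
proof -
  define \<psi> where "\<psi> \<rho> = Arg2pi (v \<rho> / u \<rho>)" for \<rho>
  define \<rho> where "\<rho> a = norm (h a - z)" for a
  define w where "w a = sgn (h a - z) / u (\<rho> a)" for a
  have d0: "d \<noteq> 0" using d by auto
  have "(\<rho> \<longlongrightarrow> 0) F"
    using h(1) unfolding \<rho>_def by (simp add: tendsto_norm_zero_iff LIM_zero_iff)
  moreover have \<rho>_pos: "\<forall>\<^sub>F a in F. 0 < \<rho> a"
    using h(2) by eventually_elim (simp add: \<rho>_def)
  ultimately have \<rho>_lim: "filterlim \<rho> (at_right 0) F"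
    by (auto simp: filterlim_at elim: eventually_mono)
  have \<rho>_less: "\<forall>\<^sub>F a in F. \<rho> a < r"
    using order_tendstoD(2)[OF \<open>(\<rho> \<longlongrightarrow> 0) F\<close> r] .
  have u_lim: "((\<lambda>a. u (\<rho> a)) \<longlongrightarrow> d) F" and v_lim: "((\<lambda>a. v (\<rho> a)) \<longlongrightarrow> - d) F"
    using filterlim_compose[OF ud \<rho>_lim] filterlim_compose[OF vd \<rho>_lim] by auto
  have "((\<lambda>a. v (\<rho> a) / u (\<rho> a)) \<longlongrightarrow> - d / d) F"
    by (intro tendsto_divide u_lim v_lim d0)
  then have "((\<lambda>a. v (\<rho> a) / u (\<rho> a)) \<longlongrightarrow> - 1) F"
    using d0 by simp
  moreover have "isCont Arg2pi (- 1)"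
    by (intro continuous_at_Arg2pi) (simp add: complex_nonneg_Reals_iff)
  ultimately have \<psi>_lim: "((\<lambda>a. \<psi> (\<rho> a)) \<longlongrightarrow> pi) F"
    unfolding \<psi>_def using isCont_tendsto_compose Arg2pi_of_real[of "-1"] by fastforce
  have w_lim: "(w \<longlongrightarrow> f / d) F"
    unfolding w_def by (intro tendsto_divide u_lim h(3) d0)
  have Im_fd: "Im (f / d) = Im (cnj d * f)"
    using d complex_div_cnj[of f d] by (simp add: mult.commute)
  have w_Arg: "((\<lambda>a. Arg2pi (w a)) \<longlongrightarrow> Arg2pi (f / d)) F" if "Im (cnj d * f) \<noteq> 0"
    using that by (intro isCont_tendsto_compose[OF _ w_lim] continuous_at_Arg2pi)
      (auto simp: complex_nonneg_Reals_iff Im_fd)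
  have polar: "h a - z = \<rho> a *\<^sub>R (u (\<rho> a) * cis (Arg2pi (w a)))" if a: "0 < \<rho> a" "\<rho> a < r" for a
  proof -
    have u1: "norm (u (\<rho> a)) = 1"
      by (rule directionsD(2)[OF u a])
    have "norm (w a) = 1"
      using u1 a(1) by (simp add: w_def norm_divide norm_sgn) (simp add: \<rho>_def)
    then have w: "w a = cis (Arg2pi (w a))"
      using Arg2pi_eq[of "w a"] by (simp add: cis_conv_exp)
    have "u (\<rho> a) \<noteq> 0"
      using u1 by auto
    then have "h a - z = \<rho> a *\<^sub>R (u (\<rho> a) * w a)"
      using a(1) by (simp add: w_def sgn_div_norm \<rho>_def scaleR_conv_of_real divide_simps)
    then show ?thesis
      using w by simp
  qed
  show "\<forall>\<^sub>F a in F. h a \<in> sector z u (\<lambda>_. 0) (\<lambda>\<rho>. Arg2pi (v \<rho> / u \<rho>)) r" if Im: "Im (cnj d * f) > 0"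
  proof -
    have "0 < Arg2pi (f / d)" "Arg2pi (f / d) < pi"
      using Arg2pi_lt_pi[of "f / d"] Im Im_fd by auto
    then obtain c where c: "Arg2pi (f / d) < c" "c < pi"
      using dense by blast
    have lim: "((\<lambda>a. Arg2pi (w a)) \<longlongrightarrow> Arg2pi (f / d)) F"
      using w_Arg Im by simp
    show ?thesis
      using \<rho>_pos \<rho>_less order_tendstoD(1)[OF lim \<open>0 < Arg2pi (f / d)\<close>] order_tendstoD(2)[OF lim c(1)]
        order_tendstoD(1)[OF \<psi>_lim c(2)]
    proof eventually_elim
      case (elim a)
      show ?case
        by (rule sectorI[where \<theta> = "Arg2pi (w a)"]; (fold \<rho>_def \<psi>_def)?)
           (rule elim order.strict_trans[OF elim(4,5)] polar[OF elim(1,2)])+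
    qed
  qed
  show "\<forall>\<^sub>F a in F. h a \<in> sector z u (\<lambda>\<rho>. Arg2pi (v \<rho> / u \<rho>)) (\<lambda>_. 2 * pi) r" if Im: "Im (cnj d * f) < 0"
  proof -
    have "pi < Arg2pi (f / d)"
      using Arg2pi_le_pi[of "f / d"] Im Im_fd by auto
    then obtain c where c: "pi < c" "c < Arg2pi (f / d)"
      using dense by blast
    have lim: "((\<lambda>a. Arg2pi (w a)) \<longlongrightarrow> Arg2pi (f / d)) F"
      using w_Arg Im by simp
    show ?thesis
      using \<rho>_pos \<rho>_less order_tendstoD(1)[OF lim c(2)] order_tendstoD(2)[OF \<psi>_lim c(1)]
    proof eventually_elim
      case (elim a)
      show ?case
        by (rule sectorI[where \<theta> = "Arg2pi (w a)"]; (fold \<rho>_def \<psi>_def)?)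
           (rule elim order.strict_trans[OF elim(4,3)] polar[OF elim(1,2)] Arg2pi_lt_2pi)+
    qed
  qed
qed

section \<open>Germs of a smooth arc and curves crossing it\<close>

lemma smooth_arcD:
  assumes "smooth_arc p"
  shows "arc p"
    "t \<in> {0..1} \<Longrightarrow> (p has_vector_derivative velocity p t) (at t within {0..1})"
    "continuous_on {0..1} (velocity p)"
    "t \<in> {0..1} \<Longrightarrow> velocity p t \<noteq> 0"
proof -
  show "arc p"
    using assms by (simp add: smooth_arc_def)
  obtain D where D: "D 0 = p" "\<And>n t. t \<in> {0..1} \<Longrightarrow> (D n has_vector_derivative D (Suc n) t) (at t within {0..1})"
    "\<And>t. t \<in> {0..1} \<Longrightarrow> D (Suc 0) t \<noteq> 0"
    using assms unfolding smooth_arc_def by blast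
  have v: "velocity p t = D (Suc 0) t" if "t \<in> {0..1}" for t
    using D(2)[OF that, of 0] that by (intro vector_derivative_within_closed_interval) (auto simp: D(1))
  show "t \<in> {0..1} \<Longrightarrow> (p has_vector_derivative velocity p t) (at t within {0..1})" for t
    using D(2)[of t 0] by (simp add: D(1) v)
  show "t \<in> {0..1} \<Longrightarrow> velocity p t \<noteq> 0" for t
    using D(3) v by simp
  have "continuous_on {0..1} (D (Suc 0))"
    using D(2) by (metis continuous_on_eq_continuous_within has_vector_derivative_continuous)
  then show "continuous_on {0..1} (velocity p)"
    by (subst continuous_on_cong[OF refl v]) auto
qed

lemma smooth_arc_germ_forward:
  assumes p: "smooth_arc p" and t0: "0 \<le> t0" "t0 < 1"
  obtains r u where "0 < r" "directions r u" "(u \<longlongrightarrow> sgn (velocity p t0)) (at_right 0)"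
    "\<forall>r'\<le>r. p ` {t0<..1} \<inter> ball (p t0) r' = ray (p t0) u r'"
proof -
  define f where "f t = p (t0 + t)" for t
  have inj: "inj_on p {0..1}"
    using smooth_arcD(1)[OF p] by (simp add: arc_def)
  have im: "(+) t0 ` {0..1 - t0} = {t0..1}" "(+) t0 ` {0<..1 - t0} = {t0<..1}"
    by (simp_all add: image_add_atLeastAtMost image_add_greaterThanAtMost)
  have der: "(f has_vector_derivative velocity p (t0 + t)) (at t within {0..1 - t0})" if "t \<in> {0..1 - t0}" for t
  proof -
    have "(p has_vector_derivative velocity p (t0 + t)) (at (t0 + t) within (+) t0 ` {0..1 - t0})"
      using that t0 unfolding im
      by (intro has_vector_derivative_within_subset[OF smooth_arcD(2)[OF p]]) auto
    moreover have "((+) t0 has_vector_derivative 1) (at t within {0..1 - t0})"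
      by (auto intro!: derivative_eq_intros)
    ultimately show ?thesis
      using vector_diff_chain_within[of "(+) t0" 1 t "{0..1 - t0}" p] by (simp add: f_def[abs_def] o_def)
  qed
  obtain r u where ru: "0 < r" "continuous_on {0<..<r} u" "\<And>\<rho>. \<rho> \<in> {0<..<r} \<Longrightarrow> norm (u \<rho>) = 1"
    "(u \<longlongrightarrow> sgn (velocity p (t0 + 0))) (at_right 0)"
    "\<And>r'. r' \<le> r \<Longrightarrow> f ` {0<..1 - t0} \<inter> ball (f 0) r' = ray (f 0) u r'"
  proof (rule radial_parametrization[of "1 - t0" f "\<lambda>t. velocity p (t0 + t)"])
    show "continuous_on {0..1 - t0} (\<lambda>t. velocity p (t0 + t))"
      using t0 by (intro continuous_on_compose2[OF smooth_arcD(3)[OF p]] continuous_intros) auto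
    show "inj_on f {0..1 - t0}"
      by (rule inj_onI) (use inj_onD[OF inj, of "t0 + _" "t0 + _"] t0 in \<open>auto simp: f_def\<close>)
  qed (use t0 der smooth_arcD(4)[OF p] in auto)
  have "f ` {0<..1 - t0} = p ` {t0<..1}"
    unfolding im(2)[symmetric] image_image f_def ..
  then show ?thesis
    using ru by (intro that[of r u]) (auto simp: directions_def f_def)
qed

lemma smooth_arc_germ_backward:
  assumes p: "smooth_arc p" and t0: "0 < t0" "t0 \<le> 1"
  obtains r u where "0 < r" "directions r u" "(u \<longlongrightarrow> - sgn (velocity p t0)) (at_right 0)"
    "\<forall>r'\<le>r. p ` {0..<t0} \<inter> ball (p t0) r' = ray (p t0) u r'"
proof -
  define f where "f t = p (t0 - t)" for t
  have inj: "inj_on p {0..1}"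
    using smooth_arcD(1)[OF p] by (simp add: arc_def)
  have im: "(-) t0 ` {0..t0} = {0..t0}" "(-) t0 ` {0<..t0} = {0..<t0}"
    using image_diff_atLeastAtMost[of t0 0 t0] by (auto simp: image_iff intro!: bexI[of _ "t0 - _"])
  have der: "(f has_vector_derivative - velocity p (t0 - t)) (at t within {0..t0})" if "t \<in> {0..t0}" for t
  proof -
    have "(p has_vector_derivative velocity p (t0 - t)) (at (t0 - t) within (-) t0 ` {0..t0})"
      using that t0 unfolding im
      by (intro has_vector_derivative_within_subset[OF smooth_arcD(2)[OF p]]) auto
    moreover have "((-) t0 has_vector_derivative - 1) (at t within {0..t0})"
      by (auto intro!: derivative_eq_intros)
    ultimately show ?thesis
      using vector_diff_chain_within[of "(-) t0" "- 1" t "{0..t0}" p] by (simp add: f_def[abs_def] o_def)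
  qed
  obtain r u where ru: "0 < r" "continuous_on {0<..<r} u" "\<And>\<rho>. \<rho> \<in> {0<..<r} \<Longrightarrow> norm (u \<rho>) = 1"
    "(u \<longlongrightarrow> sgn (- velocity p (t0 - 0))) (at_right 0)"
    "\<And>r'. r' \<le> r \<Longrightarrow> f ` {0<..t0} \<inter> ball (f 0) r' = ray (f 0) u r'"
  proof (rule radial_parametrization[of t0 f "\<lambda>t. - velocity p (t0 - t)"])
    show "continuous_on {0..t0} (\<lambda>t. - velocity p (t0 - t))"
      using t0 by (intro continuous_on_compose2[OF smooth_arcD(3)[OF p]] continuous_intros) auto
    show "inj_on f {0..t0}"
      by (rule inj_onI) (use inj_onD[OF inj, of "t0 - _" "t0 - _"] t0 in \<open>auto simp: f_def\<close>)
  qed (use t0 der smooth_arcD(4)[OF p] in auto)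
  have "f ` {0<..t0} = p ` {0..<t0}"
    unfolding im(2)[symmetric] image_image f_def ..
  then show ?thesis
    using ru by (intro that[of r u]) (auto simp: directions_def f_def sgn_minus)
qed

text \<open>The difference quotients converge to \<open>q'\<close>. The factor \<open>x - s\<close>
  is negative on the left, so seen from \<open>q s\<close> the earlier points lie in the direction
  opposite to the velocity.\<close>

lemma transverse_direction:
  fixes q :: "real \<Rightarrow> complex"
  assumes q: "(q has_vector_derivative q') (at s within {0..1})" and "s \<in> {0..1}" and q0: "q' \<noteq> 0"
  shows "(q \<longlongrightarrow> q s) (at s within {s<..1})" "\<forall>\<^sub>F x in at s within {s<..1}. q x \<noteq> q s"
    "((\<lambda>x. sgn (q x - q s)) \<longlongrightarrow> sgn q') (at s within {s<..1})"
    and "(q \<longlongrightarrow> q s) (at s within {0..<s})" "\<forall>\<^sub>F x in at s within {0..<s}. q x \<noteq> q s"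
    "((\<lambda>x. sgn (q x - q s)) \<longlongrightarrow> - sgn q') (at s within {0..<s})"
proof -
  note quot = has_vector_derivative_quotient[OF q]
  have sub: "at s within {s<..1} \<le> at s within {0..1}" "at s within {0..<s} \<le> at s within {0..1}"
    using assms(2) by (auto intro!: at_le)
  have "(q \<longlongrightarrow> q s) (at s within {0..1})"
    using has_vector_derivative_continuous[OF q] by (simp add: continuous_within)
  then show "(q \<longlongrightarrow> q s) (at s within {s<..1})" "(q \<longlongrightarrow> q s) (at s within {0..<s})"
    using sub tendsto_mono by blast+
  have "\<forall>\<^sub>F x in at s within {0..1}. (q x - q s) /\<^sub>R (x - s) \<noteq> 0"
    using tendsto_imp_eventually_ne[OF quot q0] .
  then have "\<forall>\<^sub>F x in at s within {0..1}. q x \<noteq> q s"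
    by eventually_elim auto
  then show "\<forall>\<^sub>F x in at s within {s<..1}. q x \<noteq> q s" "\<forall>\<^sub>F x in at s within {0..<s}. q x \<noteq> q s"
    using sub filter_leD by blast+
  have sg: "((\<lambda>x. sgn ((q x - q s) /\<^sub>R (x - s))) \<longlongrightarrow> sgn q') (at s within {0..1})"
    by (rule tendsto_sgn[OF quot q0])
  show "((\<lambda>x. sgn (q x - q s)) \<longlongrightarrow> sgn q') (at s within {s<..1})"
  proof (rule Lim_transform_eventually[OF tendsto_mono[OF sub(1) sg]])
    show "\<forall>\<^sub>F x in at s within {s<..1}. sgn ((q x - q s) /\<^sub>R (x - s)) = sgn (q x - q s)"
      unfolding eventually_at_filter by (intro always_eventually) (auto simp: sgn_scaleR)
  qed
  show "((\<lambda>x. sgn (q x - q s)) \<longlongrightarrow> - sgn q') (at s within {0..<s})"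
  proof (rule Lim_transform_eventually[OF tendsto_minus[OF tendsto_mono[OF sub(2) sg]]])
    show "\<forall>\<^sub>F x in at s within {0..<s}. - sgn ((q x - q s) /\<^sub>R (x - s)) = sgn (q x - q s)"
      unfolding eventually_at_filter by (intro always_eventually) (auto simp: sgn_scaleR)
  qed
qed

lemma Im_cnj_sgn_iff:
  assumes "v \<noteq> 0" "w \<noteq> 0"
  shows "0 < Im (cnj (sgn v) * sgn w) \<longleftrightarrow> 0 < Im (cnj v * w)"
    "Im (cnj (sgn v) * sgn w) < 0 \<longleftrightarrow> Im (cnj v * w) < 0"
proof -
  have "cnj (sgn v) * sgn w = (inverse (norm v) * inverse (norm w)) *\<^sub>R (cnj v * w)"
    by (simp add: sgn_div_norm)
  then have "Im (cnj (sgn v) * sgn w) = (inverse (norm v) * inverse (norm w)) * Im (cnj v * w)"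
    by (metis scaleR_complex.sel(2))
  moreover have "inverse (norm v) * inverse (norm w) > 0"
    using assms by simp
  ultimately show "0 < Im (cnj (sgn v) * sgn w) \<longleftrightarrow> 0 < Im (cnj v * w)"
    "Im (cnj (sgn v) * sgn w) < 0 \<longleftrightarrow> Im (cnj v * w) < 0"
    by (auto simp: zero_less_mult_iff mult_less_0_iff)
qed

text \<open>The two germs of the arc at an interior point leave in opposite directions and cut a
  small disc into two sectors. A curve whose velocity is not parallel to the tangent has its earlier
  and later points in opposite directions off the tangent line, hence in different sectors. Which
  sector comes first is left open.\<close>

lemma smooth_arc_sides:
  assumes p: "smooth_arc p" and t0: "0 < t0" "t0 < 1" and \<epsilon>: "0 < \<epsilon>"
  obtains r S1 S2 where "0 < r" "r \<le> \<epsilon>" "open S1" "open S2" "connected S1" "connected S2" "S1 \<inter> S2 = {}"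
    "ball (p t0) r - path_image p = S1 \<union> S2"
    "path_image p \<inter> ball (p t0) r \<subseteq> closure S1 \<inter> closure S2"
    "\<And>q q' s. s \<in> {0..1} \<Longrightarrow> (q has_vector_derivative q') (at s within {0..1}) \<Longrightarrow> q s = p t0 \<Longrightarrow>
        Im (cnj (velocity p t0) * q') \<noteq> 0 \<Longrightarrow>
      \<exists>A B. (A = S1 \<and> B = S2 \<or> A = S2 \<and> B = S1) \<and>
        (\<forall>\<^sub>F x in at s within {0..<s}. q x \<in> A) \<and> (\<forall>\<^sub>F x in at s within {s<..1}. q x \<in> B)"
proof -
  define z where "z = p t0"
  obtain r1 u where u: "0 < r1" "directions r1 u" "(u \<longlongrightarrow> sgn (velocity p t0)) (at_right 0)"
    "\<forall>r'\<le>r1. p ` {t0<..1} \<inter> ball z r' = ray z u r'"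
    using smooth_arc_germ_forward[OF p, of t0] t0 unfolding z_def by auto
  obtain r2 v where v: "0 < r2" "directions r2 v" "(v \<longlongrightarrow> - sgn (velocity p t0)) (at_right 0)"
    "\<forall>r'\<le>r2. p ` {0..<t0} \<inter> ball z r' = ray z v r'"
    using smooth_arc_germ_backward[OF p, of t0] t0 unfolding z_def by auto
  define r where "r = min \<epsilon> (min r1 r2)"
  have r: "0 < r" "r \<le> \<epsilon>" "r \<le> r1" "r \<le> r2"
    using u(1) v(1) \<epsilon> by (auto simp: r_def)
  have inj: "inj_on p {0..1}"
    using smooth_arcD(1)[OF p] by (simp add: arc_def)
  have ur: "directions r u" and vr: "directions r v"
    using u(2) v(2) r directions_mono by blast+
  have rays: "p ` {t0<..1} \<inter> ball z r = ray z u r" "p ` {0..<t0} \<inter> ball z r = ray z v r"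
    using u(4) v(4) r by auto
  have ne: "\<forall>\<rho>\<in>{0<..<r}. u \<rho> \<noteq> v \<rho>"
  proof (intro ballI notI)
    fix \<rho> assume \<rho>: "\<rho> \<in> {0<..<r}" "u \<rho> = v \<rho>"
    have "z + \<rho> *\<^sub>R u \<rho> \<in> ray z u r" "z + \<rho> *\<^sub>R u \<rho> \<in> ray z v r"
      using \<rho> by (auto intro: mem_rayI)
    then have "z + \<rho> *\<^sub>R u \<rho> \<in> p ` {t0<..1} \<inter> p ` {0..<t0}"
      using rays by blast
    moreover have "p ` {t0<..1} \<inter> p ` {0..<t0} = {}"
      using inj_on_image_Int[OF inj, of "{t0<..1}" "{0..<t0}"] t0 by force
    ultimately show False by blast
  qed
  define \<psi> where "\<psi> \<rho> = Arg2pi (v \<rho> / u \<rho>)" for \<rho>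
  define S1 where "S1 = sector z u (\<lambda>_. 0) \<psi> r"
  define S2 where "S2 = sector z u \<psi> (\<lambda>_. 2 * pi) r"
  note S = two_ray_sectors[OF ur vr ne, of z, folded \<psi>_def[abs_def], folded S1_def S2_def]
  have im: "path_image p = {z} \<union> p ` {t0<..1} \<union> p ` {0..<t0}"
  proof -
    have "{0..1} = {t0} \<union> {t0<..1} \<union> {0..<t0}"
      using t0 by auto
    then show ?thesis
      unfolding path_image_def z_def by auto
  qed
  have sub: "path_image p \<inter> ball z r = {z} \<union> ray z u r \<union> ray z v r"
    unfolding im rays[symmetric] using r(1) by auto
  show ?thesis
  proof (rule that[of r S1 S2])
    show "ball (p t0) r - path_image p = S1 \<union> S2"
      unfolding S(6)[symmetric] z_def[symmetric] using sub by blast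
    \<comment> \<open>The rays omit the point \<open>z\<close> itself, which is reached as a limit
      of one of them.\<close>
    have "z \<in> closure (closure S1)" "z \<in> closure (closure S2)"
      using center_in_closure_ray[OF r(1) ur, of z] S(7) closure_mono by blast+
    then show "path_image p \<inter> ball (p t0) r \<subseteq> closure S1 \<inter> closure S2"
      unfolding z_def[symmetric] sub using S(7) by auto
    fix q q' s
    assume s: "s \<in> {0..1}" and q: "(q has_vector_derivative q') (at s within {0..1})" "q s = p t0"
      and Im: "Im (cnj (velocity p t0) * q') \<noteq> 0"
    have q0: "q' \<noteq> 0" using Im by auto
    have p0: "velocity p t0 \<noteq> 0" using smooth_arcD(4)[OF p] t0 by simp
    have d1: "norm (sgn (velocity p t0)) = 1"
      using p0 by (simp add: norm_sgn)
    note tr = transverse_direction[OF q(1) s q0, unfolded q(2), folded z_def]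
    note F = eventually_in_two_ray_sectors[OF ur vr r(1) u(3) v(3) d1 tr(1-3), folded \<psi>_def[abs_def], folded S1_def S2_def]
    note B = eventually_in_two_ray_sectors[OF ur vr r(1) u(3) v(3) d1 tr(4-6), folded \<psi>_def[abs_def], folded S1_def S2_def]
    note sg = Im_cnj_sgn_iff[OF p0 q0]
    show "\<exists>A B. (A = S1 \<and> B = S2 \<or> A = S2 \<and> B = S1) \<and>
        (\<forall>\<^sub>F x in at s within {0..<s}. q x \<in> A) \<and> (\<forall>\<^sub>F x in at s within {s<..1}. q x \<in> B)"
    proof (cases "Im (cnj (velocity p t0) * q') > 0")
      case True
      then have "0 < Im (cnj (sgn (velocity p t0)) * sgn q')"
        using sg by simp
      then show ?thesis
        using F(1) B(2) by (intro exI[of _ S2] exI[of _ S1]) simp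
    next
      case False
      then have "Im (cnj (sgn (velocity p t0)) * sgn q') < 0"
        using sg Im by simp
      then show ?thesis
        using F(2) B(1) by (intro exI[of _ S1] exI[of _ S2]) simp
    qed
  qed (use r S in auto)
qed

text \<open>Infinitely many crossings would accumulate. Along a convergent sequence the chords of
  both arcs from the limit point coincide, so the difference quotients are parallel, and in the
  limit so are the velocities, against transversality.\<close>

lemma finite_transverse:
  assumes p: "smooth_arc p" and q: "smooth_arc q" and tr: "transverse p q"
  shows "finite {s \<in> {0..1}. q s \<in> path_image p}"
proof (rule ccontr)
  assume "infinite {s \<in> {0..1}. q s \<in> path_image p}" (is "infinite ?I")
  have "?I \<subseteq> {0..1}" by auto
  then obtain s0 where s0: "s0 \<in> {0..1}" "s0 islimpt ?I"
    using compact_eq_Bolzano_Weierstrass[of "{0..1::real}"] \<open>infinite ?I\<close> by (metis compact_Icc)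
  then obtain \<sigma> where \<sigma>: "\<And>n. \<sigma> n \<in> ?I - {s0}" "\<sigma> \<longlonglongrightarrow> s0"
    unfolding islimpt_sequential by blast
  have "\<exists>t. t \<in> {0..1} \<and> p t = q (\<sigma> n)" for n
    using \<sigma>(1)[of n] by (auto simp: path_image_def)
  then obtain \<tau> where \<tau>: "\<And>n. \<tau> n \<in> {0..1}" "\<And>n. p (\<tau> n) = q (\<sigma> n)"
    by metis
  obtain t0 k where t0: "t0 \<in> {0..1}" "strict_mono k" "(\<tau> \<circ> k) \<longlonglongrightarrow> t0"
    using compact_Icc[of "0::real" 1] \<tau>(1) unfolding compact_def by metis
  have \<sigma>k: "(\<sigma> \<circ> k) \<longlonglongrightarrow> s0"
    using \<sigma>(2) t0(2) by (rule LIMSEQ_subseq_LIMSEQ)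
  have cont: "continuous_on {0..1} p" "continuous_on {0..1} q"
    using smooth_arcD(1)[OF p] smooth_arcD(1)[OF q] by (auto simp: arc_def path_def)
  have lp: "(\<lambda>n. p (\<tau> (k n))) \<longlonglongrightarrow> p t0"
    using continuous_on_tendsto_compose[OF cont(1) t0(3)] t0(1) \<tau>(1) by (simp add: o_def)
  have lq: "(\<lambda>n. q (\<sigma> (k n))) \<longlonglongrightarrow> q s0"
    using continuous_on_tendsto_compose[OF cont(2) \<sigma>k] s0(1) \<sigma>(1) by (simp add: o_def)
  have eq: "p t0 = q s0"
    using LIMSEQ_unique[OF lp] lq \<tau>(2) by simp
  have inj: "inj_on q {0..1}"
    using smooth_arcD(1)[OF q] by (simp add: arc_def)
  \<comment> \<open>A difference quotient at \<open>t0\<close> needs parameters distinct from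
    \<open>t0\<close>; injectivity of \<open>q\<close> transfers this from \<sigma> to
    \<tau>.\<close>
  have \<tau>_ne: "\<tau> n \<noteq> t0" for n
    using \<tau>(2)[of n] eq inj_onD[OF inj, of "\<sigma> n" s0] \<sigma>(1)[of n] s0(1) by auto
  have "filterlim (\<tau> \<circ> k) (at t0 within {0..1}) sequentially"
    using t0(3) \<tau>_ne \<tau>(1) by (auto simp: filterlim_at)
  from filterlim_compose[OF has_vector_derivative_quotient[OF smooth_arcD(2)[OF p t0(1)]] this]
  have dp: "(\<lambda>n. (p (\<tau> (k n)) - p t0) /\<^sub>R (\<tau> (k n) - t0)) \<longlonglongrightarrow> velocity p t0"
    by (simp add: o_def)
  have "filterlim (\<sigma> \<circ> k) (at s0 within {0..1}) sequentially"
    using \<sigma>k \<sigma>(1) by (auto simp: filterlim_at)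
  from filterlim_compose[OF has_vector_derivative_quotient[OF smooth_arcD(2)[OF q s0(1)]] this]
  have dq: "(\<lambda>n. (q (\<sigma> (k n)) - q s0) /\<^sub>R (\<sigma> (k n) - s0)) \<longlonglongrightarrow> velocity q s0"
    by (simp add: o_def)
  have "(\<lambda>n. Im (cnj ((p (\<tau> (k n)) - p t0) /\<^sub>R (\<tau> (k n) - t0)) * ((q (\<sigma> (k n)) - q s0) /\<^sub>R (\<sigma> (k n) - s0))))
      \<longlonglongrightarrow> Im (cnj (velocity p t0) * velocity q s0)"
    by (intro tendsto_intros dp dq)
  moreover have 0: "Im (cnj ((p (\<tau> (k n)) - p t0) /\<^sub>R (\<tau> (k n) - t0)) * ((q (\<sigma> (k n)) - q s0) /\<^sub>R (\<sigma> (k n) - s0))) = 0" for n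
  proof -
    have "Im (cnj (a *\<^sub>R c) * (b *\<^sub>R c)) = 0" for a b and c :: complex
      by simp
    then show ?thesis
      unfolding \<tau>(2) eq .
  qed
  ultimately have "Im (cnj (velocity p t0) * velocity q s0) = 0"
    unfolding 0 by (simp only: LIMSEQ_const_iff)
  then show False
    using tr eq t0(1) s0(1) by (auto simp: transverse_def)
qed


section \<open>Faces of an embedded cubic graph\<close>

lemma connected_subset_Un_cases:
  assumes "connected C" "C \<subseteq> A \<union> B" "open A" "open B" "A \<inter> B = {}"
  shows "C \<subseteq> A \<or> C \<subseteq> B"
proof -
  have "A \<inter> C = {} \<or> B \<inter> C = {}"
    using connectedD[OF assms(1,3,4)] assms(2,5) by blast
  then show ?thesis
    using assms(2) by blast
qed

lemma closure_open_Int: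
  assumes "x \<in> closure D" "open U" "x \<in> U"
  shows "U \<inter> D \<noteq> {}"
  using assms open_Int_closure_eq_empty[of U D] by blast

locale cubic_graph =
  fixes G :: "('e::finite, 'f::finite) plane_graph"
  assumes cubic: "cubic_plane_graph G"
begin

abbreviation eimg :: "'e \<Rightarrow> complex set" where
  "eimg e \<equiv> path_image (edge G e)"

text \<open>All vertices are kept whatever \<open>A\<close> is, so inserting an edge removes only
  the interior of that edge from the complement.\<close>

definition subpoints :: "'e set \<Rightarrow> complex set" where
  "subpoints A = verts G \<union> (\<Union>e\<in>A. eimg e)"

abbreviation regions :: "complex set set" where
  "regions \<equiv> components (- points G)"

definition sides :: "'e \<Rightarrow> complex set set" where
  "sides e = {D \<in> regions. eimg e \<subseteq> frontier D}"

lemma cubicD: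
  "finite (verts G)" "smooth_arc (edge G e)" "eimg e \<inter> verts G = edge_ends G e" "edge_ends G e \<subseteq> verts G"
  "e \<noteq> e' \<Longrightarrow> eimg e \<inter> eimg e' \<subseteq> verts G"
  "points G \<subseteq> {z. \<bar>Re z\<bar> < 1 \<and> \<bar>Im z\<bar> < 1}"
  "v \<in> verts G \<Longrightarrow> card (edges_at G v) = 3"
  "graph_connected (edge_ends G) (verts G) UNIV"
  "graph_connected (edge_ends G) (verts G) (UNIV - {e})"
  "bij_betw (face G) UNIV {C \<in> regions. bounded C}"
proof -
  note 1 = cubic[unfolded cubic_plane_graph_def]
  note 2 = conjunct2[OF 1] note 3 = conjunct2[OF 2] note 4 = conjunct2[OF 3] note 5 = conjunct2[OF 4]
  note 6 = conjunct2[OF 5] note 7 = conjunct2[OF 6]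
  note e = conjunct1[OF 2, rule_format, of e]
  show "finite (verts G)" by (rule conjunct1[OF 1])
  show "smooth_arc (edge G e)" using e by blast
  show "eimg e \<inter> verts G = edge_ends G e" using e by blast
  show "edge_ends G e \<subseteq> verts G" using e by blast
  show "e \<noteq> e' \<Longrightarrow> eimg e \<inter> eimg e' \<subseteq> verts G" by (rule conjunct1[OF 3, rule_format])
  show "points G \<subseteq> {z. \<bar>Re z\<bar> < 1 \<and> \<bar>Im z\<bar> < 1}" by (rule conjunct1[OF 4])
  show "v \<in> verts G \<Longrightarrow> card (edges_at G v) = 3" by (rule conjunct1[OF 5, rule_format])
  show "graph_connected (edge_ends G) (verts G) UNIV" by (rule conjunct1[OF 6])
  show "graph_connected (edge_ends G) (verts G) (UNIV - {e})" by (rule conjunct1[OF 7, rule_format])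
  show "bij_betw (face G) UNIV {C \<in> regions. bounded C}" by (rule conjunct2[OF 7])
qed

lemma points_eq: "points G = subpoints UNIV"
  by (simp add: points_def subpoints_def)

lemma subpoints_mono: "A \<subseteq> B \<Longrightarrow> subpoints A \<subseteq> subpoints B"
  unfolding subpoints_def by blast

lemma arc_edge: "arc (edge G e)"
  using cubicD(2) smooth_arcD(1) by blast

section \<open>Elementary topology of edges and subgraphs\<close>

lemma edge_meets_subpoints:
  assumes "x \<in> eimg e" "x \<in> subpoints A" "e \<notin> A"
  shows "x \<in> verts G"
proof (rule ccontr)
  assume x: "x \<notin> verts G"
  then obtain e' where e': "e' \<in> A" "x \<in> eimg e'"
    using assms(2) by (auto simp: subpoints_def)
  then have "e \<noteq> e'"
    using assms(3) by auto
  from cubicD(5)[OF this] show False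
    using e' assms(1) x by blast
qed

lemma compact_subpoints: "compact (subpoints A)"
  unfolding subpoints_def
  by (intro compact_Un finite_imp_compact cubicD(1) compact_UN finite compact_arc_image arc_edge)

lemma closed_subpoints: "closed (subpoints A)"
  by (intro compact_imp_closed compact_subpoints)

lemma open_region: "D \<in> components (- subpoints A) \<Longrightarrow> open D"
  using open_components[of "- subpoints A" D] closed_subpoints by (simp add: open_Compl)

lemma open_regions: "D \<in> regions \<Longrightarrow> open D"
  using open_region[of D UNIV] by (simp add: points_eq)

lemma edge_interior: "eimg e - verts G = edge G e ` {0<..<1}"
proof -
  have "eimg e - verts G = eimg e - edge_ends G e"
    using cubicD(3)[of e] by blast
  then show ?thesis
    unfolding edge_ends_def using simple_path_endless[OF arc_imp_simple_path[OF arc_edge[of e]]] by simp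
qed

lemma edge_subset_closure_interior: "eimg e \<subseteq> closure (eimg e - verts G)"
proof -
  have "edge G e ` closure {0<..<1} \<subseteq> closure (edge G e ` {0<..<1})"
    using arc_edge[of e]
    by (intro image_closure_subset closure_subset) (auto simp: arc_def path_def closure_greaterThanLessThan)
  then show ?thesis
    unfolding edge_interior by (simp add: path_image_def closure_greaterThanLessThan)
qed

lemma connected_edge_interior: "connected (eimg e - verts G)"
  unfolding edge_interior
  using arc_edge[of e] by (intro connected_continuous_image) (auto simp: arc_def path_def elim: continuous_on_subset)

text \<open>The crossing clause is part of the data because it must speak of the same two halves
  that are later identified with regions. It leaves open which half is entered first, as only the
  change of region matters.\<close>

definition local_sides :: "'e \<Rightarrow> complex \<Rightarrow> real \<Rightarrow> complex set \<Rightarrow> complex set \<Rightarrow> bool" where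
  "local_sides e z r S1 S2 \<longleftrightarrow> 0 < r \<and> open S1 \<and> open S2 \<and> connected S1 \<and> connected S2 \<and> S1 \<inter> S2 = {} \<and>
     ball z r - eimg e = S1 \<union> S2 \<and> eimg e \<inter> ball z r \<subseteq> closure S1 \<inter> closure S2 \<and>
     ball z r \<inter> subpoints (UNIV - {e}) = {} \<and>
     (\<forall>q s. smooth_arc q \<longrightarrow> transverse (edge G e) q \<longrightarrow> s \<in> {0..1} \<longrightarrow> q s = z \<longrightarrow>
        (\<exists>A B. (A = S1 \<and> B = S2 \<or> A = S2 \<and> B = S1) \<and>
          (\<forall>\<^sub>F x in at s within {0..<s}. q x \<in> A) \<and> (\<forall>\<^sub>F x in at s within {s<..1}. q x \<in> B)))"

lemma local_sides_exist:
  assumes z: "z \<in> eimg e - verts G" and \<epsilon>: "0 < \<epsilon>"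
  obtains r S1 S2 where "r \<le> \<epsilon>" "local_sides e z r S1 S2"
proof -
  have "z \<notin> subpoints (UNIV - {e})"
    using z edge_meets_subpoints[of z e "UNIV - {e}"] by blast
  \<comment> \<open>The rest of the graph is closed and misses \<open>z\<close>, so a disc of radius
    at most \<open>d\<close> sees only the edge \<open>e\<close>.\<close>
  then obtain d where d: "d > 0" "\<And>x. x \<in> subpoints (UNIV - {e}) \<Longrightarrow> d \<le> dist z x"
    using separate_point_closed[OF closed_subpoints] by metis
  obtain t0 where t0: "0 < t0" "t0 < 1" "edge G e t0 = z"
    using z edge_interior by auto
  obtain r S1 S2 where S: "0 < r" "r \<le> min \<epsilon> d" "open S1" "open S2" "connected S1" "connected S2" "S1 \<inter> S2 = {}"
    "ball (edge G e t0) r - eimg e = S1 \<union> S2"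
    "eimg e \<inter> ball (edge G e t0) r \<subseteq> closure S1 \<inter> closure S2"
    and cross: "\<And>q q' s. s \<in> {0..1} \<Longrightarrow> (q has_vector_derivative q') (at s within {0..1}) \<Longrightarrow> q s = edge G e t0 \<Longrightarrow>
        Im (cnj (velocity (edge G e) t0) * q') \<noteq> 0 \<Longrightarrow>
      \<exists>A B. (A = S1 \<and> B = S2 \<or> A = S2 \<and> B = S1) \<and>
        (\<forall>\<^sub>F x in at s within {0..<s}. q x \<in> A) \<and> (\<forall>\<^sub>F x in at s within {s<..1}. q x \<in> B)"
    by (rule smooth_arc_sides[OF cubicD(2) t0(1,2), of "min \<epsilon> d" e]) (use \<epsilon> d(1) in auto)
  have "ball z r \<inter> subpoints (UNIV - {e}) = {}"
    using d(2) S(2) by fastforce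
  moreover have "\<exists>A B. (A = S1 \<and> B = S2 \<or> A = S2 \<and> B = S1) \<and>
        (\<forall>\<^sub>F x in at s within {0..<s}. q x \<in> A) \<and> (\<forall>\<^sub>F x in at s within {s<..1}. q x \<in> B)"
    if "smooth_arc q" "transverse (edge G e) q" "s \<in> {0..1}" "q s = z" for q s
  proof (rule cross[OF that(3) smooth_arcD(2)[OF that(1,3)]])
    show "q s = edge G e t0"
      using that(4) t0(3) by simp
    then show "Im (cnj (velocity (edge G e) t0) * velocity q s) \<noteq> 0"
      using that(2,3) t0(1,2) by (simp add: transverse_def)
  qed
  ultimately show ?thesis
  proof (intro that[of r S1 S2])
    note S' = S[unfolded t0(3)]
    show "r \<le> \<epsilon>" using S(2) by simp
    assume *: "ball z r \<inter> subpoints (UNIV - {e}) = {}"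
      "\<And>q s. smooth_arc q \<Longrightarrow> transverse (edge G e) q \<Longrightarrow> s \<in> {0..1} \<Longrightarrow> q s = z \<Longrightarrow>
        \<exists>A B. (A = S1 \<and> B = S2 \<or> A = S2 \<and> B = S1) \<and>
        (\<forall>\<^sub>F x in at s within {0..<s}. q x \<in> A) \<and> (\<forall>\<^sub>F x in at s within {s<..1}. q x \<in> B)"
    show "local_sides e z r S1 S2"
      unfolding local_sides_def
      by (intro conjI allI impI) (rule S' *; assumption)+
  qed
qed

lemma local_sidesD:
  assumes "local_sides e z r S1 S2"
  shows "0 < r" "open S1" "open S2" "connected S1" "connected S2" "S1 \<inter> S2 = {}"
    "ball z r - eimg e = S1 \<union> S2" "eimg e \<inter> ball z r \<subseteq> closure S1" "eimg e \<inter> ball z r \<subseteq> closure S2"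
    "ball z r \<inter> subpoints (UNIV - {e}) = {}"
  using assms unfolding local_sides_def by simp_all

lemma local_sides_crossing:
  assumes "local_sides e z r S1 S2" "smooth_arc q" "transverse (edge G e) q" "s \<in> {0..1}" "q s = z"
  obtains A B where "A = S1 \<and> B = S2 \<or> A = S2 \<and> B = S1"
    "\<forall>\<^sub>F x in at s within {0..<s}. q x \<in> A" "\<forall>\<^sub>F x in at s within {s<..1}. q x \<in> B"
proof -
  have "\<forall>q s. smooth_arc q \<longrightarrow> transverse (edge G e) q \<longrightarrow> s \<in> {0..1} \<longrightarrow> q s = z \<longrightarrow>
        (\<exists>A B. (A = S1 \<and> B = S2 \<or> A = S2 \<and> B = S1) \<and>
          (\<forall>\<^sub>F x in at s within {0..<s}. q x \<in> A) \<and> (\<forall>\<^sub>F x in at s within {s<..1}. q x \<in> B))"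
    using assms(1) by (simp add: local_sides_def)
  from this[rule_format, OF assms(2-5)] show ?thesis
    using that by blast
qed

lemma local_sides_nonempty:
  assumes "local_sides e z r S1 S2" "z \<in> eimg e"
  shows "z \<in> closure S1" "z \<in> closure S2" "S1 \<noteq> {}" "S2 \<noteq> {}"
proof -
  have "z \<in> eimg e \<inter> ball z r"
    using assms local_sidesD(1)[OF assms(1)] by simp
  then show "z \<in> closure S1" "z \<in> closure S2"
    using local_sidesD(8,9)[OF assms(1)] by blast+
  then show "S1 \<noteq> {}" "S2 \<noteq> {}"
    by auto
qed

lemma local_sides_avoid:
  assumes "local_sides e z r S1 S2"
  shows "S1 \<union> S2 = ball z r - points G"
proof -
  have "points G = eimg e \<union> subpoints (UNIV - {e})"
    unfolding points_eq subpoints_def by auto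
  then show ?thesis
    using local_sidesD(7,10)[OF assms] by blast
qed

lemma walk_path_component:
  assumes "walk (edge_ends G) u es v"
  shows "path_component (insert u (\<Union>e\<in>set es. eimg e)) u v"
  using assms
proof (induction es arbitrary: u)
  case (Cons e es)
  then obtain w where w: "edge_ends G e = {u, w}" "walk (edge_ends G) w es v" by auto
  have uw: "u \<in> eimg e" "w \<in> eimg e"
    using w(1) cubicD(3)[of e] by blast+
  have "path_component (eimg e) u w"
    using path_connected_path_image[OF arc_imp_path[OF arc_edge[of e]]] uw
    by (simp add: path_connected_component)
  moreover have "path_component (insert w (\<Union>e\<in>set es. eimg e)) w v"
    using Cons.IH[OF w(2)] .
  ultimately show ?case
    using uw by (intro path_component_trans[of _ u w v]) (auto elim!: path_component_of_subset[rotated])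
qed (simp add: path_component_refl)

text \<open>The walk closes \<open>e\<close> up to a Jordan curve, which has one side of \<open>e\<close> inside and the other
  one outside.\<close>

lemma sides_separated:
  assumes loc: "local_sides e z r S1 S2" and z: "z \<in> eimg e - verts G"
    and A: "e \<notin> A" "edge_ends G e = {u, w}" "walk (edge_ends G) u es w" "set es \<subseteq> A"
    and C: "connected C" "C \<subseteq> - subpoints (insert e A)"
  shows "C \<inter> S1 = {} \<or> C \<inter> S2 = {}"
proof -
  define a b where "a = pathstart (edge G e)" and "b = pathfinish (edge G e)"
  have ab: "edge_ends G e = {a, b}" "a \<noteq> b"
    using arc_distinct_ends[OF arc_edge[of e]] by (auto simp: edge_ends_def a_def b_def)
  define S where "S = insert u (\<Union>e\<in>set es. eimg e)"
  have "path_component S u w"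
    unfolding S_def by (rule walk_path_component[OF A(3)])
  then have "path_component S b a"
    using ab A(2) by (metis doubleton_eq_iff path_component_sym)
  then obtain g0 where "path g0" "path_image g0 \<subseteq> S" "pathstart g0 = b" "pathfinish g0 = a"
    unfolding path_component_def by blast
  \<comment> \<open>The walk only gives a path, which may cross itself; it is shortened to an arc so
    that closing it up with \<open>e\<close> gives a simple loop.\<close>
  then obtain g where g: "arc g" "path_image g \<subseteq> S" "pathstart g = b" "pathfinish g = a"
    using path_contains_arc[of g0 b a] ab(2) by (metis order.trans)
  have uv: "u \<in> verts G"
    using A(2) cubicD(4)[of e] by blast
  have Ssub: "S \<subseteq> subpoints (UNIV - {e})" "S \<subseteq> subpoints (insert e A)"
    unfolding S_def subpoints_def using uv A by blast+
  have "eimg e \<inter> subpoints (UNIV - {e}) \<subseteq> edge_ends G e"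
    using edge_meets_subpoints[of _ e "UNIV - {e}"] cubicD(3)[of e] by blast
  then have meet: "eimg e \<inter> path_image g \<subseteq> {a, b}"
    using g(2) Ssub ab(1) by blast
  define c where "c = edge G e +++ g"
  have sc: "simple_path c"
    unfolding c_def using g meet by (intro simple_path_join_loop arc_edge) (auto simp: a_def b_def)
  have "pathfinish c = pathstart c"
    by (simp add: c_def g a_def)
  note J = Jordan_inside_outside[OF sc this]
  define I O' where "I = inside (path_image c)" and "O' = outside (path_image c)"
  have IO: "open I" "open O'" "I \<inter> O' = {}" "I \<union> O' = - path_image c" "frontier I = path_image c" "frontier O' = path_image c"
    using J unfolding I_def O'_def by simp_all
  have pc: "path_image c = eimg e \<union> path_image g"
    unfolding c_def using g by (intro path_image_join) (simp add: b_def)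
  \<comment> \<open>Each point of a Jordan curve is a frontier point of both its inside and its
    outside, so both meet the disc around \<open>z\<close>. The local sides fill the disc off the
    curve and are connected, so one of them lies inside and the other outside.\<close>
  have "z \<in> closure I" "z \<in> closure O'"
    using IO(5,6) pc z unfolding frontier_def by blast+
  moreover have zb: "open (ball z r)" "z \<in> ball z r"
    using loc by (auto simp: local_sides_def)
  ultimately have ne: "ball z r \<inter> I \<noteq> {}" "ball z r \<inter> O' \<noteq> {}"
    using closure_open_Int by metis+
  have ballJ: "ball z r - path_image c = S1 \<union> S2"
    using local_sidesD(7,10)[OF loc] g(2) Ssub(1) unfolding pc by blast
  then have "S1 \<subseteq> I \<union> O'" "S2 \<subseteq> I \<union> O'"
    using IO(4) by blast+
  then have S12: "S1 \<subseteq> I \<or> S1 \<subseteq> O'" "S2 \<subseteq> I \<or> S2 \<subseteq> O'"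
    using local_sidesD(4,5)[OF loc] IO connected_subset_Un_cases[of _ I O'] by auto
  have "ball z r \<inter> I \<subseteq> S1 \<union> S2" "ball z r \<inter> O' \<subseteq> S1 \<union> S2"
    using IO(4) ballJ by blast+
  then have "S1 \<subseteq> I \<and> S2 \<subseteq> O' \<or> S1 \<subseteq> O' \<and> S2 \<subseteq> I"
    using S12 ne IO(3) by blast
  moreover have "eimg e \<subseteq> subpoints (insert e A)"
    by (auto simp: subpoints_def)
  then have "path_image c \<subseteq> subpoints (insert e A)"
    using pc g(2) Ssub(2) by simp
  then have "C \<subseteq> I \<union> O'"
    using C(2) IO(4) by blast
  then have "C \<subseteq> I \<or> C \<subseteq> O'"
    using connected_subset_Un_cases[OF C(1) _ IO(1,2,3)] by blast
  ultimately show ?thesis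
    using IO(3) by blast
qed

section \<open>Regions on the two sides of an edge\<close>

lemma region_superset:
  assumes "connected S" "S \<noteq> {}" "S \<subseteq> - subpoints A"
  obtains C where "C \<in> components (- subpoints A)" "S \<subseteq> C"
  using exists_component_superset[of S "- subpoints A"] assms by blast

lemma region_eq:
  assumes "C \<in> components (- subpoints A)" "D \<in> components (- subpoints A)" "C \<inter> D \<noteq> {}"
  shows "C = D"
  using components_nonoverlap[OF assms(1,2)] assms(3) by blast

text \<open>Formulated for a subgraph in which \<open>e\<close> lies on a cycle: bridgelessness
  gives the case of the whole graph, and the count of regions needs the case of subgraphs, where
  edges are added one by one.\<close>

lemma edge_on_cycle_regions:
  assumes loc: "local_sides e z r S1 S2" and z: "z \<in> eimg e - verts G"
    and A: "e \<notin> A" "edge_ends G e = {u, w}" "walk (edge_ends G) u es w" "set es \<subseteq> A"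
  obtains C1 C2 where "C1 \<noteq> C2" "C1 \<in> components (- subpoints (insert e A))"
    "C2 \<in> components (- subpoints (insert e A))" "S1 \<subseteq> C1" "S2 \<subseteq> C2"
    "\<forall>D\<in>components (- subpoints (insert e A)). z \<in> closure D \<longrightarrow> D = C1 \<or> D = C2"
proof -
  have sub: "S1 \<union> S2 \<subseteq> - subpoints (insert e A)"
    using local_sides_avoid[OF loc] subpoints_mono[of "insert e A" UNIV] by (auto simp: points_eq)
  note ne = local_sides_nonempty[OF loc]
  obtain C1 where C1: "C1 \<in> components (- subpoints (insert e A))" "S1 \<subseteq> C1"
    using region_superset[of S1 "insert e A"] loc ne z sub by (auto simp: local_sides_def)
  obtain C2 where C2: "C2 \<in> components (- subpoints (insert e A))" "S2 \<subseteq> C2"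
    using region_superset[of S2 "insert e A"] loc ne z sub by (auto simp: local_sides_def)
  show ?thesis
  proof (rule that[OF _ C1(1) C2(1) C1(2) C2(2)])
    have "connected C1" "C1 \<subseteq> - subpoints (insert e A)"
      using in_components_connected[OF C1(1)] in_components_subset[OF C1(1)] .
    from sides_separated[OF loc z A this] show "C1 \<noteq> C2"
      using C1(2) C2(2) ne z by blast
  next
    show "\<forall>D\<in>components (- subpoints (insert e A)). z \<in> closure D \<longrightarrow> D = C1 \<or> D = C2"
    proof (intro ballI impI)
    fix D assume D: "D \<in> components (- subpoints (insert e A))" "z \<in> closure D"
    have "ball z r \<inter> D \<noteq> {}"
      using closure_open_Int[OF D(2), of "ball z r"] loc by (simp add: local_sides_def)
    moreover have "D \<subseteq> - eimg e"
      using in_components_subset[OF D(1)] unfolding subpoints_def by blast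
    ultimately have "D \<inter> (S1 \<union> S2) \<noteq> {}"
      using local_sidesD(7)[OF loc] by blast
    then show "D = C1 \<or> D = C2"
      using region_eq[OF D(1) C1(1)] region_eq[OF D(1) C2(1)] C1(2) C2(2) by blast
    qed
  qed
qed

text \<open>Bridgelessness enters here: after removal of \<open>e\<close> its end points are still
  connected, so \<open>e\<close> lies on a cycle.\<close>

lemma edge_bypass:
  obtains u w es where "edge_ends G e = {u, w}" "walk (edge_ends G) u es w" "set es \<subseteq> UNIV - {e}"
proof -
  have "edge_ends G e = {pathstart (edge G e), pathfinish (edge G e)}"
    by (simp add: edge_ends_def)
  moreover obtain es where "set es \<subseteq> UNIV - {e}" "walk (edge_ends G) (pathstart (edge G e)) es (pathfinish (edge G e))"
    using cubicD(9)[of e] cubicD(4)[of e] unfolding graph_connected_def edge_ends_def by blast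
  ultimately show ?thesis
    using that by blast
qed

lemma edge_regions_at:
  assumes loc: "local_sides e z r S1 S2" and z: "z \<in> eimg e - verts G"
  obtains C1 C2 where "C1 \<noteq> C2" "C1 \<in> regions" "C2 \<in> regions" "S1 \<subseteq> C1" "S2 \<subseteq> C2"
    "\<forall>D\<in>regions. z \<in> closure D \<longrightarrow> D = C1 \<or> D = C2"
proof -
  obtain u w es where w: "edge_ends G e = {u, w}" "walk (edge_ends G) u es w" "set es \<subseteq> UNIV - {e}"
    using edge_bypass .
  have "insert e (UNIV - {e}) = UNIV" by auto
  then show ?thesis
    using edge_on_cycle_regions[OF loc z _ w, of thesis] that unfolding points_eq by auto
qed

text \<open>The interior points of \<open>e\<close> in the closure of \<open>D\<close> form a
  relatively closed set. It is also open: near such a point \<open>D\<close> contains an entire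
  local side, whose closure contains all of the edge in the disc. The interior of an edge is
  connected.\<close>

lemma edge_subset_frontier:
  assumes D: "D \<in> regions" and z: "z \<in> eimg e - verts G" "z \<in> closure D"
  shows "eimg e \<subseteq> frontier D"
proof -
  define N where "N = eimg e - verts G"
  have "N \<inter> closure D = N"
  proof -
    have "openin (top_of_set N) (N \<inter> closure D)"
    proof (subst openin_euclidean_subtopology_iff, intro conjI ballI)
      fix x assume x: "x \<in> N \<inter> closure D"
      then have xe: "x \<in> eimg e - verts G" by (simp add: N_def)
      obtain r S1 S2 where loc: "local_sides e x r S1 S2"
        using local_sides_exist[OF xe zero_less_one] .
      obtain C1 C2 where "C1 \<noteq> C2" "C1 \<in> regions" "C2 \<in> regions" and C: "S1 \<subseteq> C1" "S2 \<subseteq> C2"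
        "\<forall>D\<in>regions. x \<in> closure D \<longrightarrow> D = C1 \<or> D = C2"
        by (rule edge_regions_at[OF loc xe])
      have "closure S1 \<subseteq> closure D \<or> closure S2 \<subseteq> closure D"
        using C(3) D x closure_mono[OF C(1)] closure_mono[OF C(2)] by auto
      then have "eimg e \<inter> ball x r \<subseteq> closure D"
        using local_sidesD(8,9)[OF loc] by blast
      moreover have "0 < r"
        using loc by (simp add: local_sides_def)
      ultimately show "\<exists>d>0. \<forall>y\<in>N. dist y x < d \<longrightarrow> y \<in> N \<inter> closure D"
        by (intro exI[of _ r]) (auto simp: N_def dist_commute)
    qed simp
    moreover have "closedin (top_of_set N) (N \<inter> closure D)"
      by (simp add: closedin_closed_Int)
    ultimately have "N \<inter> closure D = {} \<or> N \<inter> closure D = N"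
      using connected_edge_interior[of e] unfolding N_def[symmetric] connected_clopen by blast
    then show ?thesis
      using z by (auto simp: N_def)
  qed
  then have "closure N \<subseteq> closure D"
    by (metis Int_lower2 closure_closure closure_mono)
  then have "eimg e \<subseteq> closure D"
    using edge_subset_closure_interior[of e] by (simp add: N_def)
  moreover have "D \<inter> eimg e = {}"
    using in_components_subset[OF D] by (auto simp: points_def)
  ultimately show ?thesis
    using open_regions[OF D] by (auto simp: frontier_def interior_open)
qed

text \<open>A region touching one interior point of \<open>e\<close> borders all of
  \<open>e\<close>, so the two regions seen in a small disc are exactly the global sides.\<close>

lemma sides_local:
  assumes loc: "local_sides e z r S1 S2" and z: "z \<in> eimg e - verts G"
  obtains C1 C2 where "C1 \<noteq> C2" "sides e = {C1, C2}" "S1 \<subseteq> C1" "S2 \<subseteq> C2"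
    "\<forall>D\<in>regions. z \<in> closure D \<longrightarrow> D \<in> sides e"
proof -
  obtain C1 C2 where C: "C1 \<noteq> C2" "C1 \<in> regions" "C2 \<in> regions" "S1 \<subseteq> C1" "S2 \<subseteq> C2"
    "\<forall>D\<in>regions. z \<in> closure D \<longrightarrow> D = C1 \<or> D = C2"
    by (rule edge_regions_at[OF loc z])
  have *: "\<forall>D\<in>regions. z \<in> closure D \<longrightarrow> D \<in> sides e"
    using edge_subset_frontier[OF _ z] by (simp add: sides_def)
  have "z \<in> closure C1" "z \<in> closure C2"
    using local_sides_nonempty[OF loc] z closure_mono[OF C(4)] closure_mono[OF C(5)] by auto
  then have "C1 \<in> sides e" "C2 \<in> sides e"
    using * C by blast+
  moreover have "D = C1 \<or> D = C2" if "D \<in> sides e" for D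
    using that z C(6) by (auto simp: sides_def frontier_def)
  ultimately have "sides e = {C1, C2}" by blast
  then show ?thesis
    by (rule that[OF C(1) _ C(4,5) *])
qed

lemma edge_interior_nonempty: "eimg e - verts G \<noteq> {}"
  unfolding edge_interior by auto

lemma card_sides: "card (sides e) = 2"
proof -
  obtain z where z: "z \<in> eimg e - verts G"
    using edge_interior_nonempty by blast
  obtain r S1 S2 where loc: "local_sides e z r S1 S2"
    using local_sides_exist[OF z zero_less_one] .
  obtain C1 C2 where "C1 \<noteq> C2" "sides e = {C1, C2}"
    by (rule sides_local[OF loc z])
  then show ?thesis by simp
qed

lemma sides_subset: "sides e \<subseteq> regions"
  by (auto simp: sides_def)


subsection \<open>Sectors at a vertex\<close>

lemma edge_germ:
  assumes "v \<in> edge_ends G e"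
  shows "\<exists>r u. 0 < r \<and> directions r u \<and> (\<forall>r'\<le>r. eimg e \<inter> ball v r' - {v} = ray v u r')"
proof -
  have inj: "inj_on (edge G e) {0..1}"
    using arc_edge[of e] by (simp add: arc_def)
  have swap: "eimg e \<inter> B - {v} = (eimg e - {v}) \<inter> B" for B
    by blast
  consider "v = edge G e 0" | "v = edge G e 1"
    using assms by (auto simp: edge_ends_def pathstart_def pathfinish_def)
  then show ?thesis
  proof cases
    case 1
    have "{0..1} - {0} = {0<..1::real}" by auto
    then have "eimg e - {v} = edge G e ` {0<..1}"
      using inj_on_image_set_diff[OF inj, of "{0..1}" "{0}"] 1 by (auto simp: path_image_def)
    moreover obtain r u where "0 < r" "directions r u" "(u \<longlongrightarrow> sgn (velocity (edge G e) 0)) (at_right 0)"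
      "\<forall>r'\<le>r. edge G e ` {0<..1} \<inter> ball (edge G e 0) r' = ray (edge G e 0) u r'"
      by (rule smooth_arc_germ_forward[OF cubicD(2)[of e] order.refl zero_less_one])
    ultimately show ?thesis
      unfolding swap using 1 by (intro exI[of _ r] exI[of _ u]) simp
  next
    case 2
    have "{0..1} - {1} = {0..<1::real}" by auto
    then have "eimg e - {v} = edge G e ` {0..<1}"
      using inj_on_image_set_diff[OF inj, of "{0..1}" "{1}"] 2 by (auto simp: path_image_def)
    moreover obtain r u where "0 < r" "directions r u" "(u \<longlongrightarrow> - sgn (velocity (edge G e) 1)) (at_right 0)"
      "\<forall>r'\<le>r. edge G e ` {0..<1} \<inter> ball (edge G e 1) r' = ray (edge G e 1) u r'"
      by (rule smooth_arc_germ_backward[OF cubicD(2)[of e] zero_less_one order.refl])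
    ultimately show ?thesis
      unfolding swap using 2 by (intro exI[of _ r] exI[of _ u]) simp
  qed
qed

text \<open>\<open>S e\<close> is the sector opposite to \<open>e\<close>. The rays are bound
  inside, since later arguments use only the sectors and how they border on the edges. All smaller
  radii are included because adjacency of a thread concerns radii tending to 0.\<close>

definition vertex_sectors :: "complex \<Rightarrow> real \<Rightarrow> ('e \<Rightarrow> complex set) \<Rightarrow> bool" where
  "vertex_sectors v R S \<longleftrightarrow> 0 < R \<and> ball v R \<inter> verts G = {v} \<and>
     (\<exists>u. opposite_sectors v R (edges_at G v) u S \<and>
       (\<forall>e\<in>edges_at G v. directions R (u e)) \<and>
       (\<forall>r\<le>R. \<forall>e\<in>edges_at G v. eimg e \<inter> ball v r - {v} = ray v (u e) r) \<and>
       (\<forall>r\<le>R. 0 < r \<longrightarrow> ball v r - points G = ball v r - {v} - (\<Union>e\<in>edges_at G v. ray v (u e) r)))"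

lemma vertex_sectors_exist:
  assumes v: "v \<in> verts G"
  obtains R S where "vertex_sectors v R S"
proof -
  let ?E = "edges_at G v"
  have "\<forall>e\<in>?E. \<exists>ru. 0 < fst ru \<and> directions (fst ru) (snd ru) \<and>
      (\<forall>r'\<le>fst ru. eimg e \<inter> ball v r' - {v} = ray v (snd ru) r')"
    using edge_germ by (auto simp: edges_at_def)
  then obtain f where f: "\<forall>e\<in>?E. 0 < fst (f e) \<and> directions (fst (f e)) (snd (f e)) \<and>
      (\<forall>r'\<le>fst (f e). eimg e \<inter> ball v r' - {v} = ray v (snd (f e)) r')"
    unfolding bchoice_iff by (elim exE)
  define u where "u e = snd (f e)" for e
  have fin: "finite ?E" by simp
  obtain a b c where abc: "?E = {a, b, c}" "a \<noteq> b" "b \<noteq> c" "a \<noteq> c"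
    using cubicD(7)[OF v] unfolding card_3_iff by auto
  \<comment> \<open>The part of the graph that does not reach \<open>v\<close>; its distance from
    \<open>v\<close> bounds the radius.\<close>
  define K where "K = (verts G - {v}) \<union> (\<Union>e\<in>UNIV - ?E. eimg e)"
  have "closed K"
    unfolding K_def using cubicD(1)
    by (intro closed_Un closed_UN ballI compact_imp_closed[OF compact_arc_image[OF arc_edge]] finite)
       (simp add: finite_imp_closed)
  moreover have "v \<notin> K"
    using v cubicD(3) by (auto simp: K_def edges_at_def)
  ultimately obtain d where d: "d > 0" "\<forall>x\<in>K. d \<le> dist v x"
    using separate_point_closed by metis
  define R where "R = Min ({d} \<union> (\<lambda>e. fst (f e)) ` ?E)"
  have R: "0 < R" "R \<le> d" "\<And>e. e \<in> ?E \<Longrightarrow> R \<le> fst (f e)"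
    using d f fin by (auto simp: R_def)
  have dir: "directions R (u e)" if "e \<in> ?E" for e
    using f R(3)[OF that] that unfolding u_def by (blast intro: directions_mono)
  have rays: "eimg e \<inter> ball v r - {v} = ray v (u e) r" if "r \<le> R" "e \<in> ?E" for r e
    using f R(3)[OF that(2)] that unfolding u_def by (meson order.trans)
  have ballK: "ball v R \<inter> K = {}"
    using d(2) R(2) by fastforce
  then have bv: "ball v R \<inter> verts G = {v}"
    using v R(1) by (auto simp: K_def)
  \<comment> \<open>Equal directions at some radius would give a common point of two edges, hence a
    second vertex in the disc.\<close>
  have ne: "u i \<rho> \<noteq> u j \<rho>" if ij: "i \<in> ?E" "j \<in> ?E" "i \<noteq> j" and \<rho>: "0 < \<rho>" "\<rho> < R" for i j \<rho>
  proof
    assume eq: "u i \<rho> = u j \<rho>"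
    define x where "x = v + \<rho> *\<^sub>R u i \<rho>"
    have "x \<in> ray v (u i) R" "x \<in> ray v (u j) R"
      using \<rho> eq unfolding x_def by (auto intro: mem_rayI)
    then have "x \<in> eimg i \<inter> ball v R - {v}" "x \<in> eimg j \<inter> ball v R - {v}"
      using rays[of R] ij by auto
    then show False
      using cubicD(5)[OF ij(3)] bv by blast
  qed
  have pts: "points G \<inter> ball v r - {v} = (\<Union>e\<in>?E. eimg e \<inter> ball v r - {v})" if "r \<le> R" for r
  proof -
    have "points G = insert v (K \<union> (\<Union>e\<in>?E. eimg e))"
      using v by (auto simp: K_def points_def)
    moreover have "ball v r \<inter> K = {}"
      using ballK subset_ball[OF that, of v] by blast
    ultimately show ?thesis by auto
  qed
  have "ball v r - points G = ball v r - {v} - (\<Union>e\<in>?E. ray v (u e) r)" if "r \<le> R" for r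
  proof -
    have "(\<Union>e\<in>?E. ray v (u e) r) = points G \<inter> ball v r - {v}"
      unfolding pts[OF that] using rays[OF that] by auto
    moreover have "v \<in> points G"
      using v by (simp add: points_def)
    ultimately show ?thesis by blast
  qed
  moreover obtain S where "opposite_sectors v R ?E u S"
    using opposite_sectors_exist[of a b c R u v] dir ne abc by auto
  ultimately have "vertex_sectors v R S"
    unfolding vertex_sectors_def using R(1) bv dir rays by blast
  then show ?thesis ..
qed

lemma vertex_sectorsD:
  assumes "vertex_sectors v R S"
  shows "0 < R" "ball v R \<inter> verts G = {v}"
    "e \<in> edges_at G v \<Longrightarrow> open (S e)"
    "e \<in> edges_at G v \<Longrightarrow> e' \<in> edges_at G v \<Longrightarrow> e \<noteq> e' \<Longrightarrow> S e \<inter> S e' = {}"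
    "0 < r \<Longrightarrow> r \<le> R \<Longrightarrow> e \<in> edges_at G v \<Longrightarrow> connected (S e \<inter> ball v r)"
    "0 < r \<Longrightarrow> r \<le> R \<Longrightarrow> ball v r - points G = (\<Union>e\<in>edges_at G v. S e) \<inter> ball v r"
    "0 < r \<Longrightarrow> r \<le> R \<Longrightarrow> e \<in> edges_at G v \<Longrightarrow> e' \<in> edges_at G v \<Longrightarrow> e \<noteq> e' \<Longrightarrow>
      eimg e \<inter> ball v r - {v} \<subseteq> closure (S e' \<inter> ball v r)"
    "0 < r \<Longrightarrow> r \<le> R \<Longrightarrow> e \<in> edges_at G v \<Longrightarrow> (eimg e \<inter> ball v r - {v}) \<inter> closure (S e) = {}"
    "0 < r \<Longrightarrow> r \<le> R \<Longrightarrow> e \<in> edges_at G v \<Longrightarrow> eimg e \<inter> ball v r - {v} \<noteq> {}"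
proof -
  obtain u where opp: "opposite_sectors v R (edges_at G v) u S"
    and dir: "\<forall>e\<in>edges_at G v. directions R (u e)"
    and rays: "\<forall>r\<le>R. \<forall>e\<in>edges_at G v. eimg e \<inter> ball v r - {v} = ray v (u e) r"
    and pts: "\<forall>r\<le>R. 0 < r \<longrightarrow> ball v r - points G = ball v r - {v} - (\<Union>e\<in>edges_at G v. ray v (u e) r)"
    using assms unfolding vertex_sectors_def by (elim conjE exE)
  note 1 = opp[unfolded opposite_sectors_def]
  note 2 = conjunct2[OF 1] note 3 = conjunct2[OF 2]
  show "0 < R" "ball v R \<inter> verts G = {v}"
    using assms unfolding vertex_sectors_def by blast+
  show "e \<in> edges_at G v \<Longrightarrow> open (S e)"
    using conjunct1[OF 1] by blast
  show "e \<in> edges_at G v \<Longrightarrow> e' \<in> edges_at G v \<Longrightarrow> e \<noteq> e' \<Longrightarrow> S e \<inter> S e' = {}"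
    using conjunct1[OF 2] by blast
  assume r: "0 < r" "r \<le> R"
  note 3 = 3[rule_format, OF r]
  note 4 = conjunct2[OF 3] note 5 = conjunct2[OF 4]
  show "ball v r - points G = (\<Union>e\<in>edges_at G v. S e) \<inter> ball v r"
    using pts r conjunct1[OF 4] by simp
  assume e: "e \<in> edges_at G v"
  have re: "eimg e \<inter> ball v r - {v} = ray v (u e) r"
    using rays r e by blast
  show "connected (S e \<inter> ball v r)"
    using conjunct1[OF 3] e by blast
  show "(eimg e \<inter> ball v r - {v}) \<inter> closure (S e) = {}"
    unfolding re using conjunct2[OF 5] e by blast
  show "eimg e \<inter> ball v r - {v} \<noteq> {}"
    unfolding re ray_def using r by auto
  assume "e' \<in> edges_at G v" "e \<noteq> e'"
  then show "eimg e \<inter> ball v r - {v} \<subseteq> closure (S e' \<inter> ball v r)"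
    unfolding re using conjunct1[OF 5] e by blast
qed

lemma edges_at_third:
  assumes "v \<in> verts G" "e \<in> edges_at G v"
  obtains a b where "edges_at G v = {e, a, b}" "e \<noteq> a" "e \<noteq> b" "a \<noteq> b"
proof -
  have "card (edges_at G v - {e}) = 2"
    using cubicD(7)[OF assms(1)] assms(2) by simp
  then obtain a b where "edges_at G v - {e} = {a, b}" "a \<noteq> b"
    by (auto simp: card_2_iff)
  then show ?thesis
    using assms(2) by (intro that[of a b]) blast+
qed

text \<open>Off the graph, a small disc at a point of \<open>e\<close> near \<open>v\<close> meets
  exactly the two sectors bordering on \<open>e\<close>, those opposite to the other edges, with one
  local side in each. The local sides lie in different regions, and so do any two sectors at
  \<open>v\<close>.\<close>

lemma vertex_regions:
  assumes v: "v \<in> verts G" and sec: "vertex_sectors v R S"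
  obtains F where "\<forall>e\<in>edges_at G v. F e \<in> regions \<and> S e \<inter> ball v R \<subseteq> F e"
    "inj_on F (edges_at G v)" "\<forall>e\<in>edges_at G v. sides e = F ` (edges_at G v - {e})"
proof -
  let ?E = "edges_at G v"
  note sD = vertex_sectorsD[OF sec]
  note R = sD(1)
  have "\<exists>C. C \<in> regions \<and> S e \<inter> ball v R \<subseteq> C" if e: "e \<in> ?E" for e
  proof -
    obtain a b where ab: "?E = {e, a, b}" "e \<noteq> a"
      using edges_at_third[OF v e] .
    have a: "a \<in> ?E" using ab by simp
    have "closure (S e \<inter> ball v R) \<noteq> {}"
      using sD(7)[OF R order.refl a e] sD(9)[OF R order.refl a] ab(2) by force
    then have "S e \<inter> ball v R \<noteq> {}" by auto
    moreover have "S e \<inter> ball v R \<subseteq> - subpoints UNIV"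
      using sD(6)[OF R order.refl] e unfolding points_eq by blast
    ultimately show ?thesis
      using region_superset[OF sD(5)[OF R order.refl e]] unfolding points_eq by metis
  qed
  then obtain F where F: "\<forall>e\<in>?E. F e \<in> regions \<and> S e \<inter> ball v R \<subseteq> F e"
    by metis
  have key: "F a \<noteq> F b \<and> sides e = {F a, F b}"
    if E: "?E = {e, a, b}" "e \<noteq> a" "e \<noteq> b" "a \<noteq> b" for e a b
  proof -
    have mem: "e \<in> ?E" "a \<in> ?E" "b \<in> ?E" using E by auto
    obtain z where z: "z \<in> eimg e \<inter> ball v R - {v}"
      using sD(9)[OF R order.refl mem(1)] by blast
    have zv: "z \<in> eimg e - verts G"
      using z sD(2) by blast
    have "open (ball v R - {v})" by (simp add: open_delete)
    then obtain \<epsilon> where \<epsilon>: "\<epsilon> > 0" "ball z \<epsilon> \<subseteq> ball v R - {v}"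
      using z open_contains_ball[of "ball v R - {v}"] by blast
    obtain r S1 S2 where r: "r \<le> \<epsilon>" and loc: "local_sides e z r S1 S2"
      using local_sides_exist[OF zv \<epsilon>(1)] .
    have zr: "z \<in> ball z r" "ball z r \<subseteq> ball v R"
      using local_sidesD(1)[OF loc] order.trans[OF subset_ball[OF r, of z] \<epsilon>(2)] by simp_all blast
    have avoid: "S1 \<union> S2 = ball z r - points G"
      by (rule local_sides_avoid[OF loc])
    have cover: "ball v R - points G = (S e \<union> (S a \<union> S b)) \<inter> ball v R"
      using sD(6)[OF R order.refl] unfolding E(1) by auto
    have dis: "S e \<inter> S a = {}" "S e \<inter> S b = {}" "S a \<inter> S b = {}"
      using sD(4) mem E by blast+
    have op: "open (S e)" "open (S a)" "open (S b)"
      using sD(3) mem by blast+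
    have ze: "z \<notin> closure (S e)"
      using sD(8)[OF R order.refl mem(1)] z by blast
    have cl: "z \<in> closure (S a)" "z \<in> closure (S b)"
      using sD(7)[OF R order.refl mem(1) mem(2) E(2)] sD(7)[OF R order.refl mem(1) mem(3) E(3)] z
        closure_mono[of "S a \<inter> ball v R" "S a"] closure_mono[of "S b \<inter> ball v R" "S b"] by blast+
    \<comment> \<open>A connected part of the disc off the graph lies in one sector, and
      \<open>S e\<close> is excluded because \<open>z\<close> is not in its closure.\<close>
    have part: "X \<subseteq> S a \<or> X \<subseteq> S b" if X: "connected X" "X \<subseteq> S1 \<union> S2" "z \<in> closure X" for X
    proof -
      have "X \<subseteq> S e \<union> (S a \<union> S b)"
        using X(2) avoid cover zr(2) by blast
      then have "X \<subseteq> S e \<or> X \<subseteq> S a \<union> S b"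
        using connected_subset_Un_cases[OF X(1)] op dis by blast
      moreover have "\<not> X \<subseteq> S e"
        using closure_mono[of X "S e"] X(3) ze by blast
      ultimately show ?thesis
        using connected_subset_Un_cases[OF X(1) _ op(2,3) dis(3)] by blast
    qed
    have "z \<in> eimg e" using z by blast
    note ne = local_sides_nonempty[OF loc this]
    have S12: "S1 \<subseteq> S a \<or> S1 \<subseteq> S b" "S2 \<subseteq> S a \<or> S2 \<subseteq> S b"
      using part[of S1] part[of S2] local_sidesD(4,5)[OF loc] ne by blast+
    \<comment> \<open>Both sectors accumulate at \<open>z\<close>, so each of them meets a local
      side; hence the local sides cannot share a sector.\<close>
    have hit: "X \<inter> (S1 \<union> S2) \<noteq> {}" if "z \<in> closure X" "X = S a \<or> X = S b" for X
    proof -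
      have "ball z r \<inter> X \<noteq> {}"
        by (rule closure_open_Int[OF that(1) open_ball zr(1)])
      then show ?thesis
        using that(2) cover zr(2) avoid by blast
    qed
    have two: "S1 \<subseteq> S a \<and> S2 \<subseteq> S b \<or> S1 \<subseteq> S b \<and> S2 \<subseteq> S a"
      using S12 hit[OF cl(1)] hit[OF cl(2)] dis(3) by blast
    obtain C1 C2 where C: "C1 \<noteq> C2" "sides e = {C1, C2}" "S1 \<subseteq> C1" "S2 \<subseteq> C2"
      "\<forall>D\<in>regions. z \<in> closure D \<longrightarrow> D \<in> sides e"
      by (rule sides_local[OF loc zv])
    have "S1 \<subseteq> ball v R" "S2 \<subseteq> ball v R"
      using avoid zr(2) by blast+
    moreover have "S a \<inter> ball v R \<subseteq> F a" "S b \<inter> ball v R \<subseteq> F b"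
      using F mem by blast+
    ultimately have sub: "S1 \<subseteq> F a \<inter> C1 \<and> S2 \<subseteq> F b \<inter> C2 \<or> S1 \<subseteq> F b \<inter> C1 \<and> S2 \<subseteq> F a \<inter> C2"
      using two C(3,4) by blast
    have "C1 \<in> regions" "C2 \<in> regions" "F a \<in> regions" "F b \<in> regions"
      using C(2) sides_subset[of e] F mem by blast+
    note reg = this
    have uniq: "C = D" if "C \<in> regions" "D \<in> regions" "X \<subseteq> C \<inter> D" "X \<noteq> {}" for C D X
      using components_nonoverlap[OF that(1,2)] that(3,4) by blast
    have "C1 = F a \<and> C2 = F b \<or> C1 = F b \<and> C2 = F a"
      using sub uniq[OF reg(3,1) _ ne(3)] uniq[OF reg(4,1) _ ne(3)]
        uniq[OF reg(3,2) _ ne(4)] uniq[OF reg(4,2) _ ne(4)] by metis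
    then show ?thesis
      using C(1,2) by auto
  qed
  show ?thesis
  proof (rule that[OF F])
    show "inj_on F ?E"
    proof (rule inj_onI, rule ccontr)
      fix a b assume ab: "a \<in> ?E" "b \<in> ?E" "F a = F b" "a \<noteq> b"
      obtain c d where cd: "?E = {a, c, d}" "a \<noteq> c" "a \<noteq> d" "c \<noteq> d"
        using edges_at_third[OF v ab(1)] .
      have "b = c \<or> b = d" using ab cd by auto
      then show False
        using key[of d a c] key[of c a d] cd ab(3) by (auto simp: insert_commute)
    qed
    show "\<forall>e\<in>?E. sides e = F ` (?E - {e})"
    proof
      fix e assume "e \<in> ?E"
      then obtain a b where ab: "?E = {e, a, b}" "e \<noteq> a" "e \<noteq> b" "a \<noteq> b"
        using edges_at_third[OF v] by metis
      then have "?E - {e} = {a, b}" by auto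
      then show "sides e = F ` (?E - {e})"
        using key[OF ab] by simp
    qed
  qed
qed

text \<open>The last piece of the thread is connected and stays off the graph, so it lies in a
  single sector \<open>S k\<close>. In every small disc the component containing it is exactly that
  sector, whose closure contains the nearby points of the edges at \<open>v\<close> other than
  \<open>k\<close> and misses those of \<open>k\<close> except \<open>v\<close>. This turns the
  adjacency condition into a combinatorial one.\<close>

lemma thread_sector:
  assumes v: "v \<in> verts G" and sec: "vertex_sectors v R S"
    and F: "\<forall>e\<in>edges_at G v. F e \<in> regions \<and> S e \<inter> ball v R \<subseteq> F e"
    and p: "arc p" "pathfinish p = v" and D: "D \<in> regions" "arc_interior p \<subseteq> D"
  obtains k where "k \<in> edges_at G v" "F k = D"
    "\<forall>e\<in>edges_at G v. adjacent_to_thread G p e \<longleftrightarrow> e \<noteq> k"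
proof -
  let ?E = "edges_at G v"
  note sD = vertex_sectorsD[OF sec]
  note R = sD(1)
  have p1: "p 1 = v" using p(2) by (simp add: pathfinish_def)
  have int: "p s \<in> D" if "0 < s" "s < 1" for s
  proof -
    have "p s \<in> arc_interior p"
      using that simple_path_endless[OF arc_imp_simple_path[OF p(1)]] by (auto simp: arc_interior_def)
    then show ?thesis using D(2) by blast
  qed
  have lim: "(p \<longlongrightarrow> v) (at_left 1)"
    using p(1) p1 continuous_on_Icc_at_leftD[of 0 1 p] by (auto simp: arc_def path_def)
  have close: "\<forall>\<^sub>F s in at_left 1. p s \<in> ball v r" if "0 < r" for r
    using tendstoD[OF lim that] by (simp add: dist_commute)
  have "\<forall>\<^sub>F s in at_left 1. 0 < s \<and> p s \<in> ball v R"
    using close[OF R] eventually_at_left_real[of 0 1] by (auto elim: eventually_elim2)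
  then obtain b where b: "b < 1" "\<And>s. b < s \<Longrightarrow> s < 1 \<Longrightarrow> 0 < s \<and> p s \<in> ball v R"
    unfolding eventually_at_left_field by blast
  define N where "N = p ` {b<..<1}"
  have Dpts: "D \<subseteq> - points G"
    using in_components_subset[OF D(1)] .
  have cover: "ball v R - points G = (\<Union>e\<in>?E. S e) \<inter> ball v R"
    by (rule sD(6)[OF R order.refl])
  have N: "N \<subseteq> D \<inter> ball v R" "N \<subseteq> (\<Union>e\<in>?E. S e)"
  proof -
    show *: "N \<subseteq> D \<inter> ball v R"
      using b(2) int unfolding N_def by auto
    show "N \<subseteq> (\<Union>e\<in>?E. S e)"
      using * Dpts cover by blast
  qed
  have "connected N"
    unfolding N_def using p(1) b(2)
    by (intro connected_continuous_image) (force simp: arc_def path_def elim!: continuous_on_subset)+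
  have "N \<noteq> {}" using b(1) by (auto simp: N_def)
  then obtain k where k: "k \<in> ?E" "N \<inter> S k \<noteq> {}"
    using N(2) by blast
  have only: "X \<subseteq> S k" if X: "connected X" "X \<subseteq> (\<Union>e\<in>?E. S e)" "X \<inter> S k \<noteq> {}" for X
  proof -
    have "X \<subseteq> S k \<or> X \<subseteq> (\<Union>e\<in>?E - {k}. S e)"
    proof (rule connected_subset_Un_cases[OF X(1)])
      show "X \<subseteq> S k \<union> (\<Union>e\<in>?E - {k}. S e)" using X(2) by blast
      show "S k \<inter> (\<Union>e\<in>?E - {k}. S e) = {}" using sD(4)[OF k(1)] by fast
    qed (use sD(3) k in auto)
    moreover have "S k \<inter> (\<Union>e\<in>?E - {k}. S e) = {}" using sD(4)[OF k(1)] by fast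
    ultimately show ?thesis using X(3) by blast
  qed
  have Nk: "N \<subseteq> S k"
    using only[OF \<open>connected N\<close> N(2) k(2)] .
  have "F k = D"
  proof -
    have "N \<subseteq> F k \<inter> D"
      using Nk N(1) F k(1) by blast
    then show ?thesis
      using components_nonoverlap[of "F k" "- points G" D] F k(1) D(1) \<open>N \<noteq> {}\<close> by blast
  qed
  moreover have "adjacent_to_thread G p e \<longleftrightarrow> e \<noteq> k" if e: "e \<in> ?E" for e
  proof -
    define Q where "Q r s \<longleftrightarrow> eimg e \<inter> (ball v r - {v}) \<inter>
         closure (connected_component_set (ball v r - points G) (p s)) \<noteq> {}" for r s
    have Q: "\<forall>\<^sub>F s in at_left 1. Q r s \<longleftrightarrow> e \<noteq> k" if r: "0 < r" "r \<le> R" for r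
    proof -
      have "\<forall>\<^sub>F s in at_left 1. b < s \<and> s < 1"
        using eventually_at_left_real[OF b(1)] by (auto elim: eventually_mono)
      with close[OF r(1)] show ?thesis
      proof eventually_elim
        case (elim s)
        then have "p s \<in> N" by (auto simp: N_def)
        then have ps: "p s \<in> S k \<inter> ball v r" using Nk elim(1) by blast
        have cov: "ball v r - points G = (\<Union>e\<in>?E. S e) \<inter> ball v r"
          by (rule sD(6)[OF r])
        have "connected_component_set (ball v r - points G) (p s) = S k \<inter> ball v r"
        proof
          show "S k \<inter> ball v r \<subseteq> connected_component_set (ball v r - points G) (p s)"
            using ps sD(5)[OF r k(1)] cov k(1) by (intro connected_component_maximal) auto
          have sub: "connected_component_set (ball v r - points G) (p s) \<subseteq> (\<Union>e\<in>?E. S e) \<inter> ball v r"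
            using connected_component_subset unfolding cov by blast
          have "p s \<in> connected_component_set (ball v r - points G) (p s)"
            using ps cov k(1) by auto
          then show "connected_component_set (ball v r - points G) (p s) \<subseteq> S k \<inter> ball v r"
            using only[OF connected_connected_component[of "ball v r - points G" "p s"]] sub ps by blast
        qed
        then have Qeq: "Q r s \<longleftrightarrow> (eimg e \<inter> ball v r - {v}) \<inter> closure (S k \<inter> ball v r) \<noteq> {}"
          unfolding Q_def by (simp add: Int_Diff)
        show ?case
        proof (cases "e = k")
          case True
          have "closure (S k \<inter> ball v r) \<subseteq> closure (S k)" by (intro closure_mono) auto
          then show ?thesis
            unfolding Qeq using sD(8)[OF r k(1)] True by blast
        next
          case False
          then show ?thesis
            unfolding Qeq using sD(7)[OF r e k(1) False] sD(9)[OF r e] by blast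
        qed
      qed
    qed
    \<comment> \<open>Nontrivial filters allow a constant proposition to be extracted from
      \<open>eventually\<close>.\<close>
    have nt: "at_left (1::real) \<noteq> bot" "at_right (0::real) \<noteq> bot" by simp_all
    have adj: "adjacent_to_thread G p e \<longleftrightarrow> (\<forall>\<^sub>F r in at_right 0. \<forall>\<^sub>F s in at_left 1. Q r s)"
      unfolding adjacent_to_thread_def Let_def p(2) Q_def using e by simp
    have evR: "\<forall>\<^sub>F r in at_right 0. 0 < r \<and> r \<le> R"
      using R by (auto simp: eventually_at_right_field)
    have "\<forall>\<^sub>F r in at_right 0. (\<forall>\<^sub>F s in at_left 1. Q r s) \<longleftrightarrow> e \<noteq> k"
      using evR
    proof eventually_elim
      case (elim r)
      then have "(\<forall>\<^sub>F s in at_left 1. Q r s) \<longleftrightarrow> (\<forall>\<^sub>F s in at_left (1::real). e \<noteq> k)"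
        using Q[of r] by (intro eventually_subst) auto
      then show ?case
        using nt by simp
    qed
    then have "(\<forall>\<^sub>F r in at_right 0. \<forall>\<^sub>F s in at_left 1. Q r s) \<longleftrightarrow> (\<forall>\<^sub>F r in at_right (0::real). e \<noteq> k)"
      by (rule eventually_subst)
    then show ?thesis
      unfolding adj using nt by simp
  qed
  ultimately show ?thesis
    using k(1) that by blast
qed

end


section \<open>Unimodularity of the complement of a basis\<close>

lemma walk_append: "walk ends u (xs @ ys) v \<longleftrightarrow> (\<exists>w. walk ends u xs w \<and> walk ends w ys v)"
  by (induction xs arbitrary: u) auto

lemma walk_rev: "walk ends u es v \<Longrightarrow> walk ends v (rev es) u"
proof (induction es arbitrary: u)
  case (Cons e es)
  then obtain w where w: "ends e = {u, w}" "walk ends v (rev es) w"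
    by auto
  moreover have "ends e = {w, u}"
    using w(1) by auto
  ultimately show ?case
    by (auto simp: walk_append)
qed simp

text \<open>Shorten at a repeated edge. If both passages start at the same end, the part between is
  cut out and one copy is kept; otherwise the second passage returns to where the first began, and
  both copies go.\<close>

lemma walk_to_trail:
  assumes "walk ends u es v"
  shows "\<exists>es'. distinct es' \<and> set es' \<subseteq> set es \<and> walk ends u es' v"
  using assms
proof (induction "length es" arbitrary: es rule: less_induct)
  case less
  show ?case
  proof (cases "distinct es")
    case True
    then show ?thesis using less.prems by blast
  next
    case False
    then obtain xs ys zs e where es: "es = xs @ [e] @ ys @ [e] @ zs"
      using not_distinct_decomp by blast
    obtain p q p' q' where w: "walk ends u xs p" "ends e = {p, q}" "walk ends q ys p'" "ends e = {p', q'}" "walk ends q' zs v"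
      using less.prems unfolding es by (auto simp: walk_append)
    have "\<exists>es'. length es' < length es \<and> set es' \<subseteq> set es \<and> walk ends u es' v"
    proof (cases "p = p'")
      case True
      then show ?thesis
        using w by (intro exI[of _ "xs @ [e] @ zs"]) (auto simp: walk_append es)
    next
      case False
      then have "q' = p"
        using w(2,4) by (auto simp: doubleton_eq_iff)
      then show ?thesis
        using w by (intro exI[of _ "xs @ zs"]) (auto simp: walk_append es)
    qed
    then show ?thesis
      using less.hyps by (meson order.trans)
  qed
qed

text \<open>Split off from \<open>graph_tree\<close> because forests, unlike trees, are preserved
  when edges are removed, as the induction on the complement of a forest requires.\<close>

definition acyclic_edges :: "('e \<Rightarrow> 'v set) \<Rightarrow> 'e set \<Rightarrow> bool" where
  "acyclic_edges ends A \<longleftrightarrow> \<not> (\<exists>u es. es \<noteq> [] \<and> distinct es \<and> set es \<subseteq> A \<and> walk ends u es u)"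

lemma acyclic_edges_mono: "acyclic_edges ends A \<Longrightarrow> B \<subseteq> A \<Longrightarrow> acyclic_edges ends B"
  unfolding acyclic_edges_def by blast

definition reachable :: "('e \<Rightarrow> 'v set) \<Rightarrow> 'e set \<Rightarrow> 'v \<Rightarrow> 'v \<Rightarrow> bool" where
  "reachable ends A u v \<longleftrightarrow> (\<exists>es. set es \<subseteq> A \<and> walk ends u es v)"

lemma reachable_refl: "reachable ends A u u"
  unfolding reachable_def by (intro exI[of _ "[]"]) simp

lemma reachable_sym: "reachable ends A u v \<Longrightarrow> reachable ends A v u"
  unfolding reachable_def using walk_rev by (metis set_rev)

lemma reachable_trans: "reachable ends A u v \<Longrightarrow> reachable ends A v w \<Longrightarrow> reachable ends A u w"
  unfolding reachable_def by (metis set_append walk_append Un_least)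

lemma reachable_edge: "e \<in> A \<Longrightarrow> ends e = {u, v} \<Longrightarrow> reachable ends A u v"
  unfolding reachable_def by (intro exI[of _ "[e]"]) auto

text \<open>A trail between the ends of \<open>e\<close> that avoids \<open>e\<close> would be
  closed up by \<open>e\<close>.\<close>

lemma acyclic_edges_not_reachable:
  assumes "acyclic_edges ends (insert e A)" "e \<notin> A" "ends e = {u, v}"
  shows "\<not> reachable ends A u v"
proof
  assume "reachable ends A u v"
  then obtain es where "set es \<subseteq> A" "distinct es" "walk ends u es v"
    unfolding reachable_def using walk_to_trail by (metis order.trans)
  moreover have "ends e = {v, u}"
    using assms(3) by auto
  ultimately have "distinct (e # es)" "set (e # es) \<subseteq> insert e A" "walk ends v (e # es) v"
    using assms(2) by auto
  then show False
    using assms(1) unfolding acyclic_edges_def by blast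
qed

context cubic_graph
begin

lemma edge_ends_pair:
  obtains u w where "edge_ends G e = {u, w}" "u \<noteq> w" "u \<in> verts G" "w \<in> verts G"
proof (rule that[of "pathstart (edge G e)" "pathfinish (edge G e)"])
  show "pathstart (edge G e) \<noteq> pathfinish (edge G e)"
    using arc_distinct_ends[OF arc_edge[of e]] by metis
  show "pathstart (edge G e) \<in> verts G" "pathfinish (edge G e) \<in> verts G"
    using cubicD(4)[of e] by (auto simp: edge_ends_def)
qed (simp add: edge_ends_def)

lemma edge_ends_other:
  assumes "x \<in> edge_ends G e" "y \<in> edge_ends G e" "x \<noteq> y"
  shows "edge_ends G e = {x, y}"
proof -
  obtain u w where "edge_ends G e = {u, w}" "u \<noteq> w" "u \<in> verts G" "w \<in> verts G"
    by (rule edge_ends_pair)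
  then show ?thesis
    using assms by auto
qed

lemma common_point_vertex:
  assumes "x \<in> eimg e" "x \<in> eimg e'" "e \<noteq> e'"
  shows "x \<in> edge_ends G e" "x \<in> edge_ends G e'"
  using cubicD(5)[OF assms(3)] cubicD(3)[of e] cubicD(3)[of e'] assms by blast+

text \<open>A forest does not separate the plane: cut it at an edge and apply Janiszewski's theorem twice.\<close>

lemma connected_forest_complement:
  assumes "acyclic_edges (edge_ends G) A"
  shows "connected (- (\<Union>e\<in>A. eimg e))"
  using assms
proof (induction "card A" arbitrary: A rule: less_induct)
  case less
  show ?case
  proof (cases "A = {}")
    case False
    then obtain e where e: "e \<in> A" by blast
    define B where "B = A - {e}"
    have A: "A = insert e B" "e \<notin> B"
      using e by (auto simp: B_def)
    obtain u w where uw: "edge_ends G e = {u, w}" "u \<noteq> w" "u \<in> verts G" "w \<in> verts G"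
      by (rule edge_ends_pair)
    \<comment> \<open>\<open>C\<close> holds the edges of the component of \<open>u\<close> after
      cutting \<open>e\<close>, and \<open>D\<close> all other remaining edges. By acyclicity
      \<open>w\<close> is not in that component, so \<open>C\<close> meets \<open>e\<close> at most
      in \<open>u\<close>, and \<open>D\<close> meets the union of both at most in
      \<open>w\<close>.\<close>
    define C where "C = {e' \<in> B. \<exists>x\<in>edge_ends G e'. reachable (edge_ends G) B u x}"
    define D where "D = B - C"
    have C_ends: "reachable (edge_ends G) B u y" if e'C: "e' \<in> C" and y: "y \<in> edge_ends G e'" for e' y
    proof -
      obtain x where x: "x \<in> edge_ends G e'" "reachable (edge_ends G) B u x" and e': "e' \<in> B"
        using e'C by (auto simp: C_def)
      show ?thesis
      proof (cases "x = y")
        case False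
        then have "reachable (edge_ends G) B x y"
          using edge_ends_other[OF x(1) y] e' by (intro reachable_edge[of e'])
        then show ?thesis
          using x(2) reachable_trans by metis
      qed (use x in simp)
    qed
    have nr: "\<not> reachable (edge_ends G) B u w"
      using acyclic_edges_not_reachable[of "edge_ends G" e B u w] less.prems A uw(1) by simp
    have "card B < card A"
      using A by (simp add: A(1))
    moreover have "card C \<le> card B" "card D \<le> card B"
      by (auto simp: C_def D_def intro!: card_mono)
    moreover have "C \<subseteq> A" "D \<subseteq> A"
      by (auto simp: C_def D_def B_def)
    ultimately have conn: "connected (- (\<Union>e\<in>C. eimg e))" "connected (- (\<Union>e\<in>D. eimg e))"
      using less.hyps[of C] less.hyps[of D] acyclic_edges_mono[OF less.prems] by auto
    have comp: "compact (\<Union>e\<in>X. eimg e)" for X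
      by (intro compact_UN finite compact_arc_image arc_edge)
    have Ce: "(\<Union>e\<in>C. eimg e) \<inter> eimg e \<subseteq> {u}"
    proof
      fix x assume "x \<in> (\<Union>e\<in>C. eimg e) \<inter> eimg e"
      then obtain e' where e': "e' \<in> C" "x \<in> eimg e'" "x \<in> eimg e" by blast
      then have "e' \<noteq> e" using A by (auto simp: C_def)
      then have "x \<in> edge_ends G e'" "x \<in> {u, w}"
        using common_point_vertex[OF e'(2,3)] uw(1) by auto
      then show "x \<in> {u}"
        using C_ends[OF e'(1)] nr by auto
    qed
    have D_meet: "((\<Union>e\<in>C. eimg e) \<union> eimg e) \<inter> (\<Union>e\<in>D. eimg e) \<subseteq> {w}"
    proof
      fix x assume x: "x \<in> ((\<Union>e\<in>C. eimg e) \<union> eimg e) \<inter> (\<Union>e\<in>D. eimg e)"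
      then obtain d where d: "d \<in> D" "x \<in> eimg d" by blast
      have no: "\<not> reachable (edge_ends G) B u x" if "x \<in> edge_ends G d"
        using d(1) that by (auto simp: C_def D_def)
      from x consider c where "c \<in> C" "x \<in> eimg c" | "x \<in> eimg e" by blast
      then show "x \<in> {w}"
      proof cases
        case 1
        then have "c \<noteq> d" using d(1) by (auto simp: D_def)
        from common_point_vertex[OF 1(2) d(2) this] show ?thesis
          using no C_ends[OF 1(1)] by blast
      next
        case 2
        have "e \<noteq> d" using d(1) A by (auto simp: D_def)
        from common_point_vertex[OF 2 d(2) this] show ?thesis
          using no uw(1) reachable_refl by fastforce
      qed
    qed
    \<comment> \<open>Janiszewski's theorem asks for a connected intersection; an empty one is
      connected as well.\<close>
    have sing: "connected X" if "X \<subseteq> {x}" for X and x :: complex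
      using that by (metis connected_empty connected_sing subset_singletonD)
    have closed_e: "closed (eimg e)"
      by (intro compact_imp_closed compact_arc_image arc_edge)
    have "connected (- ((\<Union>e\<in>C. eimg e) \<union> eimg e))"
      by (rule Janiszewski_connected[OF comp closed_e sing[OF Ce] conn(1) connected_arc_complement[OF arc_edge]]) simp
    then have "connected (- (((\<Union>e\<in>C. eimg e) \<union> eimg e) \<union> (\<Union>e\<in>D. eimg e)))"
      by (rule Janiszewski_connected[OF compact_Un[OF comp compact_arc_image[OF arc_edge]]
            compact_imp_closed[OF comp] sing[OF D_meet] _ conn(2)])
    moreover have "((\<Union>e\<in>C. eimg e) \<union> eimg e) \<union> (\<Union>e\<in>D. eimg e) = (\<Union>e\<in>A. eimg e)"
      unfolding A(1) by (auto simp: C_def D_def)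
    ultimately show ?thesis by simp
  qed (simp add: connected_UNIV)
qed

text \<open>The complement of the forest, minus the vertices, is connected. It is covered by two
  disjoint open sets, obtained by gluing the regions in \<open>K\<close>, and likewise those outside
  \<open>K\<close>, along the edges not in \<open>T\<close>; the closure condition on
  \<open>K\<close> assigns each such edge to one of the two.\<close>

lemma dual_connected:
  assumes T: "acyclic_edges (edge_ends G) T"
    and K: "K \<subseteq> regions" "K \<noteq> {}" "\<And>e. e \<notin> T \<Longrightarrow> sides e \<inter> K \<noteq> {} \<Longrightarrow> sides e \<subseteq> K"
  shows "K = regions"
proof -
  define \<Omega> where "\<Omega> = - (\<Union>e\<in>T. eimg e) - verts G"
  have "closed (\<Union>e\<in>T. eimg e)"
    by (intro closed_UN finite ballI compact_imp_closed compact_arc_image arc_edge)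
  \<comment> \<open>Removing finitely many points does not disconnect a connected open set in the
    plane.\<close>
  then have con: "connected \<Omega>"
    unfolding \<Omega>_def
    by (intro connected_open_diff_countable connected_forest_complement[OF T] countable_finite cubicD(1) open_Compl)
       auto
  define U where "U M = \<Union>M \<union> (\<Union>e\<in>{e. e \<notin> T \<and> sides e \<subseteq> M}. eimg e - verts G)" for M
  have U_open: "open (U M)" if "M \<subseteq> regions" for M
    unfolding open_contains_ball
  proof
    fix x assume "x \<in> U M"
    then consider D where "D \<in> M" "x \<in> D" | e where "e \<notin> T" "sides e \<subseteq> M" "x \<in> eimg e - verts G"
      unfolding U_def by blast
    then show "\<exists>\<epsilon>>0. ball x \<epsilon> \<subseteq> U M"
    proof cases
      case 1
      then obtain \<epsilon> where "\<epsilon> > 0" "ball x \<epsilon> \<subseteq> D"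
        using open_regions[of D] \<open>M \<subseteq> regions\<close> unfolding open_contains_ball by blast
      then show ?thesis
        using 1(1) unfolding U_def by blast
    next
      case 2
      obtain r S1 S2 where loc: "local_sides e x r S1 S2"
        using local_sides_exist[OF 2(3) zero_less_one] .
      obtain C1 C2 where C: "C1 \<noteq> C2" "sides e = {C1, C2}" "S1 \<subseteq> C1" "S2 \<subseteq> C2"
        "\<forall>D\<in>regions. x \<in> closure D \<longrightarrow> D \<in> sides e"
        by (rule sides_local[OF loc 2(3)])
      have "ball x r \<subseteq> S1 \<union> S2 \<union> (eimg e - verts G)"
      proof -
        have "verts G \<inter> ball x r = {}"
          using local_sidesD(10)[OF loc] by (auto simp: subpoints_def)
        then show ?thesis
          unfolding local_sidesD(7)[OF loc, symmetric] by blast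
      qed
      moreover have "S1 \<union> S2 \<subseteq> \<Union>M"
      proof -
        have "C1 \<in> M" "C2 \<in> M"
          using 2(2) unfolding C(2) by simp_all
        then show ?thesis
          using C(3,4) by blast
      qed
      moreover have "eimg e - verts G \<subseteq> U M"
        using 2(1,2) unfolding U_def by blast
      ultimately show ?thesis
        using local_sidesD(1)[OF loc] unfolding U_def by blast
    qed
  qed
  have cover: "\<Omega> \<subseteq> U K \<union> U (regions - K)"
  proof
    fix x assume x: "x \<in> \<Omega>"
    show "x \<in> U K \<union> U (regions - K)"
    proof (cases "x \<in> points G")
      case True
      then obtain e where e: "x \<in> eimg e - verts G" "e \<notin> T"
        using x unfolding \<Omega>_def points_def by blast
      have "sides e \<subseteq> K \<or> sides e \<subseteq> regions - K"
        using K(3)[OF e(2)] sides_subset[of e] by blast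
      then show ?thesis
        using e unfolding U_def by blast
    next
      case False
      then have "x \<in> \<Union>regions"
        by (simp add: Union_components)
      then show ?thesis
        unfolding U_def by blast
    qed
  qed
  have disj: "U K \<inter> U (regions - K) = {}"
  proof (rule ccontr)
    assume "\<not> ?thesis"
    then obtain x where x: "x \<in> U K" "x \<in> U (regions - K)" by blast
    have reg: "x \<notin> points G" if "x \<in> D" "D \<in> regions" for D
      using in_components_subset[OF that(2)] that(1) by blast
    have edg: "x \<in> points G" if "x \<in> eimg e - verts G" for e
      using that unfolding points_def by blast
    show False
    proof (cases "x \<in> points G")
      case False
      then obtain D D' where "D \<in> K" "D' \<in> regions - K" "x \<in> D" "x \<in> D'"
        using x edg unfolding U_def by blast
      then show False
        using components_nonoverlap[of D "- points G" D'] K(1) by blast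
    next
      case True
      then have "x \<notin> \<Union>K" "x \<notin> \<Union>(regions - K)"
        using reg K(1) by blast+
      then obtain e e' where e: "sides e \<subseteq> K" "x \<in> eimg e - verts G"
        "sides e' \<subseteq> regions - K" "x \<in> eimg e' - verts G"
        using x unfolding U_def by blast
      have "e = e'"
        using cubicD(5)[of e e'] e by blast
      moreover have "sides e \<noteq> {}"
        using card_sides[of e] by auto
      ultimately show False
        using e(1,3) by blast
    qed
  qed
  have two: "\<Omega> \<subseteq> U K \<or> \<Omega> \<subseteq> U (regions - K)"
    by (rule connected_subset_Un_cases[OF con cover U_open U_open disj]) (use K(1) in auto)
  have reg\<Omega>: "D \<subseteq> \<Omega>" if "D \<in> regions" for D
    using in_components_subset[OF that] unfolding \<Omega>_def points_def by blast
  have "\<not> \<Omega> \<subseteq> U (regions - K)"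
  proof
    assume *: "\<Omega> \<subseteq> U (regions - K)"
    obtain D where D: "D \<in> K" using K(2) by blast
    then have DR: "D \<in> regions" using K(1) by blast
    have "D \<subseteq> U K"
      using D unfolding U_def by blast
    moreover have "D \<subseteq> U (regions - K)"
      using reg\<Omega>[OF DR] * by simp
    ultimately have "D = {}"
      using disj by blast
    then show False
      using in_components_nonempty[OF DR] by simp
  qed
  then have "\<Omega> \<subseteq> U K"
    using two by blast
  have "D' \<in> K" if D': "D' \<in> regions" for D'
  proof (rule ccontr)
    assume "D' \<notin> K"
    then have "D' \<subseteq> U (regions - K)"
      using D' unfolding U_def by blast
    moreover have "D' \<subseteq> U K"
      using reg\<Omega>[OF D'] \<open>\<Omega> \<subseteq> U K\<close> by blast
    ultimately show False
      using disj in_components_nonempty[OF D'] by blast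
  qed
  then show ?thesis
    using K(1) by blast
qed

text \<open>Since the ends of \<open>e\<close> are joined in \<open>A\<close>, the two sides of
  \<open>e\<close> belong to different regions of the larger graph, while in the smaller graph a
  disc around a point of \<open>e\<close> merges them. Passing to the containing region is therefore
  onto but not injective.\<close>

lemma region_count_step:
  assumes A: "e \<notin> A" "edge_ends G e = {u, w}" "reachable (edge_ends G) A u w"
    and fin: "finite (components (- subpoints (insert e A)))"
  shows "finite (components (- subpoints A)) \<and>
    card (components (- subpoints A)) + 1 \<le> card (components (- subpoints (insert e A)))"
proof -
  let ?X = "components (- subpoints (insert e A))" and ?Y = "components (- subpoints A)"
  obtain es where es: "walk (edge_ends G) u es w" "set es \<subseteq> A"
    using A(3) unfolding reachable_def by blast
  have sub: "subpoints A \<subseteq> subpoints (insert e A)"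
    by (intro subpoints_mono) auto
  have "\<exists>D. D \<in> ?Y \<and> C \<subseteq> D" if "C \<in> ?X" for C
  proof -
    have "C \<subseteq> - subpoints A"
      using in_components_subset[OF that] sub by blast
    from region_superset[OF in_components_connected[OF that] in_components_nonempty[OF that] this]
    show ?thesis by metis
  qed
  then obtain f where f: "\<And>C. C \<in> ?X \<Longrightarrow> f C \<in> ?Y \<and> C \<subseteq> f C"
    by metis
  obtain z where z: "z \<in> eimg e - verts G"
    using edge_interior_nonempty by blast
  obtain r S1 S2 where loc: "local_sides e z r S1 S2"
    using local_sides_exist[OF z zero_less_one] .
  have "?Y \<subseteq> f ` ?X"
  proof
    fix D assume D: "D \<in> ?Y"
    \<comment> \<open>Surjectivity needs a point of \<open>D\<close> off the edge; an open set is
      not contained in an edge, because a local side accumulates at every interior point.\<close>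
    have "\<not> D \<subseteq> eimg e"
    proof
      assume De: "D \<subseteq> eimg e"
      obtain x where x: "x \<in> D" using in_components_nonempty[OF D] by blast
      moreover have "D \<inter> verts G = {}"
        using in_components_subset[OF D] unfolding subpoints_def by blast
      ultimately have xe: "x \<in> eimg e - verts G" using De by blast
      obtain r' S1' S2' where loc': "local_sides e x r' S1' S2'"
        using local_sides_exist[OF xe zero_less_one] .
      have "D \<inter> S1' \<noteq> {}"
        using closure_open_Int[OF _ open_region[OF D] x] local_sides_nonempty(1)[OF loc'] xe by blast
      then show False
        using local_sidesD(7)[OF loc'] De by blast
    qed
    then obtain x where x: "x \<in> D" "x \<notin> eimg e" by blast
    then have "x \<in> - subpoints (insert e A)"
      using in_components_subset[OF D] unfolding subpoints_def by auto
    then obtain C where C: "C \<in> ?X" "x \<in> C"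
      using Union_components[of "- subpoints (insert e A)"] by blast
    then have "f C = D"
      using region_eq[of "f C" A D] f[OF C(1)] D x(1) by blast
    then show "D \<in> f ` ?X" using C(1) by blast
  qed
  then have finY: "finite ?Y" and leY: "card ?Y \<le> card (f ` ?X)"
    using fin by (auto intro: finite_subset card_mono)
  obtain C1 C2 where C: "C1 \<noteq> C2" "C1 \<in> ?X" "C2 \<in> ?X" "S1 \<subseteq> C1" "S2 \<subseteq> C2"
    "\<forall>D\<in>?X. z \<in> closure D \<longrightarrow> D = C1 \<or> D = C2"
    by (rule edge_on_cycle_regions[OF loc z A(1,2) es])
  have "ball z r \<inter> subpoints A = {}"
    using local_sidesD(10)[OF loc] subpoints_mono[of A "UNIV - {e}"] A(1) by blast
  then obtain D where D: "D \<in> ?Y" "ball z r \<subseteq> D"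
    using region_superset[OF connected_ball, of z r A] local_sidesD(1)[OF loc]
    by (metis ball_eq_empty disjoint_eq_subset_Compl linorder_not_less)
  have "S1 \<union> S2 \<subseteq> ball z r"
    using local_sidesD(7)[OF loc] by blast
  then have "f C1 \<inter> D \<noteq> {}" "f C2 \<inter> D \<noteq> {}"
    using f[OF C(2)] f[OF C(3)] C(4,5) D(2) local_sides_nonempty(3,4)[OF loc] z by blast+
  then have "f C1 = f C2"
    using region_eq[of "f C1" A D] region_eq[of "f C2" A D] f[OF C(2)] f[OF C(3)] D(1) by simp
  then have "\<not> inj_on f ?X"
    using C(1-3) inj_onD by metis
  then have "card (f ` ?X) < card ?X"
    using card_image_le[OF fin, of f] eq_card_imp_inj_on[OF fin, of f] by linarith
  then show ?thesis
    using finY leY by simp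
qed

text \<open>The previous step iterated from the full graph down to \<open>A\<close>: the half of
  Euler's formula that bounds the number of edges outside a connected spanning subgraph.\<close>

lemma region_count:
  assumes conn: "\<And>u w. u \<in> verts G \<Longrightarrow> w \<in> verts G \<Longrightarrow> reachable (edge_ends G) A0 u w"
    and fin: "finite regions"
  shows "A0 \<subseteq> A \<Longrightarrow> finite (components (- subpoints A)) \<and>
    card (components (- subpoints A)) + card (UNIV - A) \<le> card regions"
proof (induction "card (UNIV - A)" arbitrary: A)
  case 0
  then have "A = UNIV" by auto
  then show ?case
    using fin by (simp add: points_eq)
next
  case (Suc n)
  then obtain e where e: "e \<notin> A"
    by (metis Diff_eq_empty_iff UNIV_I card.empty nat.distinct(1) subsetI)
  obtain u w where uw: "edge_ends G e = {u, w}" "u \<noteq> w" "u \<in> verts G" "w \<in> verts G"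
    by (rule edge_ends_pair[of e])
  have "UNIV - A = insert e (UNIV - insert e A)" using e by auto
  then have c: "card (UNIV - A) = Suc (card (UNIV - insert e A))"
    by (metis DiffD2 card_insert_disjoint finite insertI1)
  then have IH: "finite (components (- subpoints (insert e A))) \<and>
      card (components (- subpoints (insert e A))) + card (UNIV - insert e A) \<le> card regions"
    using Suc by (intro Suc.hyps(1)) auto
  have "reachable (edge_ends G) A u w"
    using conn[OF uw(3,4)] Suc.prems unfolding reachable_def by blast
  from region_count_step[OF e uw(1) this] IH show ?case
    using c by linarith
qed

subsection \<open>The exterior region\<close>

lemma bounded_points: "bounded (points G)"
  unfolding points_eq by (intro compact_imp_bounded compact_subpoints)

text \<open>\<open>exterior_face\<close> is defined as a union, but the complement of a bounded set
  in the plane has just one unbounded component.\<close>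

lemma exterior_exists:
  shows "exterior_face G \<in> regions" "\<not> bounded (exterior_face G)"
    "\<And>D. D \<in> regions \<Longrightarrow> \<not> bounded D \<Longrightarrow> D = exterior_face G"
proof -
  obtain x where x: "x \<in> - points G" "\<not> bounded (connected_component_set (- points G) x)"
    using cobounded_unbounded_component[of "- points G"] bounded_points by auto
  define D where "D = connected_component_set (- points G) x"
  have D: "D \<in> regions" "\<not> bounded D"
    using x by (auto simp: D_def components_def)
  have uniq: "D' = D" if "D' \<in> regions" "\<not> bounded D'" for D'
    using cobounded_unique_unbounded_components[of "- points G" D' D] bounded_points that D by simp
  have "{C \<in> regions. \<not> bounded C} = {D}"
    using D uniq by blast
  then have eq: "exterior_face G = D"
    by (simp add: exterior_face_def)
  show "exterior_face G \<in> regions" "\<not> bounded (exterior_face G)"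
    unfolding eq by (rule D)+
  show "D' = exterior_face G" if "D' \<in> regions" "\<not> bounded D'" for D'
    unfolding eq by (rule uniq[OF that])
qed

lemma exterior_contains:
  assumes "connected H" "\<not> bounded H" "H \<inter> points G = {}"
  shows "H \<subseteq> exterior_face G"
proof -
  obtain D where D: "D \<in> regions" "H \<subseteq> D"
    using region_superset[of H UNIV] assms unfolding points_eq by (metis bounded_empty disjoint_eq_subset_Compl)
  then have "\<not> bounded D"
    using assms(2) bounded_subset by blast
  then show ?thesis
    using exterior_exists(3)[OF D(1)] D(2) by simp
qed

lemma unbounded_halfplane:
  fixes c :: complex
  assumes "c \<noteq> 0"
  shows "\<not> bounded {z. 1 \<le> c \<bullet> z}"
proof
  assume "bounded {z. 1 \<le> c \<bullet> z}"
  then obtain b where b: "\<And>z. 1 \<le> c \<bullet> z \<Longrightarrow> norm z \<le> b"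
    unfolding bounded_iff by blast
  \<comment> \<open>The first term puts \<open>s *\<^sub>R c\<close> into the half-plane, the second
    makes its norm exceed \<open>b\<close>.\<close>
  define s where "s = max (1 / (c \<bullet> c)) ((b + 1) / norm c)"
  have cc: "c \<bullet> c > 0" "norm c > 0"
    using assms by simp_all
  have "1 \<le> s * (c \<bullet> c)"
    using cc by (simp add: s_def max_def field_simps)
  then have "norm (s *\<^sub>R c) \<le> b"
    by (intro b) simp
  moreover have "b + 1 \<le> s * norm c"
    using cc by (simp add: s_def max_def field_simps)
  moreover have "s * norm c \<le> norm (s *\<^sub>R c)"
    by (simp add: mult_right_mono)
  ultimately show False by simp
qed

text \<open>Each of the four half-planes beyond a side of the square is connected, unbounded and
  disjoint from the graph. This locates the ends of tines and the starting points of exterior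
  threads.\<close>

lemma outside_square_exterior:
  assumes "1 \<le> \<bar>Re z\<bar> \<or> 1 \<le> \<bar>Im z\<bar>"
  shows "z \<in> exterior_face G"
proof -
  have *: "z \<in> exterior_face G" if "c \<in> {1, - 1, \<i>, - \<i>}" "1 \<le> c \<bullet> z" for c
  proof -
    have "connected {z. 1 \<le> c \<bullet> z}"
      using convex_connected[OF convex_halfspace_ge[of 1 c]] by simp
    moreover have "{z. 1 \<le> c \<bullet> z} \<inter> points G = {}"
      using cubicD(6) that(1) by (auto simp: inner_complex_def)
    moreover have "\<not> bounded {z. 1 \<le> c \<bullet> z}"
      using that(1) by (intro unbounded_halfplane) auto
    ultimately show ?thesis
      using exterior_contains that(2) by blast
  qed
  have "\<exists>c\<in>{1, - 1, \<i>, - \<i>}. 1 \<le> c \<bullet> z"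
    using assms by (auto simp: inner_complex_def)
  then show ?thesis
    using * by blast
qed

section \<open>The regions as bounded faces and the exterior\<close>

lemma face_regions: "face G j \<in> regions" "bounded (face G j)"
  using cubicD(10) by (auto simp: bij_betw_def)

lemma face_inj: "face G i = face G j \<longleftrightarrow> i = j"
  using cubicD(10) by (auto simp: bij_betw_def inj_on_def)

lemma face_not_exterior: "face G j \<noteq> exterior_face G"
  using face_regions(2) exterior_exists(2) by metis

lemma regions_eq: "regions = insert (exterior_face G) (range (face G))"
proof -
  have "range (face G) = {C \<in> regions. bounded C}"
    using cubicD(10) by (simp add: bij_betw_def)
  then show ?thesis
    using exterior_exists(1,3) by blast
qed

lemma finite_regions: "finite regions"
  unfolding regions_eq by simp

lemma card_regions: "card regions = CARD('f) + 1"
proof -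
  have "card (range (face G)) = CARD('f)"
    by (rule card_image) (simp add: inj_on_def face_inj)
  moreover have "exterior_face G \<notin> range (face G)"
    using face_not_exterior by (metis rangeE)
  ultimately show ?thesis
    unfolding regions_eq by simp
qed

lemma edge_on_face_iff: "edge_on_face G e j \<longleftrightarrow> face G j \<in> sides e"
  using face_regions by (simp add: edge_on_face_def sides_def)


subsection \<open>Bases\<close>

definition incidence :: "('e \<Rightarrow> int) \<Rightarrow> complex set \<Rightarrow> int" where
  "incidence m D = (\<Sum>e\<in>UNIV. of_bool (D \<in> sides e) * m e)"

definition realizable :: "'e set \<Rightarrow> (complex set \<Rightarrow> int) \<Rightarrow> bool" where
  "realizable T W \<longleftrightarrow> (\<exists>m. (\<forall>e\<in>T. m e = 0) \<and> (\<forall>D\<in>regions. incidence m D = W D))"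

lemma realizable_combination:
  assumes "realizable T W" "realizable T W'"
  shows "realizable T (\<lambda>D. a * W D + b * W' D)"
proof -
  obtain m m' where m: "\<forall>e\<in>T. m e = 0" "\<forall>D\<in>regions. incidence m D = W D"
    "\<forall>e\<in>T. m' e = 0" "\<forall>D\<in>regions. incidence m' D = W' D"
    using assms unfolding realizable_def by blast
  have "incidence (\<lambda>e. a * m e + b * m' e) D = a * incidence m D + b * incidence m' D" for D
    unfolding incidence_def sum_distrib_left sum.distrib[symmetric]
    by (intro sum.cong) (simp_all add: algebra_simps)
  then show ?thesis
    using m unfolding realizable_def by (intro exI[of _ "\<lambda>e. a * m e + b * m' e"]) simp
qed

lemma realizable_cong: "realizable T W \<Longrightarrow> (\<And>D. D \<in> regions \<Longrightarrow> W D = W' D) \<Longrightarrow> realizable T W'"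
  unfolding realizable_def by fastforce

lemma realizable_0: "realizable T (\<lambda>_. 0)"
  unfolding realizable_def incidence_def by (intro exI[of _ "\<lambda>_. 0"]) simp

lemma realizable_sum:
  assumes "\<And>i. i \<in> I \<Longrightarrow> realizable T (W i)"
  shows "realizable T (\<lambda>D. \<Sum>i\<in>I. c i * W i D)"
  using assms
proof (induction I rule: infinite_finite_induct)
  case (insert x I)
  have "realizable T (\<lambda>D. c x * W x D + 1 * (\<Sum>i\<in>I. c i * W i D))"
    by (intro realizable_combination insert.IH insert.prems) auto
  then show ?case
    using insert.hyps by simp
qed (simp_all add: realizable_0)

lemma realizable_edge:
  assumes "e \<notin> T" "sides e = {A, B}" "A \<noteq> B"
  shows "realizable T (\<lambda>D. of_bool (D = A) + of_bool (D = B))"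
  unfolding realizable_def
proof (intro exI conjI ballI)
  fix D
  have "incidence (\<lambda>x. of_bool (x = e)) D = (\<Sum>x\<in>UNIV. if x = e then of_bool (D \<in> sides e) else 0)"
    unfolding incidence_def by (intro sum.cong) auto
  also have "\<dots> = of_bool (D = A) + of_bool (D = B)"
    using assms(2,3) by auto
  finally show "incidence (\<lambda>x. of_bool (x = e)) D = of_bool (D = A) + of_bool (D = B)" .
qed (use assms(1) in auto)

text \<open>The dual of the complement of \<open>T\<close> is connected and contains the triangle around \<open>v0\<close>.\<close>

lemma even_realizable:
  assumes T: "acyclic_edges (edge_ends G) T" and v0: "v0 \<in> verts G" "edges_at G v0 \<inter> T = {}"
    and W: "even (\<Sum>D\<in>regions. W D)"
  shows "realizable T W"
proof -
  obtain R S where sec: "vertex_sectors v0 R S"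
    using vertex_sectors_exist[OF v0(1)] .
  obtain F where F: "\<forall>e\<in>edges_at G v0. F e \<in> regions \<and> S e \<inter> ball v0 R \<subseteq> F e"
    "inj_on F (edges_at G v0)" "\<forall>e\<in>edges_at G v0. sides e = F ` (edges_at G v0 - {e})"
    by (rule vertex_regions[OF v0(1) sec])
  have "edges_at G v0 \<noteq> {}"
    using cubicD(7)[OF v0(1)] by auto
  then obtain a where "a \<in> edges_at G v0" by blast
  then obtain b c where abc: "edges_at G v0 = {a, b, c}" "a \<noteq> b" "a \<noteq> c" "b \<noteq> c"
    using edges_at_third[OF v0(1)] by metis
  have sd: "sides a = {F b, F c}" "sides b = {F a, F c}" "sides c = {F a, F b}"
    using F(3) abc by auto
  have Fne: "F a \<noteq> F b" "F a \<noteq> F c" "F b \<noteq> F c"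
    using F(2) abc by (auto simp: inj_on_def)
  have nT: "a \<notin> T" "b \<notin> T" "c \<notin> T"
    using v0(2) abc(1) by auto
  define \<delta> where "\<delta> A D = (of_bool (D = A) :: int)" for A D :: "complex set"
  have edge: "realizable T (\<lambda>D. \<delta> A D + \<delta> B D)" if "e \<notin> T" "sides e = {A, B}" "A \<noteq> B" for e A B
    unfolding \<delta>_def by (rule realizable_edge[OF that])
  note r1 = edge[OF nT(1) sd(1) Fne(3)] and r2 = edge[OF nT(2) sd(2) Fne(2)] and r3 = edge[OF nT(3) sd(3) Fne(1)]
  \<comment> \<open>Adding the edges \<open>b\<close> and \<open>c\<close> and subtracting
    \<open>a\<close> cancels the other two regions.\<close>
  have two: "realizable T (\<lambda>D. 2 * \<delta> (F a) D)"
    by (rule realizable_cong[OF realizable_combination[OF realizable_combination[OF r2 r3, of 1 1] r1, of 1 "- 1"]]) simp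
  \<comment> \<open>A sum with the base region, not a difference, propagates across an edge: D' + Fa
    = (D + D') - (D + Fa) + 2 Fa, where regions stand for their unit vectors and Fa for that of
    \<open>F a\<close>.\<close>
  define K where "K = {D \<in> regions. realizable T (\<lambda>D'. \<delta> D D' + \<delta> (F a) D')}"
  have "K = regions"
  proof (rule dual_connected[OF T])
    show "K \<subseteq> regions" by (auto simp: K_def)
    have "F a \<in> K"
      using two F(1) abc(1) by (simp add: K_def)
    then show "K \<noteq> {}" by blast
    fix e assume e: "e \<notin> T" "sides e \<inter> K \<noteq> {}"
    show "sides e \<subseteq> K"
    proof
      fix D' assume D': "D' \<in> sides e"
      obtain D where D: "D \<in> sides e" "D \<in> K" using e(2) by blast
      show "D' \<in> K"
      proof (cases "D = D'")
        case False
        obtain A B where "sides e = {A, B}"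
          using card_sides[of e] by (auto simp: card_2_iff)
        then have "sides e = {D, D'}"
          using D(1) D' False by auto
        from edge[OF e(1) this False]
        have 1: "realizable T (\<lambda>E. \<delta> D E + \<delta> D' E)" .
        have 2: "realizable T (\<lambda>E. \<delta> D E + \<delta> (F a) E)"
          using D(2) by (simp add: K_def)
        have "realizable T (\<lambda>E. \<delta> D' E + \<delta> (F a) E)"
          by (rule realizable_cong[OF realizable_combination[OF realizable_combination[OF 1 2, of 1 "- 1"] two, of 1 1]]) simp
        then show ?thesis
          using D' sides_subset[of e] by (auto simp: K_def)
      qed (use D in simp)
    qed
  qed
  then have all: "realizable T (\<lambda>D'. \<delta> D D' + \<delta> (F a) D')" if "D \<in> regions" for D
    using that unfolding K_def by blast
  define h where "h = (\<Sum>D\<in>regions. W D) div 2"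
  have h: "(\<Sum>D\<in>regions. W D) = 2 * h"
    using W by (simp add: h_def)
  \<comment> \<open>The weighted sum produces \<open>W\<close> plus an excess at the base region
    equal to the total \<open>2 * h\<close> of \<open>W\<close>; the last summand removes
    it.\<close>
  have "realizable T (\<lambda>D'. 1 * (\<Sum>D\<in>regions. W D * (\<delta> D D' + \<delta> (F a) D')) + (- h) * (2 * \<delta> (F a) D'))"
    by (intro realizable_combination realizable_sum all two)
  then show ?thesis
  proof (rule realizable_cong)
    fix D' assume D': "D' \<in> regions"
    have "(\<Sum>D\<in>regions. W D * \<delta> D D') = (\<Sum>D\<in>regions. if D = D' then W D' else 0)"
      by (intro sum.cong) (auto simp: \<delta>_def)
    also have "\<dots> = W D'"
      using D' finite_regions by simp
    finally have 1: "(\<Sum>D\<in>regions. W D * \<delta> D D') = W D'" .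
    have "(\<Sum>D\<in>regions. W D * (\<delta> D D' + \<delta> (F a) D')) = W D' + 2 * h * \<delta> (F a) D'"
      by (simp add: distrib_left sum.distrib 1 h[symmetric] sum_distrib_right)
    then show "1 * (\<Sum>D\<in>regions. W D * (\<delta> D D' + \<delta> (F a) D')) + (- h) * (2 * \<delta> (F a) D') = W D'"
      by simp
  qed
qed

text \<open>Double counting: each edge has exactly two sides.\<close>

lemma sum_incidence: "(\<Sum>D\<in>regions. incidence m D) = 2 * (\<Sum>e\<in>UNIV. m e)"
proof -
  have "(\<Sum>D\<in>regions. incidence m D) = (\<Sum>e\<in>UNIV. \<Sum>D\<in>regions. of_bool (D \<in> sides e) * m e)"
    unfolding incidence_def by (rule sum.swap)
  also have "\<dots> = (\<Sum>e\<in>UNIV. 2 * m e)"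
  proof (rule sum.cong)
    fix e
    have "(\<Sum>D\<in>regions. of_bool (D \<in> sides e) * m e) = (\<Sum>D\<in>sides e. m e)"
      using finite_regions sides_subset[of e] by (intro sum.mono_neutral_cong_right) auto
    then show "(\<Sum>D\<in>regions. of_bool (D \<in> sides e) * m e) = 2 * m e"
      by (simp add: card_sides)
  qed simp
  finally show ?thesis
    by (simp add: sum_distrib_left)
qed

lemma sum_regions: "(\<Sum>D\<in>regions. f D) = f (exterior_face G) + (\<Sum>j\<in>UNIV. f (face G j))"
  for f :: "complex set \<Rightarrow> int"
proof -
  have "exterior_face G \<notin> range (face G)"
    using face_not_exterior by (metis rangeE)
  then have "(\<Sum>D\<in>regions. f D) = f (exterior_face G) + (\<Sum>D\<in>range (face G). f D)"
    unfolding regions_eq by simp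
  also have "(\<Sum>D\<in>range (face G). f D) = (\<Sum>j\<in>UNIV. f (face G j))"
    by (subst sum.reindex) (auto simp: inj_on_def face_inj)
  finally show ?thesis .
qed

lemma incidence_face: "incidence m (face G j) = (\<Sum>e\<in>UNIV. of_bool (edge_on_face G e j) * m e)"
  by (simp add: incidence_def edge_on_face_iff)

lemma basisD:
  assumes "graph_basis G v0 T"
  shows "v0 \<in> verts G" "acyclic_edges (edge_ends G) T" "edges_at G v0 \<inter> T = {}"
    "u \<in> verts G - {v0} \<Longrightarrow> w \<in> verts G - {v0} \<Longrightarrow> reachable (edge_ends G) T u w"
  using assms unfolding graph_basis_def graph_tree_def acyclic_edges_def edges_at_def
    graph_connected_def reachable_def by blast+

text \<open>The exterior is forced to take \<open>2 * c0\<close> minus the sum of the face weights,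
  because incidences add up to twice the total. With this value the parity condition holds for every
  choice of weights.\<close>

lemma basis_weights_surj:
  assumes "graph_basis G v0 T"
  shows "\<exists>m. (\<forall>e\<in>T. m e = 0) \<and> (\<forall>j. (\<Sum>e\<in>UNIV. of_bool (edge_on_face G e j) * m e) = c j) \<and>
    (\<Sum>e\<in>UNIV. m e) = (c0 :: int)"
proof -
  define W where "W D = (if D = exterior_face G then 2 * c0 - (\<Sum>j\<in>UNIV. c j) else c (inv (face G) D))" for D
  have W: "W (exterior_face G) = 2 * c0 - (\<Sum>j\<in>UNIV. c j)" "W (face G j) = c j" for j
    using face_not_exterior[of j] face_inj by (simp_all add: W_def inv_f_f inj_on_def)
  have sumW: "(\<Sum>D\<in>regions. W D) = 2 * c0"
    by (simp add: sum_regions W)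
  then have "even (\<Sum>D\<in>regions. W D)" by simp
  from even_realizable[OF basisD(2,1,3)[OF assms] this]
  obtain m where m: "\<forall>e\<in>T. m e = 0" "\<forall>D\<in>regions. incidence m D = W D"
    unfolding realizable_def by blast
  have "2 * (\<Sum>e\<in>UNIV. m e) = 2 * c0"
    using m(2) sumW unfolding sum_incidence[symmetric] by simp
  moreover have "(\<Sum>e\<in>UNIV. of_bool (edge_on_face G e j) * m e) = c j" for j
    using m(2) face_regions(1)[of j] W(2)[of j] by (simp add: incidence_face[symmetric])
  ultimately show ?thesis
    using m(1) by auto
qed

text \<open>One edge at \<open>v0\<close> turns \<open>T\<close> into a connected spanning subgraph
  \<open>A\<close>. The complement of \<open>A\<close> has at least one region, so the region count
  leaves fewer edges outside \<open>A\<close> than there are regions, and \<open>T\<close> misses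
  one edge more.\<close>

lemma card_basis_complement:
  assumes "graph_basis G v0 T"
  shows "card (UNIV - T) \<le> card regions"
proof -
  note b = basisD[OF assms]
  have "edges_at G v0 \<noteq> {}"
    using cubicD(7)[OF b(1)] by auto
  then obtain e0 where e0: "v0 \<in> edge_ends G e0" "e0 \<notin> T"
    using b(3) by (auto simp: edges_at_def)
  define A where "A = insert e0 T"
  obtain u w where "edge_ends G e0 = {u, w}" "u \<noteq> w" "u \<in> verts G" "w \<in> verts G"
    by (rule edge_ends_pair)
  then obtain x where x: "edge_ends G e0 = {v0, x}" "x \<in> verts G - {v0}"
    using e0(1) by auto
  have T_A: "reachable (edge_ends G) A p q" if "reachable (edge_ends G) T p q" for p q
    using that unfolding reachable_def A_def by blast
  have to_x: "reachable (edge_ends G) A p x" if "p \<in> verts G" for p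
  proof (cases "p = v0")
    case True
    then show ?thesis
      using reachable_edge[of e0 A "edge_ends G" v0 x] x(1) by (simp add: A_def)
  next
    case False
    then show ?thesis
      using T_A b(4) that x(2) by blast
  qed
  then have "reachable (edge_ends G) A p q" if "p \<in> verts G" "q \<in> verts G" for p q
    using reachable_trans[OF to_x reachable_sym[OF to_x]] that by blast
  then have cnt: "finite (components (- subpoints A))"
    "card (components (- subpoints A)) + card (UNIV - A) \<le> card regions"
    using region_count[of A A] finite_regions by auto
  have "exterior_face G \<subseteq> - subpoints A"
    using in_components_subset[OF exterior_exists(1)] subpoints_mono[of A UNIV] unfolding points_eq by blast
  then have "- subpoints A \<noteq> {}"
    using in_components_nonempty[OF exterior_exists(1)] by blast
  then have "components (- subpoints A) \<noteq> {}"
    by simp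
  then have "card (components (- subpoints A)) > 0"
    using cnt(1) by (simp add: card_gt_0_iff)
  moreover have "UNIV - T = insert e0 (UNIV - A)"
    using e0(2) by (auto simp: A_def)
  then have "card (UNIV - T) = Suc (card (UNIV - A))"
    by (simp add: A_def)
  ultimately show ?thesis
    using cnt(2) by linarith
qed

text \<open>By the count of regions, the surjection above goes between spaces of equal dimension.\<close>

lemma basis_weights_inj:
  fixes m :: "'e \<Rightarrow> int"
  assumes T: "graph_basis G v0 T" and m: "\<forall>e\<in>T. m e = 0"
    "\<forall>j. (\<Sum>e\<in>UNIV. of_bool (edge_on_face G e j) * m e) = 0" "(\<Sum>e\<in>UNIV. m e) = 0"
  shows "m = (\<lambda>_. 0)"
proof (rule ccontr)
  assume nz: "m \<noteq> (\<lambda>_. 0)"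
  define \<kappa> :: "'f \<Rightarrow> 'e \<Rightarrow> real" where "\<kappa> j e = of_bool (edge_on_face G e j)" for j e
  \<comment> \<open>All weights collected in one linear map, over the reals so that dimensions can
    be compared; an integral vector of weight zero is a kernel vector of it.\<close>
  define L :: "real^'e \<Rightarrow> (real^'f) \<times> real" where
    "L x = (\<chi> j. \<Sum>e\<in>UNIV. \<kappa> j e * x $ e, \<Sum>e\<in>UNIV. x $ e)" for x
  define V :: "(real^'e) set" where "V = {x. \<forall>e\<in>T. x $ e = 0}"
  define vec :: "('e \<Rightarrow> int) \<Rightarrow> real^'e" where "vec m = (\<chi> e. of_int (m e))" for m
  have lin: "linear L"
    by (rule linearI) (simp_all add: L_def vec_eq_iff sum.distrib distrib_left sum_distrib_left mult.left_commute)
  have sub: "subspace V"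
    by (auto simp: V_def subspace_def)
  have Lvec: "L (vec m) = (\<chi> j. of_int (\<Sum>e\<in>UNIV. of_bool (edge_on_face G e j) * m e), of_int (\<Sum>e\<in>UNIV. m e))" for m
    by (simp add: L_def vec_def vec_eq_iff \<kappa>_def)
  \<comment> \<open>Integral surjectivity reaches the unit vectors, and these span.\<close>
  have "L ` V = UNIV"
  proof -
    have s: "subspace (L ` V)"
      by (rule linear_subspace_image[OF lin sub])
    have hit: "(\<chi> j. of_int (c j), of_int c0) \<in> L ` V" for c c0
    proof -
      obtain k where "\<forall>e\<in>T. k e = 0" "\<forall>j. (\<Sum>e\<in>UNIV. of_bool (edge_on_face G e j) * k e) = c j" "(\<Sum>e\<in>UNIV. k e) = c0"
        using basis_weights_surj[OF T] by blast
      then show ?thesis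
        using Lvec[of k] by (intro image_eqI[of _ _ "vec k"]) (auto simp: V_def vec_def)
    qed
    have "x \<in> L ` V" for x
    proof -
      obtain y s' where x: "x = (y, s')" by (cases x)
      have "(axis j 1, 0) \<in> L ` V" for j
        using hit[of "\<lambda>i. of_bool (i = j)" 0] by (simp add: axis_def of_bool_def if_distrib cong: if_cong)
      moreover have "(0, 1) \<in> L ` V"
        using hit[of "\<lambda>i. 0" 1] by (simp add: zero_vec_def)
      ultimately have "(\<Sum>j\<in>UNIV. y $ j *\<^sub>R (axis j 1, 0)) + s' *\<^sub>R (0, 1) \<in> L ` V"
        using s by (intro subspace_add subspace_sum subspace_scale)
      moreover have "(\<Sum>j\<in>UNIV. y $ j *\<^sub>R (axis j 1, 0 :: real)) + s' *\<^sub>R (0, 1) = x"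
        unfolding x using basis_expansion[of y]
        by (simp add: prod_eq_iff fst_sum snd_sum scalar_mult_eq_scaleR)
      ultimately show ?thesis by simp
    qed
    then show ?thesis by blast
  qed
  have x0: "vec m \<in> V" "L (vec m) = 0" "vec m \<noteq> 0"
  proof -
    show "L (vec m) = 0"
      unfolding Lvec using m(2,3) by (simp only: zero_prod_def of_int_0) (simp add: vec_eq_iff)
  qed (use m nz in \<open>auto simp: V_def vec_def vec_eq_iff fun_eq_iff\<close>)
  \<comment> \<open>A nonzero kernel vector is completed to a basis \<open>B\<close> of
    \<open>V\<close>. Its image contributes nothing, so fewer than \<open>card B\<close> vectors
    would span the target, whose dimension is at least \<open>card B\<close>.\<close>
  have "independent {vec m}"
    using x0(3) by simp
  then obtain B where B: "{vec m} \<subseteq> B" "B \<subseteq> V" "independent B" "V \<subseteq> span B"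
    using maximal_independent_subset_extend[of "{vec m}" V] x0(1) by auto
  have finB: "finite B"
    by (rule independent_imp_finite[OF B(3)])
  have "V \<subseteq> span ((\<lambda>e. axis e 1) ` (UNIV - T))"
  proof
    fix x assume x: "x \<in> V"
    have "x = (\<Sum>e\<in>UNIV. x $ e *\<^sub>R axis e 1)"
      using basis_expansion[of x] by (simp add: scalar_mult_eq_scaleR)
    also have "\<dots> = (\<Sum>e\<in>UNIV - T. x $ e *\<^sub>R axis e 1)"
      using x by (intro sum.mono_neutral_right) (auto simp: V_def)
    also have "\<dots> \<in> span ((\<lambda>e. axis e 1) ` (UNIV - T))"
      by (intro span_sum span_scale span_base imageI)
    finally show "x \<in> span ((\<lambda>e. axis e 1) ` (UNIV - T))" .
  qed
  then have "dim V \<le> card ((\<lambda>e. axis e (1::real)) ` (UNIV - T))"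
    by (intro dim_le_card) auto
  also have "\<dots> \<le> card (UNIV - T)"
    by (rule card_image_le) simp
  also have "\<dots> \<le> CARD('f) + 1"
    using card_basis_complement[OF T] card_regions by simp
  finally have "card B \<le> CARD('f) + 1"
    using independent_card_le_dim[OF B(2,3)] by linarith
  have "UNIV \<subseteq> L ` span B"
    using \<open>L ` V = UNIV\<close> B(4) by blast
  also have "L ` span B = span (L ` B)"
    by (simp add: linear_span_image[OF lin])
  also have "L ` B \<subseteq> insert 0 (L ` (B - {vec m}))"
    using x0(2) by auto
  then have "span (L ` B) \<subseteq> span (insert 0 (L ` (B - {vec m})))"
    by (rule span_mono)
  also have "span (insert 0 (L ` (B - {vec m}))) = span (L ` (B - {vec m}))"
    by (rule span_insert_0)
  finally have "dim (UNIV :: ((real^'f) \<times> real) set) \<le> card (L ` (B - {vec m}))"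
    using finB by (intro dim_le_card) auto
  also have "\<dots> \<le> card (B - {vec m})"
    using finB by (intro card_image_le) simp
  also have "\<dots> < card B"
    using finB B(1) by (intro psubset_card_mono) auto
  finally show False
    using \<open>card B \<le> CARD('f) + 1\<close> by simp
qed

end


section \<open>Weights of binary sequences\<close>

text \<open>At an end point of the interval one of the two one-sided filters is trivial, which is
  why separate conditions at the end points are needed when jumps are summed.\<close>

lemma eventually_sides:
  fixes t :: real
  assumes "t \<in> {0..1}"
  shows "(\<forall>\<^sub>F s in at t within {0..1}. P s) \<longleftrightarrow>
    (\<forall>\<^sub>F s in at t within {0..<t}. P s) \<and> (\<forall>\<^sub>F s in at t within {t<..1}. P s)"
proof -
  have "at t within {0..1} = at t within ({0..<t} \<union> {t<..1})"
    using assms by (intro at_within_nhd[of _ UNIV]) auto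
  then show ?thesis
    by (simp add: at_within_union eventually_sup)
qed

lemma eventually_between:
  fixes t :: real
  assumes "finite P"
  shows "\<forall>\<^sub>F s in at t within S. \<forall>p\<in>P. p \<noteq> t \<longrightarrow> \<bar>s - t\<bar> < \<bar>p - t\<bar>"
proof -
  have "\<forall>\<^sub>F s in at t within S. p \<noteq> t \<longrightarrow> \<bar>s - t\<bar> < \<bar>p - t\<bar>" for p
  proof (cases "p = t")
    case False
    then have "\<forall>\<^sub>F s in at t within S. dist s t < \<bar>p - t\<bar>"
      by (intro tendstoD[OF tendsto_ident_at]) simp
    then show ?thesis
      by (simp add: dist_real_def)
  qed simp
  then show ?thesis
    using assms by (simp add: eventually_ball_finite_distrib)
qed

text \<open>The value of \<open>f\<close> at a point of \<open>P\<close> is irrelevant unless it is an end point of the interval,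
  where one of the one-sided limits is vacuous.\<close>

lemma sum_of_jumps:
  fixes f l r :: "real \<Rightarrow> int"
  assumes P: "finite P" "P \<subseteq> {0..1}"
    and const: "\<And>t. t \<in> {0..1} - P \<Longrightarrow> \<forall>\<^sub>F s in at t within {0..1}. f s = f t"
    and left: "\<And>t. t \<in> P \<Longrightarrow> \<forall>\<^sub>F s in at t within {0..<t}. f s = l t"
    and right: "\<And>t. t \<in> P \<Longrightarrow> \<forall>\<^sub>F s in at t within {t<..1}. f s = r t"
    and ends: "0 \<in> P \<Longrightarrow> l 0 = f 0" "1 \<in> P \<Longrightarrow> r 1 = f 1"
  shows "(\<Sum>t\<in>P. r t - l t) = f 1 - f 0"
proof -
  \<comment> \<open>\<open>J t\<close> collects the jumps strictly before \<open>t\<close>.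
    Subtracting it, with the left limit as the value at a jump, gives a locally constant function on
    a connected interval.\<close>
  define J where "J t = (\<Sum>p\<in>{p\<in>P. p < t}. r p - l p)" for t
  define h where "h t = (if t \<in> P then l t else f t) - J t" for t
  have "\<forall>\<^sub>F s in at t within {0..1}. h t = h s" if t: "t \<in> {0..1}" for t
    unfolding eventually_sides[OF t]
  proof
    have fl: "\<forall>\<^sub>F s in at t within {0..<t}. f s = (if t \<in> P then l t else f t)"
      using left[of t] const[of t] t eventually_sides[OF t] by auto
    have "\<forall>\<^sub>F s in at t within {0..<t}. s < t"
      unfolding eventually_at_filter by simp
    with fl eventually_between[OF P(1), of t "{0..<t}"] show "\<forall>\<^sub>F s in at t within {0..<t}. h t = h s"
    proof eventually_elim
      case (elim s)
      have "s \<notin> P" using elim by auto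
      moreover have "p < s \<longleftrightarrow> p < t" if "p \<in> P" for p
        using elim(2)[rule_format, OF that] elim(3) by (auto simp: abs_if split: if_splits)
      then have "{p \<in> P. p < s} = {p \<in> P. p < t}" by auto
      ultimately show ?case
        using elim(1) by (simp add: h_def J_def)
    qed
    have fr: "\<forall>\<^sub>F s in at t within {t<..1}. f s = (if t \<in> P then r t else f t)"
      using right[of t] const[of t] t eventually_sides[OF t] by auto
    have "\<forall>\<^sub>F s in at t within {t<..1}. t < s"
      unfolding eventually_at_filter by simp
    with fr eventually_between[OF P(1), of t "{t<..1}"] show "\<forall>\<^sub>F s in at t within {t<..1}. h t = h s"
    proof eventually_elim
      case (elim s)
      have sP: "s \<notin> P" using elim by auto
      have "p < s \<longleftrightarrow> p < t \<or> p = t" if "p \<in> P" for p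
        using elim(2)[rule_format, OF that] elim(3) by (auto simp: abs_if split: if_splits)
      then have "{p \<in> P. p < s} = (if t \<in> P then insert t {p \<in> P. p < t} else {p \<in> P. p < t})"
        by auto
      then have "J s = J t + (if t \<in> P then r t - l t else 0)"
        using P(1) by (simp add: J_def)
      then show ?case
        using elim(1) sP by (simp add: h_def)
    qed
  qed
  then have "h 0 = h 1"
    by (intro connected_local_const[of "{0..1}" 0 1 h]) auto
  moreover have "J 0 = 0"
    unfolding J_def using P(2) by (intro sum.neutral) auto
  then have "h 0 = f 0"
    using ends(1) by (simp add: h_def)
  \<comment> \<open>\<open>J 1\<close> omits a jump at 1 itself; there \<open>h\<close> takes the
    left limit, and the end condition on \<open>r\<close> supplies the missing term.\<close>
  moreover have "(\<Sum>t\<in>P. r t - l t) = J 1 + (if 1 \<in> P then r 1 - l 1 else 0)"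
  proof -
    have "P = {p \<in> P. p < 1} \<union> (P \<inter> {1})"
      using P(2) by (auto simp: less_le)
    then have "(\<Sum>t\<in>P. r t - l t) = (\<Sum>t\<in>{p \<in> P. p < 1} \<union> (P \<inter> {1}). r t - l t)"
      by simp
    also have "\<dots> = J 1 + (\<Sum>t\<in>P \<inter> {1}. r t - l t)"
      unfolding J_def using P(1) by (intro sum.union_disjoint) auto
    finally show ?thesis by (cases "1 \<in> P") simp_all
  qed
  then have "h 1 = f 1 - (\<Sum>t\<in>P. r t - l t)"
    using ends(2) by (auto simp: h_def)
  ultimately show ?thesis by simp
qed

section \<open>Weights of sums, products and signs of coefficients\<close>

lemma weighted_coef_sum:
  assumes "\<And>x. x \<in> A \<Longrightarrow> coef (f x) \<in> weighted \<omega> \<nu> k"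
  shows "coef (sum f A) \<in> weighted \<omega> \<nu> k"
  using assms
  by (induction A rule: infinite_finite_induct) (auto simp: coef_add coef_def[of 0] intro: weighted_add)

lemma weighted_coef_mult:
  "coef a \<in> weighted \<omega> \<nu> k \<Longrightarrow> coef b \<in> weighted \<omega> \<nu> l \<Longrightarrow> coef (a * b) \<in> weighted \<omega> \<nu> (k + l)"
  by (simp add: coef_mult weighted_mult)

lemma weighted_coef_sign: "coef ((- 1) ^ n) \<in> weighted \<omega> \<nu> 0"
proof (induction n)
  case (Suc n)
  then show ?case
    using weighted_coef_minus[OF Suc] by simp
qed (simp add: weighted_one)

locale garden_graph = cubic_graph G for G :: "('e::finite, 'f::finite) plane_graph" +
  fixes \<Gamma> :: "('e, 'f) garden"
  assumes garden: "is_garden G \<Gamma>"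
begin

section \<open>Consequences of the garden axioms\<close>

definition thread_region :: "'f option \<Rightarrow> complex set" where
  "thread_region i = (case i of Some j \<Rightarrow> face G j | None \<Rightarrow> exterior_face G)"

lemma center_in_face: "center \<Gamma> j \<in> face G j"
  using conjunct1[OF garden[unfolded is_garden_def]] by blast

lemma threadD:
  assumes "(i, v) \<in> thread_index G"
  shows "smooth_arc (thread \<Gamma> i v)" "pathfinish (thread \<Gamma> i v) = v" "v \<in> verts G"
    "i = Some j \<Longrightarrow> pathstart (thread \<Gamma> i v) = center \<Gamma> j"
    "i = Some j \<Longrightarrow> arc_interior (thread \<Gamma> i v) \<subseteq> face G j"
    "i = None \<Longrightarrow> Re (pathstart (thread \<Gamma> i v)) = -1"
    "i = None \<Longrightarrow> path_image (thread \<Gamma> i v) \<inter> points G = {v}"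
proof -
  note g = conjunct1[OF conjunct2[OF garden[unfolded is_garden_def]]]
  have 1: "smooth_arc (thread \<Gamma> i v) \<and> pathfinish (thread \<Gamma> i v) = v \<and>
        (case i of
           Some j \<Rightarrow> pathstart (thread \<Gamma> i v) = center \<Gamma> j \<and>
                     arc_interior (thread \<Gamma> i v) \<subseteq> face G j
         | None \<Rightarrow> Re (pathstart (thread \<Gamma> i v)) = -1 \<and>
                   path_image (thread \<Gamma> i v) \<subseteq> closed_square \<and>
                   path_image (thread \<Gamma> i v) \<inter> points G = {v})"
    using bspec[OF g assms] by simp
  then show "smooth_arc (thread \<Gamma> i v)" "pathfinish (thread \<Gamma> i v) = v" by simp_all
  show "v \<in> verts G"
    using assms by (auto simp: thread_index_def)
  show "i = Some j \<Longrightarrow> pathstart (thread \<Gamma> i v) = center \<Gamma> j"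
    "i = Some j \<Longrightarrow> arc_interior (thread \<Gamma> i v) \<subseteq> face G j"
    "i = None \<Longrightarrow> Re (pathstart (thread \<Gamma> i v)) = -1"
    "i = None \<Longrightarrow> path_image (thread \<Gamma> i v) \<inter> points G = {v}"
    using 1 by simp_all
qed

lemma threads_disjoint:
  assumes "(i, v) \<in> thread_index G" "(i', v') \<in> thread_index G" "(i, v) \<noteq> (i', v')"
  shows "arc_interior (thread \<Gamma> i v) \<inter> arc_interior (thread \<Gamma> i' v') = {}"
proof -
  note g = conjunct1[OF conjunct2[OF conjunct2[OF garden[unfolded is_garden_def]]]]
  have "path_image (thread \<Gamma> i v) \<inter> path_image (thread \<Gamma> i' v')
          \<subseteq> {pathstart (thread \<Gamma> i v), v} \<inter> {pathstart (thread \<Gamma> i' v'), v'}"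
    using bspec[OF bspec[OF g assms(1), simplified] assms(2)] assms(3) by simp
  then show ?thesis
    using threadD(2)[OF assms(1)] by (auto simp: arc_interior_def subset_iff)
qed

lemma tineD:
  "smooth_arc (tine \<Gamma> j)" "Im (tine \<Gamma> j 0) = -1" "Im (tine \<Gamma> j 1) = 1" "center \<Gamma> j \<in> path_image (tine \<Gamma> j)"
  "path_image (tine \<Gamma> j) \<inter> verts G = {}" "transverse (edge G e) (tine \<Gamma> j)"
  "(i, v) \<in> thread_index G \<Longrightarrow> transverse (thread \<Gamma> i v) (tine \<Gamma> j)"
proof -
  note g = conjunct1[OF conjunct2[OF conjunct2[OF conjunct2[OF garden[unfolded is_garden_def]]]], rule_format, of j]
  show "smooth_arc (tine \<Gamma> j)" "Im (tine \<Gamma> j 0) = -1" "Im (tine \<Gamma> j 1) = 1" "center \<Gamma> j \<in> path_image (tine \<Gamma> j)"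
    "path_image (tine \<Gamma> j) \<inter> verts G = {}" "transverse (edge G e) (tine \<Gamma> j)"
    using g by (simp_all add: pathstart_def pathfinish_def)
  assume "(i, v) \<in> thread_index G"
  moreover have "\<forall>(i, v)\<in>thread_index G. transverse (thread \<Gamma> i v) (tine \<Gamma> j)"
    using g by blast
  ultimately show "transverse (thread \<Gamma> i v) (tine \<Gamma> j)"
    by blast
qed

lemma thread_region_regions: "thread_region i \<in> regions"
  using face_regions(1) exterior_exists(1) by (simp add: thread_region_def split: option.split)

lemma regions_disjoint: "C \<in> regions \<Longrightarrow> D \<in> regions \<Longrightarrow> x \<in> C \<Longrightarrow> x \<in> D \<Longrightarrow> C = D"
  using components_nonoverlap[of C "- points G" D] by blast

lemma arc_interior_eq: "arc p \<Longrightarrow> arc_interior p = p ` {0<..<1}"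
  using simple_path_endless[OF arc_imp_simple_path] by (simp add: arc_interior_def)

text \<open>For an exterior thread, the part before \<open>v\<close> is connected, avoids the graph
  and starts on the boundary of the square, hence in the exterior region.\<close>

lemma thread_interior:
  assumes "(i, v) \<in> thread_index G"
  shows "arc_interior (thread \<Gamma> i v) \<subseteq> thread_region i"
proof (cases i)
  case (Some j)
  then show ?thesis
    using threadD(5)[OF assms Some] by (simp add: thread_region_def)
next
  case None
  define p where "p = thread \<Gamma> i v"
  have p: "arc p" "pathfinish p = v"
    using threadD(1,2)[OF assms] smooth_arcD(1) by (auto simp: p_def)
  have "inj_on p {0..1}" "p 1 = v" "continuous_on {0..1} p"
    using p by (auto simp: arc_def pathfinish_def path_def)
  have "v \<notin> p ` {0..<1}"
  proof
    assume "v \<in> p ` {0..<1}"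
    then obtain x where "0 \<le> x" "x < 1" "p x = p 1"
      using \<open>p 1 = v\<close> by auto
    then show False
      using inj_onD[OF \<open>inj_on p {0..1}\<close>, of x 1] by simp
  qed
  moreover have "p ` {0..<1} \<subseteq> path_image p"
    by (auto simp: path_image_def)
  moreover have "path_image p \<inter> points G = {v}"
    using threadD(7)[OF assms None] by (simp add: p_def)
  ultimately have avoid: "p ` {0..<1} \<subseteq> - points G"
  proof (intro subsetI ComplI)
    fix x assume x: "x \<in> p ` {0..<1}" "x \<in> points G"
    then have "x \<in> path_image p \<inter> points G"
      using \<open>p ` {0..<1} \<subseteq> path_image p\<close> by (intro IntI subsetD[of "p ` {0..<1}" "path_image p"])
    then have "x = v"
      using \<open>path_image p \<inter> points G = {v}\<close> by simp
    then show False
      using x(1) \<open>v \<notin> p ` {0..<1}\<close> by simp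
  qed
  have "connected (p ` {0..<1})"
    using \<open>continuous_on {0..1} p\<close>
    by (intro connected_continuous_image) (auto elim: continuous_on_subset)
  moreover have "pathstart p \<in> exterior_face G"
    using threadD(6)[OF assms None] by (intro outside_square_exterior) (simp add: p_def)
  then have "exterior_face G \<inter> p ` {0..<1} \<noteq> {}"
    by (auto simp: pathstart_def)
  ultimately have "p ` {0..<1} \<subseteq> exterior_face G"
    using components_maximal[OF exterior_exists(1) _ avoid] by blast
  moreover have "arc_interior p \<subseteq> p ` {0..<1}"
    by (auto simp: arc_interior_eq[OF p(1)])
  ultimately show ?thesis
    using None by (simp add: thread_region_def p_def)
qed

lemma thread_weight_weighted:
  assumes iv: "(i, v) \<in> thread_index G"
  shows "coef (thread_weight G \<Gamma> (thread \<Gamma> i v) :: ('e, 'k::comm_ring_1) laurent)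
      \<in> weighted (face_weight G j) \<nu> (2 * of_bool (thread_region i = face G j))"
    and "coef (thread_weight G \<Gamma> (thread \<Gamma> i v) :: ('e, 'k) laurent) \<in> weighted (\<lambda>_. 1) \<nu> 1"
proof -
  define p where "p = thread \<Gamma> i v"
  have v: "v \<in> verts G" and p: "arc p" "pathfinish p = v"
    using threadD[OF iv] smooth_arcD(1) by (auto simp: p_def)
  obtain R S where sec: "vertex_sectors v R S"
    using vertex_sectors_exist[OF v] .
  obtain F where F: "\<forall>e\<in>edges_at G v. F e \<in> regions \<and> S e \<inter> ball v R \<subseteq> F e"
    "inj_on F (edges_at G v)" "\<forall>e\<in>edges_at G v. sides e = F ` (edges_at G v - {e})"
    by (rule vertex_regions[OF v sec])
  obtain k where k: "k \<in> edges_at G v" "F k = thread_region i"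
    "\<forall>e\<in>edges_at G v. adjacent_to_thread G p e \<longleftrightarrow> e \<noteq> k"
    by (rule thread_sector[OF v sec F(1) p thread_region_regions thread_interior[OF iv, folded p_def]])
  obtain a b where ab: "edges_at G v = {k, a, b}" "k \<noteq> a" "k \<noteq> b" "a \<noteq> b"
    by (rule edges_at_third[OF v k(1)])
  have sd: "sides k = {F a, F b}" "sides a = {F k, F b}" "sides b = {F k, F a}"
    using F(3) ab by auto
  have Fne: "F k \<noteq> F a" "F k \<noteq> F b" "F a \<noteq> F b"
    using F(2) ab by (auto simp: inj_on_def)
  have "coef (thread_weight G \<Gamma> p :: ('e, 'k) laurent)
      \<in> weighted \<omega> \<nu> (0 + (\<Sum>e\<in>edges_at G v. (if adjacent_to_thread G p e then 1 else - 1) * \<omega> e))" for \<omega>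
    unfolding thread_weight_def Let_def p(2)
    by (intro weighted_coef_mult weighted_coef_sign weighted_coef_prod weighted_coef_lvar)
  moreover have "0 + (\<Sum>e\<in>edges_at G v. (if adjacent_to_thread G p e then 1 else - 1) * \<omega> e) = \<omega> a + \<omega> b - \<omega> k"
    for \<omega> :: "'e \<Rightarrow> int"
    using k(3) ab unfolding ab(1) by simp
  ultimately have w: "coef (thread_weight G \<Gamma> p :: ('e, 'k) laurent) \<in> weighted \<omega> \<nu> (\<omega> a + \<omega> b - \<omega> k)" for \<omega>
    by metis
  \<comment> \<open>The region of the thread, opposite to \<open>k\<close>, borders \<open>a\<close>
    and \<open>b\<close> and gets 1 + 1. The region opposite to \<open>a\<close> borders
    \<open>b\<close> and \<open>k\<close> and gets 1 - 1, and similarly for \<open>b\<close>; all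
    other regions get 0.\<close>
  have "face_weight G j a + face_weight G j b - face_weight G j k = 2 * of_bool (thread_region i = face G j)"
    unfolding face_weight_def edge_on_face_iff sd k(2)[symmetric] using Fne by auto
  then show "coef (thread_weight G \<Gamma> (thread \<Gamma> i v) :: ('e, 'k) laurent)
      \<in> weighted (face_weight G j) \<nu> (2 * of_bool (thread_region i = face G j))"
    using w[of "face_weight G j"] by (simp add: p_def)
  show "coef (thread_weight G \<Gamma> (thread \<Gamma> i v) :: ('e, 'k) laurent) \<in> weighted (\<lambda>_. 1) \<nu> 1"
    using w[of "\<lambda>_. 1"] by (simp add: p_def)
qed

subsection \<open>Tines\<close>

definition edge_at :: "'f \<Rightarrow> real \<Rightarrow> 'e" where
  "edge_at j t = (THE e. tine \<Gamma> j t \<in> eimg e)"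

lemma edge_at:
  assumes "t \<in> edge_params G \<Gamma> j"
  shows "t \<in> {0..1}" "tine \<Gamma> j t \<in> eimg (edge_at j t) - verts G"
proof -
  show t: "t \<in> {0..1}" using assms by (simp add: edge_params_def)
  obtain e where e: "tine \<Gamma> j t \<in> eimg e"
    using assms by (auto simp: edge_params_def)
  have nv: "tine \<Gamma> j t \<notin> verts G"
    using tineD(5)[of j] t unfolding path_image_def by blast
  have "edge_at j t = e"
    unfolding edge_at_def
  proof (rule the_equality, rule e, rule ccontr)
    fix e' assume "tine \<Gamma> j t \<in> eimg e'" "e' \<noteq> e"
    then show False
      using cubicD(5)[of e' e] e nv by blast
  qed
  then show "tine \<Gamma> j t \<in> eimg (edge_at j t) - verts G"
    using e nv by simp
qed

lemma tine_points_iff: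
  assumes "t \<in> {0..1}"
  shows "tine \<Gamma> j t \<in> points G \<longleftrightarrow> t \<in> edge_params G \<Gamma> j"
proof -
  have "tine \<Gamma> j t \<notin> verts G"
    using tineD(5)[of j] assms unfolding path_image_def by blast
  then show ?thesis
    using assms by (auto simp: points_def edge_params_def)
qed

lemma finite_edge_params: "finite (edge_params G \<Gamma> j)"
proof (rule finite_subset)
  show "edge_params G \<Gamma> j \<subseteq> (\<Union>e. {s \<in> {0..1}. tine \<Gamma> j s \<in> eimg e})"
    by (auto simp: edge_params_def)
  show "finite (\<Union>e. {s \<in> {0..1}. tine \<Gamma> j s \<in> eimg e})"
    by (intro finite_UN_I finite finite_transverse[OF cubicD(2) tineD(1) tineD(6)])
qed

lemma finite_thread_index: "finite (thread_index G)"
proof (rule finite_subset)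
  show "thread_index G \<subseteq> UNIV \<times> verts G"
    by (auto simp: thread_index_def)
qed (simp add: cubicD(1))

lemma finite_thread_params: "finite (thread_params G \<Gamma> j)"
proof (rule finite_subset)
  show "thread_params G \<Gamma> j \<subseteq>
      (\<Union>x\<in>thread_index G. {s \<in> {0..1}. tine \<Gamma> j s \<in> path_image (thread \<Gamma> (fst x) (snd x))})"
  proof
    fix t assume "t \<in> thread_params G \<Gamma> j"
    then obtain i v where "t \<in> {0..1}" "(i, v) \<in> thread_index G" "tine \<Gamma> j t \<in> arc_interior (thread \<Gamma> i v)"
      by (auto simp: thread_params_def)
    then show "t \<in> (\<Union>x\<in>thread_index G. {s \<in> {0..1}. tine \<Gamma> j s \<in> path_image (thread \<Gamma> (fst x) (snd x))})"
      by (intro UN_I[of "(i, v)"]) (auto simp: arc_interior_def)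
  qed
  show "finite (\<Union>x\<in>thread_index G. {s \<in> {0..1}. tine \<Gamma> j s \<in> path_image (thread \<Gamma> (fst x) (snd x))})"
    by (intro finite_UN_I finite_thread_index finite_transverse[OF threadD(1) tineD(1) tineD(7)]) auto
qed

text \<open>Thread interiors are pairwise disjoint, which makes the definite description in
  \<open>thread_at\<close> denote the thread at hand.\<close>

lemma thread_paramE:
  assumes "t \<in> thread_params G \<Gamma> j"
  obtains i v where "(i, v) \<in> thread_index G" "tine \<Gamma> j t \<in> arc_interior (thread \<Gamma> i v)"
    "t \<in> {0..1}" "tine \<Gamma> j t \<in> thread_region i" "thread_at G \<Gamma> (tine \<Gamma> j t) = thread \<Gamma> i v"
proof -
  obtain i v where iv: "(i, v) \<in> thread_index G" "tine \<Gamma> j t \<in> arc_interior (thread \<Gamma> i v)" and t: "t \<in> {0..1}"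
    using assms by (auto simp: thread_params_def)
  have "(THE (i, v). (i, v) \<in> thread_index G \<and> tine \<Gamma> j t \<in> arc_interior (thread \<Gamma> i v)) = (i, v)"
  proof (rule the_equality)
    fix x assume x: "case x of (i, v) \<Rightarrow> (i, v) \<in> thread_index G \<and> tine \<Gamma> j t \<in> arc_interior (thread \<Gamma> i v)"
    obtain i' v' where x': "x = (i', v')" by (cases x)
    show "x = (i, v)"
    proof (rule ccontr)
      assume "x \<noteq> (i, v)"
      then show False
        using threads_disjoint[of i' v' i v] iv x unfolding x' by auto
    qed
  qed (use iv in simp)
  then have "thread_at G \<Gamma> (tine \<Gamma> j t) = thread \<Gamma> i v"
    by (simp add: thread_at_def)
  then show ?thesis
    using that iv t thread_interior[OF iv(1)] by blast
qed

definition center_param :: "'f \<Rightarrow> real" where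
  "center_param j = (SOME t. t \<in> {0..1} \<and> tine \<Gamma> j t = center \<Gamma> j)"

lemma center_param: "center_param j \<in> {0..1}" "tine \<Gamma> j (center_param j) = center \<Gamma> j"
proof -
  have "\<exists>t. t \<in> {0..1} \<and> tine \<Gamma> j t = center \<Gamma> j"
    using tineD(4)[of j] by (auto simp: path_image_def)
  from someI_ex[OF this] show "center_param j \<in> {0..1}" "tine \<Gamma> j (center_param j) = center \<Gamma> j"
    unfolding center_param_def by blast+
qed

lemma tine_eq_center_iff:
  assumes "t \<in> {0..1}"
  shows "tine \<Gamma> j t = center \<Gamma> j \<longleftrightarrow> t = center_param j"
proof -
  have "inj_on (tine \<Gamma> j) {0..1}"
    using smooth_arcD(1)[OF tineD(1)] by (simp add: arc_def)
  then show ?thesis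
    using center_param[of j] assms by (metis inj_onD)
qed

lemma tine_continuous: "continuous_on {0..1} (tine \<Gamma> j)"
  using smooth_arcD(1)[OF tineD(1), of j] by (simp add: arc_def path_def)

lemma tine_locally_in_region:
  assumes "t \<in> {0..1}" "D \<in> regions" "tine \<Gamma> j t \<in> D"
  shows "\<forall>\<^sub>F s in at t within {0..1}. tine \<Gamma> j s \<in> D"
proof -
  have "(tine \<Gamma> j \<longlongrightarrow> tine \<Gamma> j t) (at t within {0..1})"
    using tine_continuous assms(1) by (simp add: continuous_on_def)
  then show ?thesis
    using topological_tendstoD open_regions[OF assms(2)] assms(3) by blast
qed

lemma tine_ends: "tine \<Gamma> j 0 \<in> exterior_face G" "tine \<Gamma> j 1 \<in> exterior_face G"
  using tineD(2,3)[of j] by (auto intro!: outside_square_exterior)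

lemma exterior_not_points: "x \<in> exterior_face G \<Longrightarrow> x \<notin> points G"
  using in_components_subset[OF exterior_exists(1)] by blast

lemma region_not_points: "D \<in> regions \<Longrightarrow> x \<in> D \<Longrightarrow> x \<notin> points G"
  using in_components_subset[of D] by blast

lemma edge_params_interior: "t \<in> edge_params G \<Gamma> j \<Longrightarrow> 0 < t \<and> t < 1"
  using edge_at(1)[of t j] tine_points_iff[of t j] tine_ends[of j] exterior_not_points by (force simp: less_le)

text \<open>Centers and interiors of threads lie in open regions, edges in the graph. A thread
  through the center of \<open>j\<close> would lie in the face \<open>j\<close> and so start at that
  center, but interiors of threads omit their end points.\<close>

lemma params_disjoint:
  "edge_params G \<Gamma> j \<inter> thread_params G \<Gamma> j = {}"
  "center_param j \<notin> edge_params G \<Gamma> j" "center_param j \<notin> thread_params G \<Gamma> j"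
  "center_param j \<noteq> 0" "center_param j \<noteq> 1"
proof -
  have nP: "tine \<Gamma> j t \<notin> points G" if "t \<in> thread_params G \<Gamma> j" for t
    using that by (rule thread_paramE) (use region_not_points thread_region_regions in blast)
  have "t \<notin> thread_params G \<Gamma> j" if "t \<in> edge_params G \<Gamma> j" for t
    using nP[of t] tine_points_iff[of t j] edge_at(1)[OF that] that by blast
  then show "edge_params G \<Gamma> j \<inter> thread_params G \<Gamma> j = {}" by blast
  have cf: "tine \<Gamma> j (center_param j) \<in> face G j"
    unfolding center_param(2) by (rule center_in_face)
  then show "center_param j \<notin> edge_params G \<Gamma> j"
    using tine_points_iff[OF center_param(1)] region_not_points[OF face_regions(1)] by blast
  have ne: "tine \<Gamma> j (center_param j) \<notin> exterior_face G"
    using regions_disjoint[OF face_regions(1) exterior_exists(1) cf] face_not_exterior by blast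
  then show "center_param j \<noteq> 0" "center_param j \<noteq> 1"
    using tine_ends[of j] by metis+
  show "center_param j \<notin> thread_params G \<Gamma> j"
  proof
    assume "center_param j \<in> thread_params G \<Gamma> j"
    then obtain i v where iv: "(i, v) \<in> thread_index G" "tine \<Gamma> j (center_param j) \<in> arc_interior (thread \<Gamma> i v)"
      "center_param j \<in> {0..1}" "tine \<Gamma> j (center_param j) \<in> thread_region i"
      "thread_at G \<Gamma> (tine \<Gamma> j (center_param j)) = thread \<Gamma> i v"
      by (rule thread_paramE)
    have "thread_region i = face G j"
      using regions_disjoint[OF thread_region_regions face_regions(1) iv(4) cf] .
    then have "i = Some j"
      using face_not_exterior face_inj by (auto simp: thread_region_def split: option.splits)
    then have "center \<Gamma> j \<notin> arc_interior (thread \<Gamma> i v)"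
      using threadD(4)[OF iv(1)] by (auto simp: arc_interior_def)
    then show False
      using iv(2) by (simp add: center_param(2))
  qed
qed

lemma tine_crosses_edge:
  assumes t: "t \<in> edge_params G \<Gamma> j"
  obtains C C' where "C \<noteq> C'" "sides (edge_at j t) = {C, C'}"
    "\<forall>\<^sub>F s in at t within {0..<t}. tine \<Gamma> j s \<in> C" "\<forall>\<^sub>F s in at t within {t<..1}. tine \<Gamma> j s \<in> C'"
proof -
  obtain r S1 S2 where loc: "local_sides (edge_at j t) (tine \<Gamma> j t) r S1 S2"
    using local_sides_exist[OF edge_at(2)[OF t] zero_less_one] .
  obtain C1 C2 where C: "C1 \<noteq> C2" "sides (edge_at j t) = {C1, C2}" "S1 \<subseteq> C1" "S2 \<subseteq> C2"
    "\<forall>D\<in>regions. tine \<Gamma> j t \<in> closure D \<longrightarrow> D \<in> sides (edge_at j t)"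
    by (rule sides_local[OF loc edge_at(2)[OF t]])
  obtain A B where AB: "A = S1 \<and> B = S2 \<or> A = S2 \<and> B = S1"
    "\<forall>\<^sub>F s in at t within {0..<t}. tine \<Gamma> j s \<in> A" "\<forall>\<^sub>F s in at t within {t<..1}. tine \<Gamma> j s \<in> B"
    by (rule local_sides_crossing[OF loc tineD(1) tineD(6) edge_at(1)[OF t] refl])
  from AB(1) show ?thesis
  proof
    assume S: "A = S1 \<and> B = S2"
    show ?thesis
    proof (rule that[OF C(1,2)])
      show "\<forall>\<^sub>F s in at t within {0..<t}. tine \<Gamma> j s \<in> C1"
        using AB(2) by eventually_elim (use S C in blast)
      show "\<forall>\<^sub>F s in at t within {t<..1}. tine \<Gamma> j s \<in> C2"
        using AB(3) by eventually_elim (use S C in blast)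
    qed
  next
    assume S: "A = S2 \<and> B = S1"
    show ?thesis
    proof (rule that[of C2 C1])
      show "\<forall>\<^sub>F s in at t within {0..<t}. tine \<Gamma> j s \<in> C2"
        using AB(2) by eventually_elim (use S C in blast)
      show "\<forall>\<^sub>F s in at t within {t<..1}. tine \<Gamma> j s \<in> C1"
        using AB(3) by eventually_elim (use S C in blast)
    qed (use C in auto)
  qed
qed

subsection \<open>Jumps along a tine\<close>

text \<open>At an edge, the exponent with which it enters its factor of \<open>seq_weight\<close>;
  at a thread, whether its weight enters at all. The center counts 1 because the sequence must rise
  there, although it has no factor in the product.\<close>

definition jump :: "'f \<Rightarrow> (real \<Rightarrow> nat) \<Rightarrow> real \<Rightarrow> int" where
  "jump j B t = (if t \<in> edge_params G \<Gamma> j then (if switches_at B t 0 1 then 1 else - 1)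
     else if t = center_param j then 1 else of_bool (\<not> locally_constant_at B t))"

definition tine_params :: "'f \<Rightarrow> real set" where
  "tine_params j = edge_params G \<Gamma> j \<union> thread_params G \<Gamma> j \<union> {center_param j}"

lemma tine_params: "finite (tine_params j)" "tine_params j \<subseteq> {0..1}"
  using finite_edge_params finite_thread_params center_param(1)
  by (auto simp: tine_params_def edge_params_def thread_params_def)

text \<open>One-sided values of the sequence. At an end point of the tine one of them is not
  determined by a limit and is taken from the sequence itself, as \<open>sum_of_jumps\<close>
  requires.\<close>

definition jump_values :: "'f \<Rightarrow> (real \<Rightarrow> nat) \<Rightarrow> real \<Rightarrow> nat \<Rightarrow> nat \<Rightarrow> bool" where
  "jump_values j B t c d \<longleftrightarrow>
    (\<forall>\<^sub>F s in at t within {0..<t}. B s = c) \<and> (\<forall>\<^sub>F s in at t within {t<..1}. B s = d) \<and>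
    (t = 0 \<longrightarrow> c = B 0) \<and> (t = 1 \<longrightarrow> d = B 1) \<and> int d - int c = jump j B t \<and>
    (t \<in> edge_params G \<Gamma> j \<longrightarrow> {c, d} = {0, 1})"

lemma sequence_jump:
  assumes B: "B \<in> binary_sequences G \<Gamma> j a b" and t: "t \<in> tine_params j"
  shows "\<exists>c d. jump_values j B t c d"
proof -
  have val: "B s \<in> {0, 1}" if "s \<in> {0..1}" for s
    using B that by (auto simp: binary_sequences_def PiE_def)
  have t01: "t \<in> {0..1}" using tine_params(2) t by blast
  consider "t \<in> edge_params G \<Gamma> j" | "t = center_param j" | "t \<in> thread_params G \<Gamma> j"
    using t by (auto simp: tine_params_def)
  then show ?thesis
  proof cases
    case 1
    then have "switches_at B t 0 1 \<or> switches_at B t 1 0"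
      using B by (auto simp: binary_sequences_def)
    moreover have "0 < t" "t < 1"
      using edge_params_interior[OF 1] by auto
    ultimately show ?thesis
      unfolding jump_values_def using 1 by (cases "switches_at B t 0 1") (fastforce simp: jump_def switches_at_def)+
  next
    case 2
    then have "switches_at B t 0 1"
      using B center_param[of j] by (auto simp: binary_sequences_def)
    then show ?thesis
      unfolding jump_values_def using 2 params_disjoint[of j] unfolding switches_at_def
      by (intro exI[of _ 0] exI[of _ 1]) (simp add: jump_def)
  next
    case 3
    then have "t \<notin> edge_params G \<Gamma> j" "t \<noteq> center_param j"
      using params_disjoint[of j] by auto
    then have j: "jump j B t = of_bool (\<not> locally_constant_at B t)"
      by (simp add: jump_def)
    show ?thesis
    proof (cases "locally_constant_at B t")
      case True
      then have "(\<forall>\<^sub>F s in at t within {0..<t}. B s = B t) \<and> (\<forall>\<^sub>F s in at t within {t<..1}. B s = B t)"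
        using eventually_sides[OF t01] by (simp add: locally_constant_at_def)
      then show ?thesis
        unfolding jump_values_def using j True \<open>t \<notin> edge_params G \<Gamma> j\<close> by (intro exI[of _ "B t"]) auto
    next
      case False
      then have sw: "switches_at B t 0 1"
        using B 3 by (auto simp: binary_sequences_def)
      have e: "{0..<0::real} = {}" "{1<..1::real} = {}" by auto
      \<comment> \<open>An exterior thread may pass through an end point of the tine. The switch is
        then visible on one side only, and if \<open>B 0\<close> were already 1 the sequence would
        be locally constant there.\<close>
      have "B 0 = 0" if "t = 0"
      proof (rule ccontr)
        assume "B 0 \<noteq> 0"
        then have "B t = 1" using val[of 0] that by auto
        then have "locally_constant_at B t"
          using sw that unfolding locally_constant_at_def eventually_sides[OF t01] switches_at_def by (simp add: e)
        then show False using False by simp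
      qed
      moreover have "B 1 = 1" if "t = 1"
      proof (rule ccontr)
        assume "B 1 \<noteq> 1"
        then have "B t = 0" using val[of 1] that by auto
        then have "locally_constant_at B t"
          using sw that unfolding locally_constant_at_def eventually_sides[OF t01] switches_at_def by (simp add: e)
        then show False using False by simp
      qed
      ultimately show ?thesis
        unfolding jump_values_def using j False sw \<open>t \<notin> edge_params G \<Gamma> j\<close> unfolding switches_at_def
        by (intro exI[of _ 0] exI[of _ 1]) simp
    qed
  qed
qed

definition tine_passes :: "'f \<Rightarrow> real \<Rightarrow> complex set \<Rightarrow> complex set \<Rightarrow> bool" where
  "tine_passes j t C C' \<longleftrightarrow>
    C \<in> regions \<and> C' \<in> regions \<and> (\<forall>\<^sub>F s in at t within {0..<t}. tine \<Gamma> j s \<in> C) \<and>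
    (\<forall>\<^sub>F s in at t within {t<..1}. tine \<Gamma> j s \<in> C') \<and>
    (t \<in> edge_params G \<Gamma> j \<longrightarrow> C \<noteq> C' \<and> sides (edge_at j t) = {C, C'}) \<and>
    (t \<notin> edge_params G \<Gamma> j \<longrightarrow> C = C' \<and> tine \<Gamma> j t \<in> C)"

lemma tine_regions:
  assumes "t \<in> {0..1}"
  shows "\<exists>C C'. tine_passes j t C C'"
proof (cases "t \<in> edge_params G \<Gamma> j")
  case True
  obtain C C' where "C \<noteq> C'" "sides (edge_at j t) = {C, C'}"
    "\<forall>\<^sub>F s in at t within {0..<t}. tine \<Gamma> j s \<in> C" "\<forall>\<^sub>F s in at t within {t<..1}. tine \<Gamma> j s \<in> C'"
    by (rule tine_crosses_edge[OF True])
  then show ?thesis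
    unfolding tine_passes_def using True sides_subset[of "edge_at j t"] by (intro exI[of _ C] exI[of _ C']) simp
next
  case False
  then have "tine \<Gamma> j t \<in> - points G"
    using tine_points_iff[OF assms] by simp
  then obtain C where C: "C \<in> regions" "tine \<Gamma> j t \<in> C"
    using Union_components[of "- points G"] by blast
  have "\<forall>\<^sub>F s in at t within {0..1}. tine \<Gamma> j s \<in> C"
    by (rule tine_locally_in_region[OF assms C])
  then show ?thesis
    unfolding tine_passes_def using C False unfolding eventually_sides[OF assms] by (intro exI[of _ C]) simp
qed

lemma sequence_locally_constant:
  assumes "B \<in> binary_sequences G \<Gamma> j a b" "t \<in> {0..1} - tine_params j"
  shows "\<forall>\<^sub>F s in at t within {0..1}. B s = B t"
proof -
  have "tine \<Gamma> j t \<noteq> center \<Gamma> j"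
    using assms(2) tine_eq_center_iff[of t j] by (simp add: tine_params_def)
  then have "locally_constant_at B t"
    using assms by (auto simp: binary_sequences_def tine_params_def)
  then show ?thesis
    by (simp add: locally_constant_at_def)
qed

lemma sum_jump:
  assumes B: "B \<in> binary_sequences G \<Gamma> j a b"
  shows "(\<Sum>t\<in>tine_params j. jump j B t) = int b - int a"
proof -
  obtain c d where "\<And>t. t \<in> tine_params j \<Longrightarrow> jump_values j B t (c t) (d t)"
    using sequence_jump[OF B] by metis
  note cd = this[unfolded jump_values_def]
  have "(\<Sum>t\<in>tine_params j. int (d t) - int (c t)) = int (B 1) - int (B 0)"
    by (rule sum_of_jumps[OF tine_params]) (use cd sequence_locally_constant[OF B] in auto)
  moreover have "B 0 = a" "B 1 = b"
    using B by (auto simp: binary_sequences_def)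
  ultimately show ?thesis
    using cd by simp
qed

text \<open>Applied to the function that equals \<open>2 * B - 1\<close> while the tine is in the face \<open>j'\<close>
  and \<open>0\<close> elsewhere.\<close>

lemma sum_jump_face:
  assumes B: "B \<in> binary_sequences G \<Gamma> j a b"
  shows "(\<Sum>t\<in>tine_params j. (if t \<in> edge_params G \<Gamma> j then face_weight G j' (edge_at j t)
      else 2 * of_bool (tine \<Gamma> j t \<in> face G j')) * jump j B t) = 0"
proof -
  obtain c d where "\<And>t. t \<in> tine_params j \<Longrightarrow> jump_values j B t (c t) (d t)"
    using sequence_jump[OF B] by metis
  note cd = this[unfolded jump_values_def]
  obtain C D where "\<And>t. t \<in> {0..1} \<Longrightarrow> tine_passes j t (C t) (D t)"
    using tine_regions[of _ j] by metis
  note CD = this[unfolded tine_passes_def]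
  define N where "N t = of_bool (tine \<Gamma> j t \<in> face G j') * (2 * int (B t) - 1)" for t
  define l where "l t = of_bool (C t = face G j') * (2 * int (c t) - 1)" for t
  define r where "r t = of_bool (D t = face G j') * (2 * int (d t) - 1)" for t
  have in_iff: "tine \<Gamma> j s \<in> face G j' \<longleftrightarrow> E = face G j'" if "E \<in> regions" "tine \<Gamma> j s \<in> E" for s E
    using regions_disjoint[OF that(1) face_regions(1) that(2)] that(2) by blast
  have ext: "tine \<Gamma> j s \<notin> face G j'" if "tine \<Gamma> j s \<in> exterior_face G" for s
    using in_iff[OF exterior_exists(1) that] face_not_exterior by metis
  have N01: "N 0 = 0" "N 1 = 0"
    using ext tine_ends by (simp_all add: N_def)
  have "(\<Sum>t\<in>tine_params j. r t - l t) = N 1 - N 0"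
  proof (rule sum_of_jumps[OF tine_params])
    fix t assume t: "t \<in> {0..1} - tine_params j"
    then have t': "t \<in> {0..1}" "t \<notin> edge_params G \<Gamma> j"
      by (auto simp: tine_params_def)
    then have Ct: "C t \<in> regions" "tine \<Gamma> j t \<in> C t"
      using CD by blast+
    show "\<forall>\<^sub>F s in at t within {0..1}. N s = N t"
      using sequence_locally_constant[OF B t] tine_locally_in_region[OF t'(1) Ct]
      by eventually_elim (simp add: N_def in_iff[OF Ct(1)] Ct(2))
  next
    fix t assume t: "t \<in> tine_params j"
    then have t01: "t \<in> {0..1}" using tine_params(2) by blast
    have reg: "C t \<in> regions" "D t \<in> regions" using CD[OF t01] by blast+
    have "\<forall>\<^sub>F s in at t within {0..<t}. B s = c t" "\<forall>\<^sub>F s in at t within {0..<t}. tine \<Gamma> j s \<in> C t"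
      using cd[OF t] CD[OF t01] by blast+
    then show "\<forall>\<^sub>F s in at t within {0..<t}. N s = l t"
      by eventually_elim (simp add: N_def l_def in_iff[OF reg(1)])
    have "\<forall>\<^sub>F s in at t within {t<..1}. B s = d t" "\<forall>\<^sub>F s in at t within {t<..1}. tine \<Gamma> j s \<in> D t"
      using cd[OF t] CD[OF t01] by blast+
    then show "\<forall>\<^sub>F s in at t within {t<..1}. N s = r t"
      by eventually_elim (simp add: N_def r_def in_iff[OF reg(2)])
  next
    have "0 \<notin> edge_params G \<Gamma> j" "1 \<notin> edge_params G \<Gamma> j"
      using edge_params_interior by force+
    then have "tine \<Gamma> j 0 \<in> C 0" "tine \<Gamma> j 1 \<in> D 1" "C 0 \<in> regions" "D 1 \<in> regions"
      using CD[of 0] CD[of 1] by auto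
    then have "C 0 = exterior_face G" "D 1 = exterior_face G"
      using regions_disjoint[OF _ exterior_exists(1)] tine_ends by blast+
    then show "l 0 = N 0" "r 1 = N 1"
      using N01 face_not_exterior by (auto simp: l_def r_def)
  qed
  moreover have "r t - l t = (if t \<in> edge_params G \<Gamma> j then face_weight G j' (edge_at j t)
      else 2 * of_bool (tine \<Gamma> j t \<in> face G j')) * jump j B t" if t: "t \<in> tine_params j" for t
  proof -
    have t01: "t \<in> {0..1}" using tine_params(2) t by blast
    note cdt = cd[OF t] note CDt = CD[OF t01]
    show ?thesis
    proof (cases "t \<in> edge_params G \<Gamma> j")
      case True
      then have s: "sides (edge_at j t) = {C t, D t}" "C t \<noteq> D t" "{c t, d t} = {0, 1}"
        using cdt CDt by simp_all
      have J: "jump j B t = int (d t) - int (c t)"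
        using cdt by simp
      \<comment> \<open>At an edge \<open>2 * B - 1\<close> changes sign, so leaving a face with one
        value and entering a face with the other produce the same jump; this matches incidences
        without signs.\<close>
      have "c t = 0 \<and> d t = 1 \<or> c t = 1 \<and> d t = 0"
        using s(3) by (auto simp: doubleton_eq_iff)
      moreover define x y :: int where "x = of_bool (C t = face G j')" and "y = of_bool (D t = face G j')"
      moreover have "face_weight G j' (edge_at j t) = x + y"
        using s(2) unfolding face_weight_def edge_on_face_iff s(1) x_def y_def
        by (simp add: of_bool_def)
      ultimately have "r t - l t = face_weight G j' (edge_at j t) * jump j B t"
        unfolding J r_def l_def x_def[symmetric] y_def[symmetric] by (elim disjE conjE) simp_all
      then show ?thesis
        using True by simp
    next
      case False
      then have s: "C t = D t" "tine \<Gamma> j t \<in> D t" "D t \<in> regions"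
        using CDt by auto
      have J: "jump j B t = int (d t) - int (c t)"
        using cdt by simp
      \<comment> \<open>Within one region the constant in \<open>2 * B - 1\<close> cancels and the
        jump of \<open>B\<close> is doubled; the 2 is the weight of a thread in that face or of the
        face generator.\<close>
      show ?thesis
        using False unfolding J by (simp add: r_def l_def s(1) in_iff[OF s(3,2)])
    qed
  qed
  ultimately show ?thesis
    using N01 by simp
qed

section \<open>From jumps to the weights of the differential\<close>

lemma sum_tine_params:
  fixes f :: "real \<Rightarrow> int"
  assumes "B \<in> binary_sequences G \<Gamma> j a b"
  shows "(\<Sum>t\<in>tine_params j. f t * jump j B t) =
    (\<Sum>t\<in>edge_params G \<Gamma> j. f t * (if switches_at B t 0 1 then 1 else - 1)) +
    (\<Sum>t\<in>switch_params G \<Gamma> j B. f t) + f (center_param j)"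
proof -
  note d = params_disjoint[of j]
  have "(\<Sum>t\<in>tine_params j. f t * jump j B t) =
      (\<Sum>t\<in>edge_params G \<Gamma> j. f t * jump j B t) + (\<Sum>t\<in>thread_params G \<Gamma> j. f t * jump j B t)
      + f (center_param j) * jump j B (center_param j)"
    unfolding tine_params_def using d finite_edge_params[of j] finite_thread_params[of j]
    by (simp add: sum.union_disjoint)
  also have "(\<Sum>t\<in>edge_params G \<Gamma> j. f t * jump j B t) =
      (\<Sum>t\<in>edge_params G \<Gamma> j. f t * (if switches_at B t 0 1 then 1 else - 1))"
    by (intro sum.cong) (auto simp: jump_def)
  also have "(\<Sum>t\<in>thread_params G \<Gamma> j. f t * jump j B t) = (\<Sum>t\<in>switch_params G \<Gamma> j B. f t)"
  proof (rule sum.mono_neutral_cong_right)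
    show "finite (thread_params G \<Gamma> j)" by (rule finite_thread_params)
    show "switch_params G \<Gamma> j B \<subseteq> thread_params G \<Gamma> j" by (auto simp: switch_params_def)
    have J: "jump j B t = of_bool (\<not> locally_constant_at B t)" if "t \<in> thread_params G \<Gamma> j" for t
      using that d by (auto simp: jump_def)
    show "\<forall>t\<in>thread_params G \<Gamma> j - switch_params G \<Gamma> j B. f t * jump j B t = 0"
      using J by (auto simp: switch_params_def)
    show "\<And>t. t \<in> switch_params G \<Gamma> j B \<Longrightarrow> f t * jump j B t = f t"
      using J by (auto simp: switch_params_def)
  qed
  also have "jump j B (center_param j) = 1"
    using d(2) by (simp add: jump_def)
  finally show ?thesis by simp
qed

text \<open>\<open>f\<close> expresses the weight of a thread through the tine parameter, by way of
  the region that contains the crossing; this brings the weight of the product into the form of the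
  jump sums. Signs have weight zero.\<close>

lemma seq_weight_weighted:
  assumes thread: "\<And>i v. (i, v) \<in> thread_index G \<Longrightarrow>
      coef (thread_weight G \<Gamma> (thread \<Gamma> i v) :: ('e, 'k::comm_ring_1) laurent) \<in> weighted \<omega> \<nu> (\<theta> i)"
    and f: "\<And>t i. t \<in> switch_params G \<Gamma> j B \<Longrightarrow> tine \<Gamma> j t \<in> thread_region i \<Longrightarrow> \<theta> i = f t"
  shows "coef (seq_weight G \<Gamma> j B :: ('e, 'k) laurent) \<in> weighted \<omega> \<nu>
    ((\<Sum>t\<in>edge_params G \<Gamma> j. \<omega> (edge_at j t) * (if switches_at B t 0 1 then 1 else - 1)) +
     (\<Sum>t\<in>switch_params G \<Gamma> j B. f t))"
  unfolding seq_weight_def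
proof (intro weighted_coef_mult weighted_coef_prod)
  fix t
  have "coef (lvar e 1 :: ('e, 'k) laurent) \<in> weighted \<omega> \<nu> (\<omega> e)"
    "coef (lvar e (- 1) :: ('e, 'k) laurent) \<in> weighted \<omega> \<nu> (- \<omega> e)" for e
    using weighted_coef_lvar[of e 1 \<omega> \<nu>] weighted_coef_lvar[of e "- 1" \<omega> \<nu>] by simp_all
  then show "coef (edge_weight G \<Gamma> j B t :: ('e, 'k) laurent)
      \<in> weighted \<omega> \<nu> (\<omega> (edge_at j t) * (if switches_at B t 0 1 then 1 else - 1))"
    unfolding edge_weight_def Let_def edge_at_def by (simp add: weighted_coef_minus)
next
  fix t assume t: "t \<in> switch_params G \<Gamma> j B"
  then have "t \<in> thread_params G \<Gamma> j" by (simp add: switch_params_def)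
  then obtain i v where iv: "(i, v) \<in> thread_index G" "tine \<Gamma> j t \<in> arc_interior (thread \<Gamma> i v)"
    "t \<in> {0..1}" "tine \<Gamma> j t \<in> thread_region i" "thread_at G \<Gamma> (tine \<Gamma> j t) = thread \<Gamma> i v"
    by (rule thread_paramE)
  have "coef (thread_weight G \<Gamma> (thread \<Gamma> i v) :: ('e, 'k) laurent) \<in> weighted \<omega> \<nu> (f t)"
    using thread[OF iv(1)] f[OF t iv(4)] by simp
  then show "coef (let p = thread_at G \<Gamma> (tine \<Gamma> j t) in
        (if crosses_left_to_right p (tine \<Gamma> j) (tine \<Gamma> j t) then 1 else -1) * thread_weight G \<Gamma> p
        :: ('e, 'k) laurent) \<in> weighted \<omega> \<nu> (f t)"
    unfolding Let_def iv(5) by (simp add: weighted_coef_minus)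
qed

text \<open>The weighted jumps sum to zero, but the jump at the center has no factor in the product.
  The missing 2 for the face of the tine is the weight of its generator, so multiplying by that
  generator restores weight 0.\<close>

lemma seq_weight_face:
  assumes B: "B \<in> binary_sequences G \<Gamma> j a b"
  shows "coef (seq_weight G \<Gamma> j B :: ('e, 'k::comm_ring_1) laurent)
    \<in> weighted (face_weight G j') \<nu> (- 2 * of_bool (j = j'))"
proof -
  define f where "f t = (if t \<in> edge_params G \<Gamma> j then face_weight G j' (edge_at j t)
      else 2 * of_bool (tine \<Gamma> j t \<in> face G j'))" for t
  have w: "coef (seq_weight G \<Gamma> j B :: ('e, 'k) laurent) \<in> weighted (face_weight G j') \<nu>
    ((\<Sum>t\<in>edge_params G \<Gamma> j. face_weight G j' (edge_at j t) * (if switches_at B t 0 1 then 1 else - 1)) +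
     (\<Sum>t\<in>switch_params G \<Gamma> j B. f t))"
  proof (rule seq_weight_weighted[OF thread_weight_weighted(1)])
    fix t i assume t: "t \<in> switch_params G \<Gamma> j B" "tine \<Gamma> j t \<in> thread_region i"
    then have "t \<notin> edge_params G \<Gamma> j"
      using params_disjoint(1)[of j] by (auto simp: switch_params_def)
    moreover have "thread_region i = face G j' \<longleftrightarrow> tine \<Gamma> j t \<in> face G j'"
      using regions_disjoint[OF thread_region_regions face_regions(1) t(2)] t(2) by blast
    ultimately show "2 * of_bool (thread_region i = face G j') = f t"
      by (simp add: f_def)
  qed
  have "(\<Sum>t\<in>edge_params G \<Gamma> j. f t * (if switches_at B t 0 1 then 1 else - 1)) +
    (\<Sum>t\<in>switch_params G \<Gamma> j B. f t) + f (center_param j) = 0"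
    using sum_jump_face[OF B, of j'] sum_tine_params[OF B, of f] by (simp add: f_def)
  moreover have "(\<Sum>t\<in>edge_params G \<Gamma> j. f t * (if switches_at B t 0 1 then 1 else - 1)) =
      (\<Sum>t\<in>edge_params G \<Gamma> j. face_weight G j' (edge_at j t) * (if switches_at B t 0 1 then 1 else - 1))"
    by (intro sum.cong) (simp_all add: f_def)
  moreover have "center \<Gamma> j \<in> face G j' \<longleftrightarrow> j = j'"
    using regions_disjoint[OF face_regions(1) face_regions(1) center_in_face] center_in_face face_inj by metis
  then have "f (center_param j) = 2 * of_bool (j = j')"
    using params_disjoint(2)[of j] by (simp add: f_def center_param(2))
  ultimately have "(\<Sum>t\<in>edge_params G \<Gamma> j. face_weight G j' (edge_at j t) * (if switches_at B t 0 1 then 1 else - 1)) +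
     (\<Sum>t\<in>switch_params G \<Gamma> j B. f t) = - 2 * of_bool (j = j')"
    by linarith
  with w show ?thesis by simp
qed

text \<open>With all edge weights equal to 1 the jumps are those of \<open>B\<close>, with sum
  \<open>b - a\<close>; the center accounts for 1 of it, which the generator \<open>Face j\<close>
  restores. The boundary values (1, 0) thus yield -1, the weight of \<open>Y\<close>.\<close>

lemma seq_weight_total:
  assumes B: "B \<in> binary_sequences G \<Gamma> j a b"
  shows "coef (seq_weight G \<Gamma> j B :: ('e, 'k::comm_ring_1) laurent) \<in> weighted (\<lambda>_. 1) \<nu> (int b - int a - 1)"
proof -
  have "coef (seq_weight G \<Gamma> j B :: ('e, 'k) laurent) \<in> weighted (\<lambda>_. 1) \<nu>
    ((\<Sum>t\<in>edge_params G \<Gamma> j. 1 * (if switches_at B t 0 1 then 1 else - 1)) + (\<Sum>t\<in>switch_params G \<Gamma> j B. 1))"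
    by (rule seq_weight_weighted[where \<theta> = "\<lambda>_. 1", OF thread_weight_weighted(2)]) (assumption, rule refl)
  moreover have "(\<Sum>t\<in>edge_params G \<Gamma> j. 1 * (if switches_at B t 0 1 then 1 else - 1)) +
      (\<Sum>t\<in>switch_params G \<Gamma> j B. 1) = int b - int a - 1"
    using sum_jump[OF B] sum_tine_params[OF B, of "\<lambda>_. 1"] by simp
  ultimately show ?thesis by simp
qed

lemma gen_diff_face_weighted:
  "(gen_diff G \<Gamma> g :: ('e, 'f, 'k::comm_ring_1) alg) \<in> weighted (face_weight G j') (gen_face_weight j') (gen_face_weight j' g)"
proof -
  have seq: "(seq_sum G \<Gamma> a b :: ('e, 'f, 'k) alg) \<in> weighted (face_weight G j') (gen_face_weight j') 0" for a b
    unfolding seq_sum_def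
  proof (rule weighted_sum)
    fix j
    have "coef (\<Sum>B\<in>binary_sequences G \<Gamma> j a b. seq_weight G \<Gamma> j B :: ('e, 'k) laurent)
        \<in> weighted (face_weight G j') (gen_face_weight j') (- 2 * of_bool (j = j'))"
      by (intro weighted_coef_sum seq_weight_face)
    from weighted_coef_letter[OF this, of "Face j"]
    show "(coef (\<Sum>B\<in>binary_sequences G \<Gamma> j a b. seq_weight G \<Gamma> j B) * letter (Face j) :: ('e, 'f, 'k) alg)
        \<in> weighted (face_weight G j') (gen_face_weight j') 0"
      by (cases "j = j'") (simp_all add: gen_face_weight_def)
  qed
  show ?thesis
  proof (cases g)
    case (Face j)
    have "coef (\<Sum>v\<in>verts G \<inter> frontier (face G j). thread_weight G \<Gamma> (thread \<Gamma> (Some j) v) :: ('e, 'k) laurent)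
        \<in> weighted (face_weight G j') (gen_face_weight j') (2 * of_bool (thread_region (Some j) = face G j'))"
      by (intro weighted_coef_sum thread_weight_weighted(1)) (auto simp: thread_index_def)
    then show ?thesis
      using Face by (auto simp: gen_face_weight_def thread_region_def face_inj split: if_splits)
  qed (use seq in \<open>simp_all add: gen_face_weight_def\<close>)
qed

lemma gen_diff_total_weighted:
  "(gen_diff G \<Gamma> g :: ('e, 'f, 'k::comm_ring_1) alg) \<in> weighted (\<lambda>_. 1) gen_weight_0 (gen_weight_0 g)"
proof -
  have seq: "(seq_sum G \<Gamma> a b :: ('e, 'f, 'k) alg) \<in> weighted (\<lambda>_. 1) gen_weight_0 (int b - int a)" for a b
    unfolding seq_sum_def
  proof (rule weighted_sum)
    fix j
    have "coef (\<Sum>B\<in>binary_sequences G \<Gamma> j a b. seq_weight G \<Gamma> j B :: ('e, 'k) laurent)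
        \<in> weighted (\<lambda>_. 1) gen_weight_0 (int b - int a - 1)"
      by (intro weighted_coef_sum seq_weight_total)
    from weighted_coef_letter[OF this, of "Face j"]
    show "(coef (\<Sum>B\<in>binary_sequences G \<Gamma> j a b. seq_weight G \<Gamma> j B) * letter (Face j) :: ('e, 'f, 'k) alg)
        \<in> weighted (\<lambda>_. 1) gen_weight_0 (int b - int a)"
      by simp
  qed
  show ?thesis
  proof (cases g)
    case (Face j)
    have "coef (\<Sum>v\<in>verts G \<inter> frontier (face G j). thread_weight G \<Gamma> (thread \<Gamma> (Some j) v) :: ('e, 'k) laurent)
        \<in> weighted (\<lambda>_. 1) gen_weight_0 1"
      by (intro weighted_coef_sum thread_weight_weighted(2)) (auto simp: thread_index_def)
    then show ?thesis
      using Face by simp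
  qed (use seq[of 1 1] seq[of 1 0] seq[of 0 0] in simp_all)
qed

end

section \<open>From integer vectors to exponents, and conclusion\<close>

lemma (in cubic_graph) basis_unimodular:
  assumes T: "graph_basis G v0 T"
  shows "unimodular_complement G T"
  unfolding unimodular_complement_def
proof (intro conjI allI impI)
  fix c :: "'f \<Rightarrow> int" and c0 :: int
  obtain m where m: "\<forall>e\<in>T. m e = 0" "\<forall>j. (\<Sum>e\<in>UNIV. of_bool (edge_on_face G e j) * m e) = c j"
    "(\<Sum>e\<in>UNIV. m e) = c0"
    using basis_weights_surj[OF T] by blast
  \<comment> \<open>Every function on the finite edge type is finitely supported, so it is an
    exponent vector.\<close>
  define n where "n = Abs_poly_mapping m"
  have n: "lookup n = m"
    by (simp add: n_def lookup_Abs_poly_mapping)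
  show "\<exists>m. keys m \<inter> T = {} \<and> (\<forall>j. exp_weight (face_weight G j) m = c j) \<and> exp_weight (\<lambda>_. 1) m = c0"
  proof (intro exI conjI allI)
    show "keys n \<inter> T = {}"
      using m(1) by (auto simp: in_keys_iff n)
    show "exp_weight (face_weight G j) n = c j" for j
      using m(2) by (simp only: exp_weight_def n face_weight_def mult.commute[of "m _"])
    show "exp_weight (\<lambda>_. 1) n = c0"
      using m(3) by (simp add: exp_weight_def n)
  qed
next
  fix m :: "'e \<Rightarrow>\<^sub>0 int"
  assume m: "keys m \<inter> T = {}" "\<forall>j. exp_weight (face_weight G j) m = 0" "exp_weight (\<lambda>_. 1) m = 0"
  have "lookup m = (\<lambda>_. 0)"
  proof (rule basis_weights_inj[OF T])
    show "\<forall>e\<in>T. lookup m e = 0"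
      using m(1) by (auto simp: in_keys_iff)
    show "\<forall>j. (\<Sum>e\<in>UNIV. of_bool (edge_on_face G e j) * lookup m e) = 0"
      using m(2) by (simp only: exp_weight_def face_weight_def mult.commute[of "lookup m _"] simp_thms)
    show "(\<Sum>e\<in>UNIV. lookup m e) = 0"
      using m(3) by (simp add: exp_weight_def)
  qed
  then show "m = 0"
    by (intro poly_mapping_eqI) simp
qed

theorem theorem6p6:
  fixes G :: "('e::finite, 'f::finite) plane_graph"
    and \<Gamma> :: "('e, 'f) garden"
    and v0 :: complex and T :: "'e set"
  assumes "cubic_plane_graph G"
    and "is_garden G \<Gamma>"
    and "graph_basis G v0 T"
  shows "dg_isomorphic (versal_dga G \<Gamma> T :: ('k::field, ('e, 'f, 'k) alg) dga) (invariant_dga G \<Gamma>)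
    \<and> (\<forall>v0' T'. graph_basis G v0' T' \<longrightarrow>
          dg_isomorphic (versal_dga G \<Gamma> T :: ('k, ('e, 'f, 'k) alg) dga) (versal_dga G \<Gamma> T'))"
proof -
  interpret garden_graph G \<Gamma>
    using assms(1,2) by unfold_locales
  have closed: "(garden_diff G \<Gamma> a :: ('e, 'f, 'k) alg) \<in> invariants G" if "a \<in> invariants G" for a
    by (rule garden_diff_invariant[OF gen_diff_face_weighted gen_diff_total_weighted that])
  have 1: "dg_isomorphic (versal_dga G \<Gamma> T :: ('k, ('e, 'f, 'k) alg) dga) (invariant_dga G \<Gamma>)"
    by (rule dg_isomorphic_versal_invariant[OF basis_unimodular[OF assms(3)] closed])
  \<comment> \<open>The invariant algebra does not involve the basis, so it is a common intermediate
    for any two bases.\<close>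
  moreover have "dg_isomorphic (invariant_dga G \<Gamma> :: ('k, ('e, 'f, 'k) alg) dga) (versal_dga G \<Gamma> T')"
    if "graph_basis G v0' T'" for v0' T'
    by (rule dg_isomorphic_invariant_versal[OF basis_unimodular[OF that] closed])
  ultimately show ?thesis
    using dg_isomorphic_trans by blast
qed

end
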